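(* Let $K=[p_1,q_1]\cup[p_2,q_2]\cup[p_3,q_3]$ with $0<p_1<q_1<p_2<q_2<p_3<q_3$. Then $K$ is a wavelet set for $H^2(\mathbb R)$ if and only if for some non-negative integers $r,s,k,l$ both of the following hold. (1) Either [T1]: $[p_1,q_1]\cup([p_2,q_2]-k)\cup([p_3,q_3]-l)=[p_1,p_1+1]$ with $q_1=p_2-k$, $q_2-k=p_3-l$, $q_3-l=p_1+1$; or [T2]: $[p_1,q_1]\cup([p_3,q_3]-l)\cup([p_2,q_2]-k)=[p_1,p_1+1]$ with $q_1=p_3-l$, $q_3-l=p_2-k$, $q_2-k=p_1+1$. (2) Either [D1]: $[p_1,q_1]\cup2^{-r}[p_2,q_2]\cup2^{-s}[p_3,q_3]=[p_1,2p_1]$ with $q_1=2^{-r}p_2$, $2^{-r}q_2=2^{-s}p_3$, $2^{-s}q_3=2p_1$; or [D2]: $[p_1,q_1]\cup2^{-s}[p_3,q_3]\cup2^{-r}[p_2,q_2]=[p_1,2p_1]$ with $q_1=2^{-s}p_3$, $2^{-s}q_3=2^{-r}p_2$, $2^{-r}q_2=2p_1$.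
   Context: Fourier transform: $\widehat f(\xi)=\int_{\mathbb R}f(x)e^{-2\pi i x\xi}\,dx$; $\mathbb R^+=(0,\infty)$. $H^2(\mathbb R)=\{f\in L^2(\mathbb R):\widehat f(\xi)=0\text{ for a.e. }\xi\le 0\}$. A function $\psi\in H^2(\mathbb R)$ is an $H^2$-wavelet if $\{2^{j/2}\psi(2^j\cdot-k):j,k\in\mathbb Z\}$ is an orthonormal basis of $H^2(\mathbb R)$. A measurable set $K\subset\mathbb R^+$ is a wavelet set for $H^2(\mathbb R)$ ($H^2$-wavelet set) if there is an $H^2$-wavelet $\psi$ with $|\widehat\psi|=\chi_K$ a.e. *)

theory Defs
  imports "HOL-Analysis.Analysis"
begin

text \<open>
  Elements of \<open>L\<^sup>2(\<real>)\<close> are represented by square-integrable Lebesgue measurable functions;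
  all notions below are invariant under changes on null sets.
\<close>

definition L2 :: "(real \<Rightarrow> complex) set" where
  "L2 = {f \<in> borel_measurable lebesgue. integrable lebesgue (\<lambda>x. (cmod (f x))\<^sup>2)}"

definition L2_inner :: "(real \<Rightarrow> complex) \<Rightarrow> (real \<Rightarrow> complex) \<Rightarrow> complex" where
  "L2_inner f g = (LINT x|lebesgue. f x * cnj (g x))"

text \<open>
  The squared \<open>L\<^sup>2\<close> distance takes values in the extended nonnegative reals, so that it is infinite
  (rather than 0, as for the Bochner integral) when the difference is not square-integrable.
\<close>

definition L2_dist_sq :: "(real \<Rightarrow> complex) \<Rightarrow> (real \<Rightarrow> complex) \<Rightarrow> ennreal" where
  "L2_dist_sq f g = (\<integral>\<^sup>+x. ennreal ((cmod (f x - g x))\<^sup>2) \<partial>lebesgue)"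

definition fourier_integral :: "(real \<Rightarrow> complex) \<Rightarrow> real \<Rightarrow> complex" where
  "fourier_integral f \<xi> =
     (LINT x|lebesgue. f x * exp (- 2 * of_real pi * \<i> * of_real x * of_real \<xi>))"

text \<open>
  The Fourier integral of an \<open>L\<^sup>2\<close> function need not converge absolutely. As usual, the
  transform on \<open>L\<^sup>2\<close> is the \<open>L\<^sup>2\<close> limit of the Fourier integrals of the truncations to
  \<open>[-n, n]\<close> (which are integrable); it is determined up to a null set.
\<close>

definition fourier :: "(real \<Rightarrow> complex) \<Rightarrow> real \<Rightarrow> complex" where
  "fourier f = (SOME g. g \<in> L2 \<and>
     (\<lambda>n::nat. L2_dist_sq (fourier_integral (\<lambda>x. indicator {- real n..real n} x * f x)) g)
       \<longlonglongrightarrow> 0)"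

definition H2 :: "(real \<Rightarrow> complex) set" where
  "H2 = {f \<in> L2. AE \<xi> in lebesgue. \<xi> \<le> 0 \<longrightarrow> fourier f \<xi> = 0}"

text \<open>An orthonormal family in \<open>V\<close> whose finite linear combinations are dense in \<open>V\<close>.\<close>

definition orthonormal_basis :: "('i \<Rightarrow> real \<Rightarrow> complex) \<Rightarrow> (real \<Rightarrow> complex) set \<Rightarrow> bool" where
  "orthonormal_basis e V \<longleftrightarrow>
     (\<forall>i. e i \<in> V) \<and>
     (\<forall>i j. L2_inner (e i) (e j) = (if i = j then 1 else 0)) \<and>
     (\<forall>f\<in>V. \<forall>\<epsilon>>0. \<exists>F c. finite F \<and> L2_dist_sq f (\<lambda>x. \<Sum>i\<in>F. c i * e i x) < \<epsilon>)"

definition wavelet_system :: "(real \<Rightarrow> complex) \<Rightarrow> int \<times> int \<Rightarrow> real \<Rightarrow> complex" where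
  "wavelet_system \<psi> = (\<lambda>(j, k) x. of_real (2 powr (of_int j / 2)) * \<psi> (2 powi j * x - of_int k))"

definition H2_wavelet :: "(real \<Rightarrow> complex) \<Rightarrow> bool" where
  "H2_wavelet \<psi> \<longleftrightarrow> \<psi> \<in> H2 \<and> orthonormal_basis (wavelet_system \<psi>) H2"

definition H2_wavelet_set :: "real set \<Rightarrow> bool" where
  "H2_wavelet_set K \<longleftrightarrow> K \<in> sets lebesgue \<and> K \<subseteq> {0<..} \<and>
     (\<exists>\<psi>. H2_wavelet \<psi> \<and> (AE \<xi> in lebesgue. cmod (fourier \<psi> \<xi>) = indicator K \<xi>))"

end

theory Submission
  imports Defs
begin

text \<open>
  Write \<open>e(t) = exp (2\<pi>it)\<close>. On the frequency side the wavelet system of \<open>\<psi>\<close> consists of the functions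
  \<open>2\<^sup>-\<^sup>j\<^sup>/\<^sup>2 e(-k\<xi>/2\<^sup>j) \<Psi>(\<xi>/2\<^sup>j)\<close> where \<open>\<Psi>\<close> is the transform of \<open>\<psi>\<close>, and \<open>H2\<close> becomes the space of
  square-integrable functions on the positive half-line. When \<open>|\<Psi>|\<close> is the indicator of \<open>K\<close>, the system is
  an orthonormal basis exactly when the integer translates of \<open>K\<close> tile the line and the dyadic
  dilates of \<open>K\<close> tile the half-line, up to null sets.

  The first tiling comes from scale \<open>j = 0\<close>: orthonormality of the translates says that
  \<open>\<integral>\<^sub>K e(k\<xi>) d\<xi>\<close> is \<open>1\<close> for \<open>k = 0\<close> and \<open>0\<close> otherwise. For three intervals \<open>[p\<^sub>i, q\<^sub>i]\<close> and \<open>k \<noteq> 0\<close>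
  it is a nonzero multiple of \<open>\<Sum>\<^sub>i (e(kq\<^sub>i) - e(kp\<^sub>i))\<close>, so the numbers \<open>e(q\<^sub>i)\<close> and \<open>e(p\<^sub>i)\<close> have the same power sums and
  agree up to a permutation. As the lengths add up to \<open>1\<close>, no interval has integer length; hence
  the permutation has no fixed point and is one of the two 3-cycles. These are the arrangements T1 and
  T2 (\<open>three_intervals_consecutive\<close>). Conversely, either arrangement makes the translates tile
  (\<open>three_intervals_tile\<close>).

  Once \<open>K\<close> tiles by translations, the trigonometric polynomials are dense on \<open>K\<close>
  (\<open>trig_poly_dense_tile\<close>), so the functions of scale \<open>0\<close> already span everything supported on \<open>K\<close>.
  Orthogonality between scales therefore forces \<open>K\<close> and \<open>2\<^sup>jK\<close> to be disjoint up to a null set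
  (\<open>H2_wavelet_dilates_disjoint\<close>), and completeness forces the dilates to cover the half-line
  (\<open>H2_wavelet_dilates_cover\<close>). Conversely the two tilings make the system with \<open>\<Psi>\<close> the indicator of \<open>K\<close>
  an orthonormal basis (\<open>H2_wavelet_set_of_tiles\<close>).

  Dyadic dilates of \<open>K\<close> tile the half-line if and only if integer translates of \<open>log\<^sub>2 K\<close> tile the line.
  Since \<open>log\<^sub>2 K\<close> is again a union of three intervals, the same endpoint argument applies to
  it, and its two arrangements are D1 and D2.

  The transfer to the frequency side needs Plancherel's theorem. Density of the trigonometric
  polynomials gives Parseval's identity on \<open>[0,1]\<close>; applied to \<open>f(x) e(-x\<xi>)\<close> it reads
  \<open>\<Sum>\<^sub>k |F(\<xi> + k)|\<^sup>2 = \<parallel>f\<parallel>\<^sup>2\<close> for the Fourier integral \<open>F\<close> of \<open>f\<close>, and integration over \<open>\<xi>\<close> in \<open>[0,1]\<close>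
  shows \<open>\<parallel>F\<parallel> = \<parallel>f\<parallel>\<close> (\<open>Plancherel_unit_interval\<close>). Scaling, completeness and the multiplication formula
  extend this to a surjective isometry (\<open>Plancherel\<close>, \<open>fourier_surj\<close>).
\<close>

section \<open>Square-integrable functions\<close>

text \<open>
  The norm is meaningful on \<open>L2\<close> only: a Bochner integral that does not converge is \<open>0\<close> by convention.
\<close>

definition norm2 :: "(real \<Rightarrow> complex) \<Rightarrow> real" where
  "norm2 f = sqrt (LINT x|lebesgue. (cmod (f x))\<^sup>2)"

lemma borel_measurable_cnj [measurable (raw)]:
  "f \<in> borel_measurable M \<Longrightarrow> (\<lambda>x. cnj (f x)) \<in> borel_measurable M"
  by (rule measurable_compose[where N = borel]) (auto intro: borel_measurable_continuous_onI continuous_intros)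

lemma L2_measurable [measurable_dest]: "f \<in> L2 \<Longrightarrow> f \<in> borel_measurable lebesgue"
  by (simp add: L2_def)

lemma L2_integrable_sq: "f \<in> L2 \<Longrightarrow> integrable lebesgue (\<lambda>x. (cmod (f x))\<^sup>2)"
  by (simp add: L2_def)

lemma norm2_nonneg [simp]: "0 \<le> norm2 f"
  by (simp add: norm2_def)

lemma norm2_sq: "(norm2 f)\<^sup>2 = (LINT x|lebesgue. (cmod (f x))\<^sup>2)"
  by (simp add: norm2_def)

lemma L2_dominated:
  assumes "g \<in> L2" "f \<in> borel_measurable lebesgue" "AE x in lebesgue. cmod (f x) \<le> C * cmod (g x)"
  shows "f \<in> L2"
proof -
  have "integrable lebesgue (\<lambda>x. C\<^sup>2 * (cmod (g x))\<^sup>2)"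
    using L2_integrable_sq[OF assms(1)] by simp
  then have "integrable lebesgue (\<lambda>x. (cmod (f x))\<^sup>2)"
  proof (rule Bochner_Integration.integrable_bound)
    show "AE x in lebesgue. norm ((cmod (f x))\<^sup>2) \<le> norm (C\<^sup>2 * (cmod (g x))\<^sup>2)"
      using assms(3)
    proof eventually_elim
      case (elim x)
      then have "(cmod (f x))\<^sup>2 \<le> (C * cmod (g x))\<^sup>2"
        by (intro power_mono) auto
      then show ?case by (simp add: power_mult_distrib)
    qed
  qed (use assms in measurable)
  then show ?thesis using assms(2) by (simp add: L2_def)
qed

lemma L2_zero [simp]: "(\<lambda>x. 0) \<in> L2"
  by (simp add: L2_def)

lemma L2_bounded_mult:
  assumes "f \<in> L2" "m \<in> borel_measurable lebesgue" "\<And>x. cmod (m x) \<le> C"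
  shows "(\<lambda>x. m x * f x) \<in> L2"
  by (rule L2_dominated[OF assms(1), of _ C])
     (use assms in \<open>auto simp: norm_mult intro!: mult_right_mono\<close>)

lemma L2_scale: "f \<in> L2 \<Longrightarrow> (\<lambda>x. c * f x) \<in> L2"
  by (rule L2_bounded_mult[of _ _ "cmod c"]) auto

lemma L2_indicator: "f \<in> L2 \<Longrightarrow> A \<in> sets lebesgue \<Longrightarrow> (\<lambda>x. indicator A x * f x) \<in> L2"
  by (rule L2_bounded_mult[of _ _ 1]) (auto simp: indicator_def)

lemma L2_cnj: "f \<in> L2 \<Longrightarrow> (\<lambda>x. cnj (f x)) \<in> L2"
  by (rule L2_dominated[of f _ 1]) auto

text \<open>
  The free weight \<open>t\<close> is what makes this inequality useful under an integral: integrating first and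
  optimizing \<open>t\<close> afterwards yields the triangle inequality for \<open>norm2\<close>.
\<close>

lemma norm_add_sq_le:
  fixes a b :: complex assumes "t > 0"
  shows "(cmod (a + b))\<^sup>2 \<le> (1 + t) * (cmod a)\<^sup>2 + (1 + 1 / t) * (cmod b)\<^sup>2"
proof -
  have "(cmod (a + b))\<^sup>2 \<le> (cmod a + cmod b)\<^sup>2"
    by (intro power_mono norm_triangle_ineq) auto
  also have "\<dots> = (1 + t) * (cmod a)\<^sup>2 + (1 + 1 / t) * (cmod b)\<^sup>2 - (t * cmod a - cmod b)\<^sup>2 / t"
    using assms by (simp add: field_simps power2_eq_square)
  finally show ?thesis using assms by (smt (verit) divide_nonneg_pos zero_le_power2)
qed

lemma L2_add:
  assumes "f \<in> L2" "g \<in> L2" shows "(\<lambda>x. f x + g x) \<in> L2"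
proof -
  have "integrable lebesgue (\<lambda>x. (1 + 1) * (cmod (f x))\<^sup>2 + (1 + 1 / 1) * (cmod (g x))\<^sup>2)"
    using L2_integrable_sq assms by (intro Bochner_Integration.integrable_add integrable_mult_right) auto
  then have "integrable lebesgue (\<lambda>x. (cmod (f x + g x))\<^sup>2)"
    by (rule Bochner_Integration.integrable_bound)
       (use assms norm_add_sq_le[of 1] in \<open>auto intro!: AE_I2\<close>)
  then show ?thesis using assms by (auto simp: L2_def)
qed

lemma L2_uminus: "f \<in> L2 \<Longrightarrow> (\<lambda>x. - f x) \<in> L2"
  using L2_scale[of f "-1"] by simp

lemma L2_diff: "f \<in> L2 \<Longrightarrow> g \<in> L2 \<Longrightarrow> (\<lambda>x. f x - g x) \<in> L2"
  using L2_add[OF _ L2_uminus] by simp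

lemma L2_sum: "(\<And>i. i \<in> F \<Longrightarrow> f i \<in> L2) \<Longrightarrow> (\<lambda>x. \<Sum>i\<in>F. f i x) \<in> L2"
  by (induction F rule: infinite_finite_induct) (auto intro: L2_add)

lemmas L2_intros = L2_add L2_diff L2_uminus L2_sum L2_scale L2_indicator L2_cnj L2_zero

lemma norm2_cong_AE:
  assumes "f \<in> borel_measurable lebesgue" "g \<in> borel_measurable lebesgue"
    "AE x in lebesgue. cmod (f x) = cmod (g x)"
  shows "norm2 f = norm2 g"
  unfolding norm2_def using assms
  by (intro arg_cong[where f = sqrt] integral_cong_AE) auto

lemma norm2_mono:
  assumes "g \<in> L2" "f \<in> borel_measurable lebesgue" "AE x in lebesgue. cmod (f x) \<le> cmod (g x)"
  shows "norm2 f \<le> norm2 g"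
proof -
  have "f \<in> L2" using L2_dominated[OF assms(1,2), of 1] assms(3) by simp
  then show ?thesis
    unfolding norm2_def using assms
    by (intro real_sqrt_le_mono integral_mono_AE L2_integrable_sq) (auto elim!: eventually_mono)
qed

lemma norm2_scale: "norm2 (\<lambda>x. c * f x) = cmod c * norm2 f"
  by (simp add: norm2_def norm_mult power_mult_distrib real_sqrt_mult)

lemma norm2_uminus [simp]: "norm2 (\<lambda>x. - f x) = norm2 f"
  by (simp add: norm2_def)

lemma norm2_minus_commute: "norm2 (\<lambda>x. f x - g x) = norm2 (\<lambda>x. g x - f x)"
  by (simp add: norm2_def norm_minus_commute)

lemma norm2_zero [simp]: "norm2 (\<lambda>x. 0) = 0"
  by (simp add: norm2_def)

lemma norm2_eq_0_iff:
  assumes "f \<in> L2" shows "norm2 f = 0 \<longleftrightarrow> (AE x in lebesgue. f x = 0)"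
  using integral_nonneg_eq_0_iff_AE[OF L2_integrable_sq[OF assms]]
  by (simp add: norm2_def)

lemma norm2_add_sq_le:
  assumes "f \<in> L2" "g \<in> L2" "t > 0"
  shows "(norm2 (\<lambda>x. f x + g x))\<^sup>2 \<le> (1 + t) * (norm2 f)\<^sup>2 + (1 + 1 / t) * (norm2 g)\<^sup>2"
proof -
  have "(norm2 (\<lambda>x. f x + g x))\<^sup>2
      \<le> (LINT x|lebesgue. (1 + t) * (cmod (f x))\<^sup>2 + (1 + 1 / t) * (cmod (g x))\<^sup>2)"
    unfolding norm2_sq using assms norm_add_sq_le[OF assms(3)]
    by (intro integral_mono L2_integrable_sq L2_add Bochner_Integration.integrable_add
        integrable_mult_right) auto
  also have "\<dots> = (1 + t) * (norm2 f)\<^sup>2 + (1 + 1 / t) * (norm2 g)\<^sup>2"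
    unfolding norm2_sq using assms
    by (subst Bochner_Integration.integral_add) (auto intro!: L2_integrable_sq)
  finally show ?thesis .
qed

lemma norm2_triangle:
  assumes "f \<in> L2" "g \<in> L2"
  shows "norm2 (\<lambda>x. f x + g x) \<le> norm2 f + norm2 g"
proof (cases "norm2 f = 0 \<or> norm2 g = 0")
  case True
  then show ?thesis
  proof
    assume "norm2 f = 0"
    then have "AE x in lebesgue. f x = 0" using norm2_eq_0_iff assms by blast
    then have "norm2 (\<lambda>x. f x + g x) = norm2 g"
      using assms by (intro norm2_cong_AE) auto
    then show ?thesis using \<open>norm2 f = 0\<close> by simp
  next
    assume "norm2 g = 0"
    then have "AE x in lebesgue. g x = 0" using norm2_eq_0_iff assms by blast
    then have "norm2 (\<lambda>x. f x + g x) = norm2 f"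
      using assms by (intro norm2_cong_AE) auto
    then show ?thesis using \<open>norm2 g = 0\<close> by simp
  qed
next
  case False
  then have pos: "norm2 f > 0" "norm2 g > 0"
    using norm2_nonneg[of f] norm2_nonneg[of g] by linarith+
  \<comment> \<open>The weight \<open>norm2 g / norm2 f\<close> minimizes the bound; it is positive because neither norm vanishes.\<close>
  have "(norm2 (\<lambda>x. f x + g x))\<^sup>2
      \<le> (1 + norm2 g / norm2 f) * (norm2 f)\<^sup>2 + (1 + 1 / (norm2 g / norm2 f)) * (norm2 g)\<^sup>2"
    using assms pos by (intro norm2_add_sq_le) auto
  also have "\<dots> = (norm2 f + norm2 g)\<^sup>2"
    using pos by (simp add: field_simps power2_eq_square)
  finally show ?thesis using pos by (simp add: power2_le_iff_abs_le)
qed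

lemma norm2_triangle_diff:
  assumes "f \<in> L2" "g \<in> L2" "h \<in> L2"
  shows "norm2 (\<lambda>x. f x - h x) \<le> norm2 (\<lambda>x. f x - g x) + norm2 (\<lambda>x. g x - h x)"
  using norm2_triangle[of "\<lambda>x. f x - g x" "\<lambda>x. g x - h x"] assms by (auto intro: L2_intros)

lemma norm2_diff_abs:
  assumes "f \<in> L2" "g \<in> L2"
  shows "\<bar>norm2 f - norm2 g\<bar> \<le> norm2 (\<lambda>x. f x - g x)"
proof -
  have "norm2 f \<le> norm2 (\<lambda>x. f x - g x) + norm2 g"
    using norm2_triangle[of "\<lambda>x. f x - g x" g] assms L2_diff by auto
  moreover have "norm2 g \<le> norm2 (\<lambda>x. g x - f x) + norm2 f"
    using norm2_triangle[of "\<lambda>x. g x - f x" f] assms L2_diff by auto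
  ultimately show ?thesis using norm2_minus_commute[of f g] by linarith
qed

lemma L2_dist_sq_eq:
  assumes "f \<in> L2" "g \<in> L2"
  shows "L2_dist_sq f g = ennreal ((norm2 (\<lambda>x. f x - g x))\<^sup>2)"
  unfolding L2_dist_sq_def norm2_sq
  by (rule nn_integral_eq_integral) (use L2_integrable_sq[OF L2_diff[OF assms]] in auto)

lemma L2_dist_sq_tendsto_0_iff:
  assumes "\<And>n. f n \<in> L2" "g \<in> L2"
  shows "(\<lambda>n. L2_dist_sq (f n) g) \<longlonglongrightarrow> 0 \<longleftrightarrow> (\<lambda>n. norm2 (\<lambda>x. f n x - g x)) \<longlonglongrightarrow> 0"
proof -
  have "(\<lambda>n. L2_dist_sq (f n) g) \<longlonglongrightarrow> 0 \<longleftrightarrow>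
      (\<lambda>n. (norm2 (\<lambda>x. f n x - g x))\<^sup>2) \<longlonglongrightarrow> 0"
    unfolding L2_dist_sq_eq[OF assms] using tendsto_ennreal_iff[of _ sequentially 0] by simp
  also have "\<dots> \<longleftrightarrow> (\<lambda>n. norm2 (\<lambda>x. f n x - g x)) \<longlonglongrightarrow> 0"
    by (auto dest: tendsto_real_sqrt simp: power2_eq_square tendsto_mult_zero)
  finally show ?thesis .
qed

lemma L2_integrable_product:
  assumes "f \<in> L2" "g \<in> L2" shows "integrable lebesgue (\<lambda>x. f x * g x)"
proof -
  have "integrable lebesgue (\<lambda>x. (cmod (f x))\<^sup>2 + (cmod (g x))\<^sup>2)"
    using assms by (intro Bochner_Integration.integrable_add L2_integrable_sq)
  then show ?thesis
  proof (rule Bochner_Integration.integrable_bound)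
    have "cmod a * cmod b \<le> (cmod a)\<^sup>2 + (cmod b)\<^sup>2" for a b
      using sum_squares_bound[of "cmod a" "cmod b"] mult_nonneg_nonneg[OF norm_ge_zero[of a] norm_ge_zero[of b]]
      by linarith
    then show "AE x in lebesgue. norm (f x * g x) \<le> norm ((cmod (f x))\<^sup>2 + (cmod (g x))\<^sup>2)"
      by (simp add: norm_mult)
  qed (use assms in measurable)
qed

lemma L2_inner_integrable:
  "f \<in> L2 \<Longrightarrow> g \<in> L2 \<Longrightarrow> integrable lebesgue (\<lambda>x. f x * cnj (g x))"
  by (intro L2_integrable_product L2_cnj)

lemma L2_inner_diff_left:
  "f \<in> L2 \<Longrightarrow> g \<in> L2 \<Longrightarrow> h \<in> L2 \<Longrightarrow> L2_inner (\<lambda>x. f x - g x) h = L2_inner f h - L2_inner g h"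
  unfolding L2_inner_def left_diff_distrib
  by (intro Bochner_Integration.integral_diff L2_inner_integrable)

lemma L2_inner_scale_left: "L2_inner (\<lambda>x. c * f x) g = c * L2_inner f g"
  unfolding L2_inner_def by (simp add: mult.assoc)

lemma L2_inner_sum_left:
  assumes "\<And>i. i \<in> F \<Longrightarrow> f i \<in> L2" "g \<in> L2"
  shows "L2_inner (\<lambda>x. \<Sum>i\<in>F. f i x) g = (\<Sum>i\<in>F. L2_inner (f i) g)"
  unfolding L2_inner_def sum_distrib_right using assms
  by (intro Bochner_Integration.integral_sum L2_inner_integrable) auto

lemma L2_inner_commute: "L2_inner f g = cnj (L2_inner g f)"
proof -
  have "cnj (L2_inner g f) = (LINT x|lebesgue. cnj (g x * cnj (f x)))"
    unfolding L2_inner_def by (rule Bochner_Integration.integral_cnj[symmetric])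
  then show ?thesis by (simp add: L2_inner_def mult.commute)
qed

lemma L2_inner_self: "L2_inner f f = of_real ((norm2 f)\<^sup>2)"
  unfolding L2_inner_def norm2_sq complex_norm_square[symmetric] by (simp del: of_real_power)

lemma L2_inner_cong_AE:
  assumes "f \<in> borel_measurable lebesgue" "f' \<in> borel_measurable lebesgue"
    "g \<in> borel_measurable lebesgue" "g' \<in> borel_measurable lebesgue"
    "AE x in lebesgue. f x = f' x" "AE x in lebesgue. g x = g' x"
  shows "L2_inner f g = L2_inner f' g'"
  unfolding L2_inner_def using assms by (intro integral_cong_AE) auto

lemma norm2_diff_sq:
  assumes "f \<in> L2" "g \<in> L2"
  shows "(norm2 (\<lambda>x. f x - g x))\<^sup>2 = (norm2 f)\<^sup>2 - 2 * Re (L2_inner f g) + (norm2 g)\<^sup>2"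
proof -
  have "complex_of_real ((norm2 (\<lambda>x. f x - g x))\<^sup>2) = L2_inner (\<lambda>x. f x - g x) (\<lambda>x. f x - g x)"
    by (simp add: L2_inner_self)
  also have "\<dots> = L2_inner f (\<lambda>x. f x - g x) - L2_inner g (\<lambda>x. f x - g x)"
    using assms by (intro L2_inner_diff_left L2_intros)
  also have "\<dots> = cnj (L2_inner (\<lambda>x. f x - g x) f) - cnj (L2_inner (\<lambda>x. f x - g x) g)"
    by (simp add: L2_inner_commute[of f] L2_inner_commute[of g])
  also have "\<dots> = cnj (L2_inner f f - L2_inner g f) - cnj (L2_inner f g - L2_inner g g)"
    using assms by (simp add: L2_inner_diff_left)
  finally have "(norm2 (\<lambda>x. f x - g x))\<^sup>2 = Re \<dots>" 
    by (metis Re_complex_of_real)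
  then show ?thesis
    using L2_inner_commute[of f g] by (simp add: L2_inner_self del: of_real_power)
qed

text \<open>
  After multiplying \<open>f\<close> by a unimodular constant the inner product is real and nonnegative; then
  the expansion of the squared norm of the sum is bounded by the triangle inequality.
\<close>

lemma L2_Cauchy_Schwarz:
  assumes "f \<in> L2" "g \<in> L2"
  shows "cmod (L2_inner f g) \<le> norm2 f * norm2 g"
proof (cases "L2_inner f g = 0")
  case False
  define c where "c = cnj (sgn (L2_inner f g))"
  have c: "cmod c = 1" using False by (simp add: c_def norm_sgn)
  have ip: "c * L2_inner f g = of_real (cmod (L2_inner f g))"
    using False unfolding c_def sgn_eq
    by (simp add: complex_norm_square[symmetric] mult.commute[of "cnj _"] power2_eq_square)
  \<comment> \<open>The norm of \<open>f\<close> is unchanged, while \<open>L2_inner f' g\<close> is the modulus of \<open>L2_inner f g\<close>.\<close>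
  define f' where "f' = (\<lambda>x. c * f x)"
  have f': "f' \<in> L2" using assms by (simp add: f'_def L2_scale)
  have "L2_inner f' (\<lambda>x. - g x) = - of_real (cmod (L2_inner f g))"
    using ip L2_inner_scale_left[of c f g] by (simp add: f'_def L2_inner_def)
  then have "(norm2 (\<lambda>x. f' x + g x))\<^sup>2 = (norm2 f)\<^sup>2 + 2 * cmod (L2_inner f g) + (norm2 g)\<^sup>2"
    using norm2_diff_sq[OF f' L2_uminus[OF assms(2)]] c by (simp add: norm2_scale f'_def)
  moreover have "(norm2 (\<lambda>x. f' x + g x))\<^sup>2 \<le> (norm2 f' + norm2 g)\<^sup>2"
    using norm2_triangle[OF f' assms(2)] by (intro power_mono) auto
  moreover have "norm2 f' = norm2 f" using c by (simp add: norm2_scale f'_def)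
  ultimately show ?thesis by (simp add: power2_sum)
qed (simp add: assms)

section \<open>Convergence in mean square\<close>

lemma L2_dominated_convergence:
  assumes "w \<in> L2" "\<And>n. d n \<in> borel_measurable lebesgue"
    "\<And>n. AE x in lebesgue. cmod (d n x) \<le> cmod (w x)"
    "AE x in lebesgue. (\<lambda>n. d n x) \<longlonglongrightarrow> 0"
  shows "(\<lambda>n. norm2 (d n)) \<longlonglongrightarrow> 0"
proof -
  have "(\<lambda>n. LINT x|lebesgue. (cmod (d n x))\<^sup>2) \<longlonglongrightarrow> (LINT x|(lebesgue :: real measure). 0 :: real)"
  proof (rule integral_dominated_convergence[where w = "\<lambda>x. (cmod (w x))\<^sup>2"])
    show "integrable lebesgue (\<lambda>x. (cmod (w x))\<^sup>2)" by (rule L2_integrable_sq[OF assms(1)])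
    show "AE x in lebesgue. (\<lambda>n. (cmod (d n x))\<^sup>2) \<longlonglongrightarrow> 0"
      using assms(4)
    proof eventually_elim
      case (elim x)
      then have "(\<lambda>n. (cmod (d n x))\<^sup>2) \<longlonglongrightarrow> (cmod 0)\<^sup>2" by (intro tendsto_intros)
      then show ?case by simp
    qed
    show "AE x in lebesgue. norm ((cmod (d n x))\<^sup>2) \<le> (cmod (w x))\<^sup>2" for n
      using assms(3)[of n] by eventually_elim (auto intro: power_mono)
  qed (use assms(2) in measurable)
  from tendsto_real_sqrt[OF this] show ?thesis by (simp add: norm2_def)
qed

lemma L2_truncation_tendsto:
  assumes "f \<in> L2"
  shows "(\<lambda>n. norm2 (\<lambda>x. indicator {- real n..real n} x * f x - f x)) \<longlonglongrightarrow> 0"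
proof (rule L2_dominated_convergence[OF assms])
  show "AE x in lebesgue. (\<lambda>n. indicator {- real n..real n} x * f x - f x) \<longlonglongrightarrow> 0"
  proof (rule AE_I2)
    fix x :: real
    obtain N :: nat where "\<bar>x\<bar> \<le> real N" using real_arch_simple by blast
    then have "eventually (\<lambda>n. indicator {- real n..real n} x * f x - f x = 0) sequentially"
      by (intro eventually_sequentiallyI[of N]) (auto simp: indicator_def)
    then show "(\<lambda>n. indicator {- real n..real n} x * f x - f x) \<longlonglongrightarrow> 0"
      by (simp add: tendsto_eventually)
  qed
next
  show "AE x in lebesgue. cmod (indicator {- real n..real n} x * f x - f x) \<le> cmod (f x)" for n
    by (auto simp: indicator_def)
  show "(\<lambda>x. indicator {- real n..real n} x * f x - f x) \<in> borel_measurable lebesgue" for n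
    using assms by (intro L2_measurable L2_diff L2_indicator) auto
qed

text \<open>
  The Riesz-Fischer argument: a subsequence with rapidly decreasing increments converges almost
  everywhere, and Fatou's lemma turns its pointwise limit into a limit in mean square.
\<close>

lemma L2_complete:
  assumes f: "\<And>n. f n \<in> L2"
    and cauchy: "\<And>\<epsilon>. \<epsilon> > 0 \<Longrightarrow> \<exists>N. \<forall>m\<ge>N. \<forall>n\<ge>N. norm2 (\<lambda>x. f m x - f n x) < \<epsilon>"
  obtains g where "g \<in> L2" "(\<lambda>n. norm2 (\<lambda>x. f n x - g x)) \<longlonglongrightarrow> 0"
proof -
  note f[THEN L2_measurable, measurable]
  have "\<exists>M. \<forall>k. \<forall>m\<ge>M k. \<forall>n\<ge>M k. norm2 (\<lambda>x. f m x - f n x) < (1/2) ^ k"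
    by (intro choice allI cauchy) auto
  then obtain M where M: "\<And>k m n. m \<ge> M k \<Longrightarrow> n \<ge> M k \<Longrightarrow> norm2 (\<lambda>x. f m x - f n x) < (1/2) ^ k"
    by blast
  \<comment> \<open>Summing makes the indices monotone while keeping them beyond \<open>M k\<close>.\<close>
  define r where "r = (\<lambda>k. \<Sum>i\<le>k. M i)"
  have r_mono: "r j \<le> r k" if "j \<le> k" for j k
    unfolding r_def using that by (intro sum_mono2) auto
  have r_ge: "M k \<le> r k" for k
    unfolding r_def by (intro member_le_sum) auto
  define d where "d = (\<lambda>k x. f (r (Suc k)) x - f (r k) x)"
  have d_L2: "d k \<in> L2" for k unfolding d_def by (intro L2_diff f)
  note d_L2[THEN L2_measurable, measurable]
  have d_le: "norm2 (d k) \<le> (1/2) ^ k" for k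
    unfolding d_def using M[of k "r (Suc k)" "r k"] r_ge[of k] r_mono[of k "Suc k"] by simp
  \<comment> \<open>The increments have norm at most \<open>(1/2) ^ k\<close>, so the squares may be weighted by \<open>2 ^ k\<close> and
    still have a finite sum; pointwise this controls the sum of the increments themselves.\<close>
  have "(\<integral>\<^sup>+x. (\<Sum>k. ennreal (2 ^ k * (cmod (d k x))\<^sup>2)) \<partial>lebesgue)
      = (\<Sum>k. \<integral>\<^sup>+x. ennreal (2 ^ k * (cmod (d k x))\<^sup>2) \<partial>lebesgue)"
    by (rule nn_integral_suminf) measurable
  also have "\<dots> \<le> (\<Sum>k. ennreal ((1/2) ^ k))"
  proof (rule suminf_le)
    fix k
    have "(\<integral>\<^sup>+x. ennreal (2 ^ k * (cmod (d k x))\<^sup>2) \<partial>lebesgue)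
        = ennreal (LINT x|lebesgue. 2 ^ k * (cmod (d k x))\<^sup>2)"
      by (rule nn_integral_eq_integral) (use L2_integrable_sq[OF d_L2] in auto)
    also have "\<dots> = ennreal (2 ^ k * (norm2 (d k))\<^sup>2)" by (simp add: norm2_sq)
    also have "\<dots> \<le> ennreal (2 ^ k * ((1/2) ^ k)\<^sup>2)"
      using d_le by (intro ennreal_leI mult_left_mono power_mono) auto
    also have "2 ^ k * ((1/2) ^ k)\<^sup>2 = ((1/2) ^ k :: real)"
      by (simp add: power2_eq_square power_one_over)
    finally show "(\<integral>\<^sup>+x. ennreal (2 ^ k * (cmod (d k x))\<^sup>2) \<partial>lebesgue) \<le> ennreal ((1/2) ^ k)" .
  qed auto
  also have "\<dots> = ennreal (\<Sum>k. (1/2) ^ k)"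
    by (rule suminf_ennreal2) auto
  also have "\<dots> < \<infinity>" by simp
  finally have "(\<integral>\<^sup>+x. (\<Sum>k. ennreal (2 ^ k * (cmod (d k x))\<^sup>2)) \<partial>lebesgue) \<noteq> \<infinity>" by simp
  then have "AE x in lebesgue. (\<Sum>k. ennreal (2 ^ k * (cmod (d k x))\<^sup>2)) \<noteq> \<infinity>"
    by (rule nn_integral_PInf_AE[rotated]) measurable
  then have conv: "AE x in lebesgue. convergent (\<lambda>k. f (r k) x)"
  proof eventually_elim
    case (elim x)
    then have "summable (\<lambda>k. 2 ^ k * (cmod (d k x))\<^sup>2)"
      by (intro summable_suminf_not_top) auto
    then have s: "summable (\<lambda>k. 2 ^ k * (cmod (d k x))\<^sup>2 + (1/2) ^ k)"
      by (intro summable_add) auto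
    have "cmod (d k x) \<le> 2 ^ k * (cmod (d k x))\<^sup>2 + (1/2) ^ k" for k
    proof -
      have "0 \<le> (2 ^ k * cmod (d k x) - 1)\<^sup>2 + 2 ^ k * cmod (d k x)" by simp
      then have "2 ^ k * cmod (d k x) \<le> 2 ^ k * (2 ^ k * (cmod (d k x))\<^sup>2 + (1/2) ^ k)"
        by (simp add: power2_eq_square algebra_simps power_one_over)
      then show ?thesis by simp
    qed
    then have "summable (\<lambda>k. d k x)"
      by (intro summable_comparison_test[OF _ s]) auto
    then have "convergent (\<lambda>n. \<Sum>k<n. d k x)" by (simp add: summable_iff_convergent)
    then have "convergent (\<lambda>n. (\<Sum>k<n. d k x) + f (r 0) x)"
      by (intro convergent_add convergent_const)
    moreover have "(\<Sum>k<n. d k x) + f (r 0) x = f (r n) x" for n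
      unfolding d_def by (subst sum_lessThan_telescope) simp
    ultimately show ?case by simp
  qed
  define g where "g = (\<lambda>x. lim (\<lambda>k. f (r k) x))"
  have g_meas [measurable]: "g \<in> borel_measurable lebesgue"
    unfolding g_def by measurable
  have tail: "(\<integral>\<^sup>+x. ennreal ((cmod (f n x - g x))\<^sup>2) \<partial>lebesgue) \<le> ennreal (((1/2) ^ j)\<^sup>2)"
    if "n \<ge> M j" for n j
  proof -
    have "(\<integral>\<^sup>+x. ennreal ((cmod (f n x - g x))\<^sup>2) \<partial>lebesgue)
        = (\<integral>\<^sup>+x. liminf (\<lambda>k. ennreal ((cmod (f n x - f (r k) x))\<^sup>2)) \<partial>lebesgue)"
    proof (rule nn_integral_cong_AE, use conv in eventually_elim)
      case (elim x)
      then have "(\<lambda>k. f (r k) x) \<longlonglongrightarrow> g x"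
        by (simp add: g_def convergent_LIMSEQ_iff)
      then have "(\<lambda>k. ennreal ((cmod (f n x - f (r k) x))\<^sup>2)) \<longlonglongrightarrow> ennreal ((cmod (f n x - g x))\<^sup>2)"
        by (intro tendsto_intros)
      then show ?case by (intro lim_imp_Liminf[symmetric]) auto
    qed
    also have "\<dots> \<le> liminf (\<lambda>k. \<integral>\<^sup>+x. ennreal ((cmod (f n x - f (r k) x))\<^sup>2) \<partial>lebesgue)"
      by (rule nn_integral_liminf) measurable
    also have "\<dots> \<le> liminf (\<lambda>k. ennreal (((1/2) ^ j)\<^sup>2))"
    proof (rule Liminf_mono, rule eventually_sequentiallyI)
      fix k assume "j \<le> k"
      then have "norm2 (\<lambda>x. f n x - f (r k) x) \<le> (1/2) ^ j"
        using M[of j n "r k"] that r_ge[of j] r_mono[of j k] by simp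
      then have "(norm2 (\<lambda>x. f n x - f (r k) x))\<^sup>2 \<le> ((1/2) ^ j)\<^sup>2"
        by (intro power_mono) auto
      then show "(\<integral>\<^sup>+x. ennreal ((cmod (f n x - f (r k) x))\<^sup>2) \<partial>lebesgue) \<le> ennreal (((1/2) ^ j)\<^sup>2)"
        using L2_dist_sq_eq[OF f f, of n "r k"] by (simp add: L2_dist_sq_def ennreal_leI del: ennreal_power)
    qed
    also have "\<dots> = ennreal (((1/2) ^ j)\<^sup>2)" by (simp add: Liminf_const)
    finally show ?thesis .
  qed
  have diff_L2: "(\<lambda>x. f n x - g x) \<in> L2" if "n \<ge> M 0" for n
  proof -
    have "integrable lebesgue (\<lambda>x. (cmod (f n x - g x))\<^sup>2)"
      by (rule integrableI_nonneg) (use tail[OF that] in \<open>auto intro: le_less_trans\<close>)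
    then show ?thesis by (simp add: L2_def)
  qed
  have "(\<lambda>x. f (M 0) x - (f (M 0) x - g x)) \<in> L2"
    by (intro L2_diff f diff_L2) auto
  then have gL2: "g \<in> L2" by simp
  have le: "norm2 (\<lambda>x. f n x - g x) \<le> (1/2) ^ j" if "n \<ge> M j" for n j
    using tail[OF that] L2_dist_sq_eq[OF f gL2, of n]
    by (simp add: L2_dist_sq_def power2_le_iff_abs_le del: ennreal_power)
  have "(\<lambda>n. norm2 (\<lambda>x. f n x - g x)) \<longlonglongrightarrow> 0"
  proof (rule LIMSEQ_I)
    fix \<epsilon> :: real assume "\<epsilon> > 0"
    then obtain j where "(1/2) ^ j < \<epsilon>" using real_arch_pow_inv[of \<epsilon> "1/2"] by auto
    then show "\<exists>no. \<forall>n\<ge>no. norm (norm2 (\<lambda>x. f n x - g x) - 0) < \<epsilon>"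
      using le[of j] by (intro exI[of _ "M j"]) (auto intro: le_less_trans)
  qed
  then show thesis using gL2 that by blast
qed

section \<open>Trigonometric polynomials\<close>

text \<open>
  The character \<open>t \<mapsto> exp (2\<pi>it)\<close> of the circle group.
\<close>

definition chr :: "real \<Rightarrow> complex" where
  "chr t = cis (2 * pi * t)"

lemma chr_add: "chr (a + b) = chr a * chr b"
  by (simp add: chr_def cis_mult distrib_left)

lemma chr_0 [simp]: "chr 0 = 1"
  by (simp add: chr_def)

lemma norm_chr [simp]: "cmod (chr t) = 1"
  by (simp add: chr_def)

lemma cnj_chr: "cnj (chr t) = chr (- t)"
  by (simp add: chr_def cis_cnj)

lemma chr_of_int [simp]: "chr (of_int k) = 1"
  unfolding chr_def by (rule cis_multiple_2pi) simp

lemma chr_int_mult_add: "chr (of_int k * (x + of_int n)) = chr (of_int k * x)"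
proof -
  have "chr (of_int k * (x + of_int n)) = chr (of_int k * x) * chr (of_int (k * n))"
    by (simp add: chr_add[symmetric] distrib_left)
  then show ?thesis by (simp only: chr_of_int mult_1_right)
qed

lemma continuous_on_chr [continuous_intros]:
  "continuous_on S f \<Longrightarrow> continuous_on S (\<lambda>x. chr (f x))"
  unfolding chr_def by (intro continuous_intros)

lemma tendsto_chr [tendsto_intros]: "(f \<longlongrightarrow> a) F \<Longrightarrow> ((\<lambda>x. chr (f x)) \<longlongrightarrow> chr a) F"
  unfolding chr_def by (intro tendsto_intros)

lemma borel_measurable_chr [measurable (raw)]:
  "f \<in> borel_measurable M \<Longrightarrow> (\<lambda>x. chr (f x)) \<in> borel_measurable M"
  using measurable_compose[of f M borel chr borel]
    borel_measurable_continuous_onI[OF continuous_on_chr[OF continuous_on_id]] by simp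

text \<open>
  The inductive form makes closure under products an induction on the generators.
\<close>

inductive trig_poly :: "(real \<Rightarrow> complex) \<Rightarrow> bool" where
  trig_poly_monom: "trig_poly (\<lambda>x. c * chr (of_int k * x))"
| trig_poly_add: "trig_poly p \<Longrightarrow> trig_poly q \<Longrightarrow> trig_poly (\<lambda>x. p x + q x)"

lemma trig_poly_const: "trig_poly (\<lambda>x. c)"
  using trig_poly_monom[of c 0] by simp

lemma trig_poly_mult:
  assumes "trig_poly p" "trig_poly q" shows "trig_poly (\<lambda>x. p x * q x)"
  using assms
proof (induction arbitrary: q)
  case (trig_poly_monom c k)
  from trig_poly_monom.prems show ?case
  proof induction
    case (trig_poly_monom d j)
    have "(\<lambda>x. c * chr (of_int k * x) * (d * chr (of_int j * x)))
        = (\<lambda>x. c * d * chr (of_int (k + j) * x))"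
      by (simp add: chr_add distrib_left mult_ac)
    then show ?case by (simp only: trig_poly.trig_poly_monom)
  next
    case (trig_poly_add p q)
    from trig_poly.trig_poly_add[OF this(3,4)] show ?case by (simp only: distrib_left)
  qed
next
  case (trig_poly_add p p')
  from trig_poly.trig_poly_add[OF this(3,4)[OF trig_poly_add.prems]]
  show ?case by (simp only: distrib_right)
qed

lemma trig_poly_imp_sum:
  assumes "trig_poly p"
  obtains F c where "finite F" "p = (\<lambda>x. \<Sum>k\<in>F. c k * chr (of_int k * x))"
proof -
  have "\<exists>F c. finite F \<and> (\<forall>k. k \<notin> F \<longrightarrow> c k = 0) \<and> p = (\<lambda>x. \<Sum>k\<in>F. c k * chr (of_int k * x))"
    using assms
  proof induction
    case (trig_poly_monom c k)
    show ?case
      by (rule exI[of _ "{k}"], rule exI[of _ "\<lambda>j. if j = k then c else 0"]) auto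
  next
    case (trig_poly_add p q)
    from trig_poly_add.IH(1) obtain F c where
      F: "finite F" "\<forall>k. k \<notin> F \<longrightarrow> c k = 0" "p = (\<lambda>x. \<Sum>k\<in>F. c k * chr (of_int k * x))"
      by blast
    from trig_poly_add.IH(2) obtain G d where
      G: "finite G" "\<forall>k. k \<notin> G \<longrightarrow> d k = 0" "q = (\<lambda>x. \<Sum>k\<in>G. d k * chr (of_int k * x))"
      by blast
    have "p x = (\<Sum>k\<in>F \<union> G. c k * chr (of_int k * x))" for x
      unfolding F(3) using F G by (intro sum.mono_neutral_left) auto
    moreover have "q x = (\<Sum>k\<in>F \<union> G. d k * chr (of_int k * x))" for x
      unfolding G(3) using F G by (intro sum.mono_neutral_left) auto
    ultimately have "(\<lambda>x. p x + q x) = (\<lambda>x. \<Sum>k\<in>F \<union> G. (c k + d k) * chr (of_int k * x))"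
      by (simp add: distrib_right sum.distrib)
    then show ?case using F G
      by (intro exI[of _ "F \<union> G"] exI[of _ "\<lambda>k. c k + d k"]) auto
  qed
  then show thesis using that by blast
qed

lemma trig_poly_continuous: "trig_poly p \<Longrightarrow> continuous_on UNIV p"
  by (induction rule: trig_poly.induct)
    (intro continuous_on_add continuous_on_mult continuous_on_const continuous_on_chr continuous_on_id
      | assumption)+

lemma continuous_lebesgue_measurable:
  fixes f :: "real \<Rightarrow> 'a::topological_space"
  shows "continuous_on UNIV f \<Longrightarrow> f \<in> borel_measurable lebesgue"
  by (intro measurable_completion) (simp add: borel_measurable_continuous_onI)

text \<open>
  On the unit circle the real and imaginary part of \<open>z\<close> are linear combinations of \<open>z\<close> and \<open>1/z\<close>, so
  polynomials in them become trigonometric polynomials.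
\<close>

lemma trig_poly_real_polynomial:
  fixes g :: "complex \<Rightarrow> real"
  assumes "real_polynomial_function g"
  shows "trig_poly (\<lambda>x. of_real (g (chr x)))"
  using assms
proof induction
  case (linear f)
  interpret bounded_linear f by fact
  have "of_real (f (chr x)) = (of_real (f 1) / 2 - \<i> * of_real (f \<i>) / 2) * chr (of_int 1 * x)
      + (of_real (f 1) / 2 + \<i> * of_real (f \<i>) / 2) * chr (of_int (-1) * x)" for x
  proof -
    have "chr x = Re (chr x) *\<^sub>R 1 + Im (chr x) *\<^sub>R \<i>" by (simp add: complex_eq_iff)
    then have "f (chr x) = Re (chr x) * f 1 + Im (chr x) * f \<i>"
      by (metis add scaleR real_scaleR_def)
    then show ?thesis
      by (simp add: complex_eq_iff chr_def field_simps)
  qed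
  then show ?case by (simp only: trig_poly.intros)
next
  case (const c)
  then show ?case by (rule trig_poly_const)
next
  case (add f g)
  then show ?case by (simp add: trig_poly_add)
next
  case (mult f g)
  then show ?case by (simp add: trig_poly_mult)
qed

lemma trig_poly_polynomial:
  fixes g :: "complex \<Rightarrow> complex"
  assumes "polynomial_function g"
  shows "trig_poly (\<lambda>x. g (chr x))"
proof -
  have "real_polynomial_function (Re \<circ> g)" "real_polynomial_function (Im \<circ> g)"
    using assms bounded_linear_Re bounded_linear_Im unfolding polynomial_function_def by blast+
  from this[THEN trig_poly_real_polynomial]
  have "trig_poly (\<lambda>x. of_real (Re (g (chr x))) + \<i> * of_real (Im (g (chr x))))"
    unfolding o_def by (rule trig_poly_add[OF _ trig_poly_mult[OF trig_poly_const]])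
  then show ?thesis by (simp add: complex_eq[symmetric])
qed

lemma Arg2pi_chr: "0 \<le> x \<Longrightarrow> x < 1 \<Longrightarrow> Arg2pi (chr x) = 2 * pi * x"
  by (rule Arg2pi_unique[of 1]) (auto simp: chr_def cis_conv_exp)

text \<open>
  Since \<open>h 0 = h 1\<close>, the function descends to the unit circle, where the Stone-Weierstrass theorem
  provides a polynomial approximation.
\<close>

lemma trig_poly_dense_continuous:
  fixes h :: "real \<Rightarrow> complex"
  assumes "continuous_on {0..1} h" "h 0 = h 1" "\<epsilon> > 0"
  obtains p where "trig_poly p" "\<And>x. 0 \<le> x \<Longrightarrow> x < 1 \<Longrightarrow> cmod (h x - p x) < \<epsilon>"
proof -
  have "homotopic_loops UNIV h h"
    using assms by (simp add: homotopic_loops_refl path_def pathstart_def pathfinish_def)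
  then have "homotopic_with_canon (\<lambda>h. True) (sphere 0 1) UNIV
      (h \<circ> (\<lambda>z. Arg2pi z / (2*pi))) (h \<circ> (\<lambda>z. Arg2pi z / (2*pi)))"
    by (rule homotopic_loops_imp_homotopic_circlemaps)
  then have "continuous_on (sphere 0 1) (h \<circ> (\<lambda>z. Arg2pi z / (2*pi)))"
    using homotopic_with_imp_continuous by blast
  then obtain g where g: "polynomial_function g"
    "\<forall>z \<in> sphere 0 1. cmod ((h \<circ> (\<lambda>z. Arg2pi z / (2*pi))) z - g z) < \<epsilon>"
    using Stone_Weierstrass_polynomial_function[of "sphere 0 1"] assms(3) by (metis compact_sphere)
  show thesis
  proof (rule that[OF trig_poly_polynomial[OF g(1)]])
    fix x :: real assume "0 \<le> x" "x < 1"
    then show "cmod (h x - g (chr x)) < \<epsilon>"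
      using g(2)[rule_format, of "chr x"] by (simp add: Arg2pi_chr)
  qed
qed

section \<open>Density of trigonometric polynomials on the unit interval\<close>

lemma L2_indicator_Icc: "(indicator {a..b} :: real \<Rightarrow> complex) \<in> L2"
proof -
  have "integrable lebesgue (indicat_real {a..b})"
    by (simp add: integrable_indicator_iff emeasure_lborel_Icc_eq)
  moreover have "(\<lambda>x. (cmod (indicator {a..b} x))\<^sup>2) = indicat_real {a..b}"
    by (auto simp: indicator_def)
  moreover have "(indicator {a..b} :: real \<Rightarrow> complex) \<in> borel_measurable lebesgue"
    by (rule borel_measurable_indicator) simp
  ultimately show ?thesis by (simp add: L2_def)
qed

lemma L2_bounded_support:
  assumes "f \<in> borel_measurable lebesgue" "\<And>x. cmod (f x) \<le> C" "\<And>x. x \<notin> {a..b} \<Longrightarrow> f x = 0"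
  shows "f \<in> L2"
  by (rule L2_dominated[OF L2_indicator_Icc[of a b] assms(1), of C])
     (use assms in \<open>auto simp: indicator_def intro!: AE_I2\<close>)

lemma L2_indicator_trig_poly:
  assumes "trig_poly p" "B \<in> sets lebesgue" "B \<subseteq> {a..b}"
  shows "(\<lambda>x. indicator B x * p x) \<in> L2"
proof -
  have cont: "continuous_on UNIV p" by (rule trig_poly_continuous[OF assms(1)])
  have "bounded (p ` {a..b})"
    by (intro compact_imp_bounded compact_continuous_image continuous_on_subset[OF cont]) auto
  then obtain C where C: "\<And>x. x \<in> {a..b} \<Longrightarrow> cmod (p x) \<le> C" unfolding bounded_iff by blast
  show ?thesis
  proof (rule L2_bounded_support[of _ "max 0 C" a b])
    show "(\<lambda>x. indicator B x * p x) \<in> borel_measurable lebesgue"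
      by (intro borel_measurable_times borel_measurable_indicator assms
          continuous_lebesgue_measurable cont)
    show "cmod (indicator B x * p x) \<le> max 0 C" for x
      using C[of x] assms(3) by (cases "x \<in> B") (auto simp: le_max_iff_disj)
    show "indicator B x * p x = 0" if "x \<notin> {a..b}" for x
      using that assms(3) by (cases "x \<in> B") auto
  qed
qed

lemma L2_bounded_support_integrable:
  assumes "f \<in> L2" "\<And>x. x \<notin> {a..b} \<Longrightarrow> f x = 0"
  shows "integrable lebesgue f"
proof -
  have "f = (\<lambda>x. f x * indicator {a..b} x)"
  proof
    show "f x = f x * indicator {a..b} x" for x
      using assms(2)[of x] by (cases "x \<in> {a..b}") auto
  qed
  then show ?thesis using L2_integrable_product[OF assms(1) L2_indicator_Icc[of a b]] by metis
qed

lemma norm2_le_of_bounded: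
  assumes "f \<in> borel_measurable lebesgue" "a \<le> b" "C \<ge> 0" "AE x in lebesgue. cmod (f x) \<le> C * indicator {a..b} x"
  shows "norm2 f \<le> C * sqrt (b - a)"
proof -
  have L2: "(\<lambda>x. of_real C * indicator {a..b} x :: complex) \<in> L2"
    by (intro L2_scale L2_indicator_Icc)
  have "norm2 f \<le> norm2 (\<lambda>x. of_real C * indicator {a..b} x)"
  proof (rule norm2_mono[OF L2 assms(1)])
    show "AE x in lebesgue. cmod (f x) \<le> cmod (of_real C * indicator {a..b} x)"
      using assms(4) by eventually_elim (use assms(3) in \<open>auto simp: indicator_def norm_mult\<close>)
  qed
  also have "\<dots> = C * norm2 (indicator {a..b})" using assms(3) by (simp add: norm2_scale)
  also have "norm2 (indicator {a..b}) = sqrt (LINT x|lebesgue. indicat_real {a..b} x)"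
    unfolding norm2_def
    by (intro arg_cong[where f = sqrt] Bochner_Integration.integral_cong) (auto simp: indicator_def)
  also have "\<dots> = sqrt (b - a)" using assms(2) by simp
  finally show ?thesis .
qed

lemma AE_neq_real: "AE x in lebesgue. x \<noteq> (a :: real)"
  by (rule AE_completion) (rule AE_lborel_singleton)

text \<open>
  A measurable function is an almost everywhere limit of continuous functions \<open>g n\<close>. Clamping them
  (\<open>cl\<close>) supplies the bound for dominated convergence, and cutting them off near \<open>0\<close> and \<open>1\<close>
  (\<open>\<phi> n\<close>) makes their endpoint values agree.
\<close>

lemma trig_poly_dense_bounded:
  assumes "f \<in> borel_measurable lebesgue" "\<And>x. cmod (f x) \<le> B" "\<And>x. x \<notin> {0..1} \<Longrightarrow> f x = 0"
    "\<epsilon> > 0"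
  obtains p where "trig_poly p" "norm2 (\<lambda>x. f x - indicator {0..1} x * p x) < \<epsilon>"
proof -
  define C where "C = max B 1"
  have C: "C > 0" "\<And>x. cmod (f x) \<le> C" using assms(2) by (auto simp: C_def le_max_iff_disj)
  have "f measurable_on UNIV"
    using assms(1) by (rule lebesgue_measurable_imp_measurable_on) simp
  then obtain N g where N: "negligible N" and g: "\<And>n. continuous_on UNIV (g n)"
    "\<And>x. x \<notin> N \<Longrightarrow> (\<lambda>n. g n x) \<longlonglongrightarrow> f x"
    by (auto simp: measurable_on_def)
  define cl where "cl = (\<lambda>w :: complex. of_real (C / max C (cmod w)) * w)"
  have cl_cont: "continuous_on UNIV cl"
    unfolding cl_def using C(1) by (intro continuous_intros) (auto simp: max_def)
  have cl_le: "cmod (cl w) \<le> C" for w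
    using C(1) by (auto simp: cl_def norm_mult norm_divide max_def)
  have cl_id: "cl w = w" if "cmod w \<le> C" for w
    using C(1) that by (auto simp: cl_def max_def)
  define \<phi> where "\<phi> = (\<lambda>(n::nat) x :: real. min 1 (max 0 (real n * x)) * min 1 (max 0 (real n * (1 - x))))"
  have \<phi>_cont: "continuous_on UNIV (\<phi> n)" for n
    unfolding \<phi>_def by (intro continuous_intros)
  have \<phi>_le: "0 \<le> \<phi> n x \<and> \<phi> n x \<le> 1" for n x
    unfolding \<phi>_def by (auto intro: mult_le_one)
  have \<phi>_0: "\<phi> n x = 0" if "x \<le> 0 \<or> 1 \<le> x" for n x
  proof -
    have "real n * x \<le> 0 \<or> real n * (1 - x) \<le> 0"
      using that by (auto simp: mult_le_0_iff)
    then show ?thesis unfolding \<phi>_def by (elim disjE) (simp_all add: max_absorb1)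
  qed
  have \<phi>_lim: "(\<lambda>n. \<phi> n x) \<longlonglongrightarrow> 1" if "0 < x" "x < 1" for x
  proof (rule tendsto_eventually)
    obtain M where M: "1 / x \<le> real M" using real_arch_simple by blast
    obtain L where L: "1 / (1 - x) \<le> real L" using real_arch_simple by blast
    have "\<phi> n x = 1" if "M \<le> n" "L \<le> n" for n
    proof -
      have "1 / x \<le> real n" "1 / (1 - x) \<le> real n" using M L that by linarith+
      then have "1 \<le> real n * x" "1 \<le> real n * (1 - x)" using \<open>0 < x\<close> \<open>x < 1\<close>
        by (simp_all add: divide_le_eq)
      then show ?thesis by (simp add: \<phi>_def)
    qed
    then show "\<forall>\<^sub>F n in sequentially. \<phi> n x = 1"
      by (intro eventually_sequentiallyI[of "max M L"]) auto
  qed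
  define h where "h = (\<lambda>n x. of_real (\<phi> n x) * cl (g n x))"
  have h_cont: "continuous_on UNIV (h n)" for n
    unfolding h_def by (intro continuous_intros \<phi>_cont continuous_on_compose2[OF cl_cont g(1)]) auto
  have h_le: "cmod (h n x) \<le> C * indicator {0..1} x" for n x
    using \<phi>_le[of n x] cl_le[of "g n x"] \<phi>_0[of x n] C(1)
    by (auto simp: h_def norm_mult indicator_def intro: mult_le_one mult_mono[of "\<phi> n x" 1 _ C, simplified])
  have lim: "(\<lambda>n. norm2 (\<lambda>x. f x - h n x)) \<longlonglongrightarrow> 0"
  proof (rule L2_dominated_convergence[where w = "\<lambda>x. complex_of_real (2 * C) * indicator {0..1} x"])
    show "(\<lambda>x. complex_of_real (2 * C) * indicator {0..1} x) \<in> L2"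
      by (intro L2_scale L2_indicator_Icc)
    show "(\<lambda>x. f x - h n x) \<in> borel_measurable lebesgue" for n
      using assms(1) continuous_lebesgue_measurable[OF h_cont] by measurable
    show "AE x in lebesgue. cmod (f x - h n x) \<le> cmod (complex_of_real (2 * C) * indicator {0..1} x)" for n
    proof (rule AE_I2)
      fix x
      show "cmod (f x - h n x) \<le> cmod (complex_of_real (2 * C) * indicator {0..1} x)"
        using norm_triangle_ineq4[of "f x" "h n x"] C(2)[of x] h_le[of n x] assms(3)[of x] C(1)
        by (auto simp: indicator_def norm_mult split: if_splits)
    qed
    have "AE x in lebesgue. x \<notin> N"
      using N by (auto simp: negligible_iff_null_sets intro: AE_not_in)
    then show "AE x in lebesgue. (\<lambda>n. f x - h n x) \<longlonglongrightarrow> 0"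
      using AE_neq_real[of 0] AE_neq_real[of 1]
    proof eventually_elim
      case (elim x)
      show ?case
      proof (cases "0 < x \<and> x < 1")
        case True
        have "(\<lambda>n. cl (g n x)) \<longlonglongrightarrow> cl (f x)"
          using cl_cont g(2)[OF elim(1)]
          by (intro continuous_on_tendsto_compose[of UNIV cl]) auto
        then have "(\<lambda>n. f x - h n x) \<longlonglongrightarrow> f x - of_real 1 * cl (f x)"
          unfolding h_def using \<phi>_lim True by (intro tendsto_intros) auto
        then show ?thesis using cl_id C(2) by simp
      next
        case False
        then have "x \<notin> {0..1}" using elim by auto
        then have "f x = 0" "\<And>n. h n x = 0" using assms(3) \<phi>_0[of x] by (auto simp: h_def)
        then show ?thesis by simp
      qed
    qed
  qed
  then obtain n where n: "norm2 (\<lambda>x. f x - h n x) < \<epsilon> / 2"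
    using assms(4) LIMSEQ_D[OF lim, of "\<epsilon> / 2"] by auto
  obtain p where p: "trig_poly p" "\<And>x. 0 \<le> x \<Longrightarrow> x < 1 \<Longrightarrow> cmod (h n x - p x) < \<epsilon> / 2"
  proof (rule trig_poly_dense_continuous[of "h n" "\<epsilon> / 2"])
    show "continuous_on {0..1} (h n)" by (rule continuous_on_subset[OF h_cont]) simp
    show "h n 0 = h n 1" using \<phi>_0[of 0 n] \<phi>_0[of 1 n] by (simp add: h_def)
  qed (use assms(4) in auto)
  have h_meas [measurable]: "h n \<in> borel_measurable lebesgue"
    by (rule continuous_lebesgue_measurable[OF h_cont])
  have hL2: "h n \<in> L2"
  proof (rule L2_bounded_support[OF h_meas])
    show "cmod (h n x) \<le> C" for x
      using h_le[of n x] C(1) by (cases "x \<in> {0..1}") auto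
    show "h n x = 0" if "x \<notin> {0..1}" for x
      using h_le[of n x] that by simp
  qed
  have fL2: "f \<in> L2" by (rule L2_bounded_support[OF assms(1-3)])
  have bd2: "AE x in lebesgue. cmod (h n x - indicator {0..1} x * p x) \<le> \<epsilon> / 2 * indicator {0..1} x"
    using AE_neq_real[of 1]
  proof eventually_elim
    case (elim x)
    then show ?case
      using p(2)[of x] h_le[of n x] by (auto simp: indicator_def split: if_splits)
  qed
  have pL2: "(\<lambda>x. indicator {0..1} x * p x) \<in> L2"
    by (rule L2_indicator_trig_poly[OF p(1), of _ 0 1]) auto
  have "norm2 (\<lambda>x. h n x - indicator {0..1} x * p x) \<le> \<epsilon> / 2 * sqrt (1 - 0)"
    using bd2 assms(4) by (intro norm2_le_of_bounded L2_measurable[OF L2_diff[OF hL2 pL2]]) auto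
  then have "norm2 (\<lambda>x. f x - indicator {0..1} x * p x) < \<epsilon>"
    using norm2_triangle_diff[OF fL2 hL2 pL2] n by simp
  then show thesis using p(1) that by blast
qed

lemma trig_poly_dense_L2:
  assumes f: "f \<in> L2" and supp: "\<And>x. x \<notin> {0..1} \<Longrightarrow> f x = 0" and "\<epsilon> > 0"
  obtains p where "trig_poly p" "norm2 (\<lambda>x. f x - indicator {0..1} x * p x) < \<epsilon>"
proof -
  note [measurable] = L2_measurable[OF f]
  define fn where "fn = (\<lambda>(n::nat) x. if cmod (f x) \<le> real n then f x else 0)"
  have fn_meas: "fn n \<in> borel_measurable lebesgue" for n unfolding fn_def by measurable
  have fn_L2: "fn n \<in> L2" for n
    by (rule L2_dominated[OF f fn_meas, of _ 1]) (auto simp: fn_def)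
  have "(\<lambda>n. norm2 (\<lambda>x. f x - fn n x)) \<longlonglongrightarrow> 0"
  proof (rule L2_dominated_convergence[OF f])
    show "AE x in lebesgue. (\<lambda>n. f x - fn n x) \<longlonglongrightarrow> 0"
    proof (rule AE_I2, rule tendsto_eventually)
      fix x
      obtain M where "cmod (f x) \<le> real M" using real_arch_simple by blast
      then show "\<forall>\<^sub>F n in sequentially. f x - fn n x = 0"
        by (intro eventually_sequentiallyI[of M]) (auto simp: fn_def)
    qed
  qed (use fn_meas in \<open>auto simp: fn_def\<close>)
  from LIMSEQ_D[OF this, of "\<epsilon> / 2"] obtain n where n: "norm2 (\<lambda>x. f x - fn n x) < \<epsilon> / 2"
    using assms(3) by auto
  obtain p where p: "trig_poly p" "norm2 (\<lambda>x. fn n x - indicator {0..1} x * p x) < \<epsilon> / 2"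
  proof (rule trig_poly_dense_bounded[OF fn_meas[of n], of "real n" "\<epsilon> / 2"])
    show "cmod (fn n x) \<le> real n" for x by (simp add: fn_def)
    show "fn n x = 0" if "x \<notin> {0..1}" for x using supp[OF that] by (simp add: fn_def)
  qed (use assms(3) in auto)
  have pL2: "(\<lambda>x. indicator {0..1} x * p x) \<in> L2"
    by (rule L2_indicator_trig_poly[OF p(1), of _ 0 1]) auto
  have "norm2 (\<lambda>x. f x - indicator {0..1} x * p x) < \<epsilon>"
    using norm2_triangle_diff[OF f fn_L2[of n] pL2] n p(2) by simp
  then show thesis using p(1) that by blast
qed

section \<open>Fourier integrals and Parseval's identity on the unit interval\<close>

lemma fourier_integral_chr: "fourier_integral f \<xi> = (LINT x|lebesgue. f x * chr (- (x * \<xi>)))"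
proof -
  have "exp (- 2 * of_real pi * \<i> * of_real x * of_real \<xi>) = chr (- (x * \<xi>))" for x
    by (simp add: chr_def cis_conv_exp mult_ac)
  then show ?thesis by (simp add: fourier_integral_def)
qed

lemma integrable_mult_chr:
  assumes "integrable lebesgue f" "g \<in> borel_measurable lebesgue"
  shows "integrable lebesgue (\<lambda>x. f x * chr (g x))"
  by (rule Bochner_Integration.integrable_bound[OF assms(1)])
     (use assms in \<open>auto simp: norm_mult\<close>)

lemma cmod_fourier_integral_le: "cmod (fourier_integral f \<xi>) \<le> (LINT x|lebesgue. cmod (f x))"
  unfolding fourier_integral_chr by (rule order_trans[OF integral_norm_bound]) (simp add: norm_mult)

lemma borel_measurable_chr_linear: "(\<lambda>x. chr (- (x * \<xi>))) \<in> borel_measurable lebesgue"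
  by (intro continuous_lebesgue_measurable continuous_intros)

lemma fourier_integral_continuous:
  assumes "integrable lebesgue f"
  shows "continuous_on UNIV (fourier_integral f)"
  unfolding continuous_on_sequentially o_def
proof (intro allI ballI impI, elim conjE)
  fix u :: "nat \<Rightarrow> real" and a assume "u \<longlonglongrightarrow> a"
  then show "(\<lambda>n. fourier_integral f (u n)) \<longlonglongrightarrow> fourier_integral f a"
    unfolding fourier_integral_chr
    using assms borel_measurable_integrable[OF assms]
    by (intro integral_dominated_convergence[where w = "\<lambda>x. cmod (f x)"])
       (auto simp: norm_mult intro!: tendsto_intros borel_measurable_times borel_measurable_chr_linear)
qed

lemma integral_chr_Icc:
  assumes "a \<le> b" "k \<noteq> 0"
  shows "(LINT x|lebesgue. indicator {a..b} x * chr (k * x))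
    = (chr (k * b) - chr (k * a)) / (2 * of_real pi * \<i> * of_real k)"
proof -
  define F where "F = (\<lambda>x. chr (k * x) / (2 * of_real pi * \<i> * of_real k))"
  have "(LINT x|lborel. indicator {a..b} x *\<^sub>R chr (k * x)) = F b - F a"
  proof (rule integral_FTC_atLeastAtMost[OF assms(1)])
    fix x :: real
    have "((\<lambda>z. exp (2 * of_real pi * \<i> * of_real k * z) / (2 * of_real pi * \<i> * of_real k))
       has_field_derivative exp (2 * of_real pi * \<i> * of_real k * of_real x)) (at (of_real x))"
      using assms(2) by (auto intro!: derivative_eq_intros)
    from has_vector_derivative_real_field[OF this]
    have "(F has_vector_derivative chr (k * x)) (at x)"
      by (simp add: F_def chr_def cis_conv_exp mult_ac)
    then show "(F has_vector_derivative chr (k * x)) (at x within {a..b})"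
      by (rule has_vector_derivative_at_within)
  qed (intro continuous_intros)
  moreover have "(LINT x|lebesgue. indicator {a..b} x *\<^sub>R chr (k * x))
      = (LINT x|lborel. indicator {a..b} x *\<^sub>R chr (k * x))"
    by (rule integral_completion) measurable
  moreover have "indicator {a..b} x *\<^sub>R chr (k * x) = indicator {a..b} x * chr (k * x)" for x
    by (simp add: indicator_def)
  ultimately show ?thesis by (simp add: F_def diff_divide_distrib)
qed

lemma integral_chr_unit:
  "(LINT x|lebesgue. indicator {0..1} x * chr (of_int k * x)) = (if k = 0 then 1 else 0)"
proof (cases "k = 0")
  case True
  have "(LINT x|lebesgue. indicator {0..1::real} x :: complex)
      = (LINT x|lebesgue. complex_of_real (indicator {0..1::real} x))"
    by (intro Bochner_Integration.integral_cong) (auto simp: indicator_def)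
  also have "\<dots> = of_real (LINT x|lebesgue. indicator {0..1::real} x)"
    by (rule integral_complex_of_real)
  finally show ?thesis using True by simp
next
  case False
  then show ?thesis using integral_chr_Icc[of 0 1 "of_int k"] chr_of_int[of k] by simp
qed

text \<open>
  Completing the square: the coefficients \<open>L2_inner f (e i)\<close> minimize the distance to the span. Both
  Bessel's inequality and the lower bound needed for Parseval's identity are read off from here.
\<close>

lemma norm2_sq_diff_orthonormal:
  assumes f: "f \<in> L2" and e: "\<And>i. e i \<in> L2" "\<And>i j. L2_inner (e i) (e j) = (if i = j then 1 else 0)"
    and "finite F"
  shows "(norm2 (\<lambda>x. f x - (\<Sum>i\<in>F. c i * e i x)))\<^sup>2 =
    (norm2 f)\<^sup>2 - (\<Sum>i\<in>F. (cmod (L2_inner f (e i)))\<^sup>2) + (\<Sum>i\<in>F. (cmod (L2_inner f (e i) - c i))\<^sup>2)"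
proof -
  let ?p = "\<lambda>x. \<Sum>i\<in>F. c i * e i x"
  have ce: "(\<lambda>x. c i * e i x) \<in> L2" for i by (intro L2_scale e)
  have p: "?p \<in> L2" by (intro L2_sum ce)
  have ip: "L2_inner ?p g = (\<Sum>i\<in>F. c i * L2_inner (e i) g)" if "g \<in> L2" for g
    using L2_inner_sum_left[OF ce that] by (simp add: L2_inner_scale_left)
  have "L2_inner f ?p = cnj (\<Sum>i\<in>F. c i * L2_inner (e i) f)"
    using L2_inner_commute[of f ?p] ip[OF f] by simp
  also have "\<dots> = (\<Sum>i\<in>F. cnj (c i) * L2_inner f (e i))"
    by (simp add: L2_inner_commute[of f])
  finally have 1: "L2_inner f ?p = (\<Sum>i\<in>F. cnj (c i) * L2_inner f (e i))" .
  have "L2_inner (e i) ?p = cnj (\<Sum>j\<in>F. c j * L2_inner (e j) (e i))" for i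
    using L2_inner_commute[of "e i" ?p] ip[OF e(1)] by simp
  then have "L2_inner (e i) ?p = (if i \<in> F then cnj (c i) else 0)" for i
    using assms(4) by (simp add: e(2) if_distrib[of "\<lambda>x. _ * x"] cong: if_cong)
  then have "L2_inner ?p ?p = (\<Sum>i\<in>F. c i * cnj (c i))"
    using ip[OF p] by (simp cong: sum.cong)
  also have "\<dots> = of_real (\<Sum>i\<in>F. (cmod (c i))\<^sup>2)"
    by (simp add: complex_norm_square del: of_real_power)
  finally have "complex_of_real ((norm2 ?p)\<^sup>2) = of_real (\<Sum>i\<in>F. (cmod (c i))\<^sup>2)"
    unfolding L2_inner_self .
  then have 2: "(norm2 ?p)\<^sup>2 = (\<Sum>i\<in>F. (cmod (c i))\<^sup>2)"
    by (simp only: of_real_eq_iff)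
  have 3: "(cmod (z - w))\<^sup>2 = (cmod z)\<^sup>2 - 2 * Re (cnj w * z) + (cmod w)\<^sup>2" for z w
    by (simp only: cmod_power2) (simp add: power2_eq_square algebra_simps)
  show ?thesis
    unfolding norm2_diff_sq[OF f p] 1 2 3
    by (simp add: sum.distrib sum_subtractf sum_distrib_left)
qed

lemma Bessel:
  assumes "f \<in> L2" "\<And>i. e i \<in> L2" "\<And>i j. L2_inner (e i) (e j) = (if i = j then 1 else 0)"
    and "finite F"
  shows "(\<Sum>i\<in>F. (cmod (L2_inner f (e i)))\<^sup>2) \<le> (norm2 f)\<^sup>2"
  using norm2_sq_diff_orthonormal[OF assms, of "\<lambda>i. L2_inner f (e i)"]
    zero_le_power2[of "norm2 (\<lambda>x. f x - (\<Sum>i\<in>F. L2_inner f (e i) * e i x))"] by simp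

text \<open>
  A good approximation in the span of \<open>F\<close> bounds the coefficient sum over every larger index set
  \<open>G\<close>, which is why the two sets are kept apart.
\<close>

lemma Parseval_lower:
  assumes "f \<in> L2" "\<And>i. e i \<in> L2" "\<And>i j. L2_inner (e i) (e j) = (if i = j then 1 else 0)"
    and "finite F" "F \<subseteq> G" "finite G"
  shows "(norm2 f)\<^sup>2 - (norm2 (\<lambda>x. f x - (\<Sum>i\<in>F. c i * e i x)))\<^sup>2 \<le> (\<Sum>i\<in>G. (cmod (L2_inner f (e i)))\<^sup>2)"
proof -
  have "(\<Sum>i\<in>F. (cmod (L2_inner f (e i)))\<^sup>2) \<le> (\<Sum>i\<in>G. (cmod (L2_inner f (e i)))\<^sup>2)"
    using assms(5,6) by (intro sum_mono2) auto
  moreover have "0 \<le> (\<Sum>i\<in>F. (cmod (L2_inner f (e i) - c i))\<^sup>2)" by (intro sum_nonneg) auto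
  ultimately show ?thesis using norm2_sq_diff_orthonormal[OF assms(1-4), of c] by linarith
qed

definition unit_chr :: "int \<Rightarrow> real \<Rightarrow> complex" where
  "unit_chr k x = indicator {0..1} x * chr (of_int k * x)"

lemma unit_chr_L2: "unit_chr k \<in> L2"
proof -
  have "(\<lambda>x. chr (of_int k * x) * indicator {0..1} x) \<in> L2"
    by (rule L2_bounded_mult[OF L2_indicator_Icc, of _ 1])
       (auto intro!: continuous_lebesgue_measurable continuous_intros)
  then show ?thesis by (simp add: unit_chr_def[abs_def] mult.commute)
qed

lemma unit_chr_orthonormal: "L2_inner (unit_chr i) (unit_chr j) = (if i = j then 1 else 0)"
proof -
  have "unit_chr i x * cnj (unit_chr j x) = indicator {0..1} x * chr (of_int (i - j) * x)" for x
    by (simp add: unit_chr_def indicator_def cnj_chr chr_add[symmetric] left_diff_distrib)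
  then show ?thesis using integral_chr_unit[of "i - j"] by (simp add: L2_inner_def)
qed

text \<open>
  The frequencies are summed over \<open>{-M..<M}\<close> because these index the unit intervals that make up
  \<open>[-M, M)\<close>.
\<close>

lemma Parseval_unit_interval:
  assumes f: "f \<in> L2" and supp: "\<And>x. x \<notin> {0..1} \<Longrightarrow> f x = 0"
  shows "(\<lambda>M. \<Sum>k\<in>{-int M..<int M}. (cmod (L2_inner f (unit_chr k)))\<^sup>2) \<longlonglongrightarrow> (norm2 f)\<^sup>2"
proof (rule LIMSEQ_I)
  fix \<epsilon> :: real assume "\<epsilon> > 0"
  then obtain p where p: "trig_poly p" "norm2 (\<lambda>x. f x - indicator {0..1} x * p x) < sqrt \<epsilon>"
    using trig_poly_dense_L2[OF f supp, of "sqrt \<epsilon>"] by auto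
  obtain F c where F: "finite F" "p = (\<lambda>x. \<Sum>k\<in>F. c k * chr (of_int k * x))"
    using trig_poly_imp_sum[OF p(1)] by blast
  have "norm2 (\<lambda>x. f x - (\<Sum>k\<in>F. c k * unit_chr k x)) < sqrt \<epsilon>"
    using p(2) by (simp add: F(2) unit_chr_def sum_distrib_left mult_ac)
  then have less: "(norm2 (\<lambda>x. f x - (\<Sum>k\<in>F. c k * unit_chr k x)))\<^sup>2 < \<epsilon>"
    using \<open>\<epsilon> > 0\<close> by (metis norm2_nonneg power2_less_imp_less power_strict_mono real_sqrt_pow2 less_imp_le zero_less_numeral)
  define N where "N = nat (Max (insert 0 ((\<lambda>k. \<bar>k\<bar> + 1) ` F)))"
  have sub: "F \<subseteq> {-int M..<int M}" if "N \<le> M" for M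
  proof
    fix k assume "k \<in> F"
    then have "\<bar>k\<bar> + 1 \<le> Max (insert 0 ((\<lambda>k. \<bar>k\<bar> + 1) ` F))"
      using F(1) by (intro Max_ge) auto
    then show "k \<in> {-int M..<int M}" using that by (simp add: N_def) linarith
  qed
  have "norm ((\<Sum>k\<in>{-int M..<int M}. (cmod (L2_inner f (unit_chr k)))\<^sup>2) - (norm2 f)\<^sup>2) < \<epsilon>"
    if "N \<le> M" for M
  proof -
    note lower = Parseval_lower[OF f unit_chr_L2 unit_chr_orthonormal F(1) sub[OF that], of c]
    note upper = Bessel[OF f unit_chr_L2 unit_chr_orthonormal, of "{-int M..<int M}"]
    show ?thesis using lower upper less by simp
  qed
  then show "\<exists>N. \<forall>M\<ge>N. norm ((\<Sum>k\<in>{-int M..<int M}. (cmod (L2_inner f (unit_chr k)))\<^sup>2)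
      - (norm2 f)\<^sup>2) < \<epsilon>" by blast
qed

section \<open>Plancherel's theorem for functions of bounded support\<close>

text \<open>
  Folding an integral over the line onto the unit interval; bounded support keeps the sum
  of translates finite.
\<close>

lemma integral_unfold_unit:
  fixes F :: "real \<Rightarrow> 'a::euclidean_space"
  assumes "integrable lebesgue F" "\<And>x. x \<notin> {-real M..<real M} \<Longrightarrow> F x = 0"
  shows "(LINT x|lebesgue. F x)
    = (LINT x|lebesgue. indicator {0..<1} x *\<^sub>R (\<Sum>k\<in>{-int M..<int M}. F (x + of_int k)))"
proof -
  have int: "integrable lebesgue (\<lambda>x. indicator {0..<1} x *\<^sub>R F (x + of_int k))" for k :: int
    using lebesgue_integrable_real_affine[OF assms(1), of 1 "of_int k"]
    by (intro integrable_mult_indicator) (auto simp: add.commute)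
  have "F x = (\<Sum>k\<in>{-int M..<int M}. indicator {0..<1} (x - real_of_int k) *\<^sub>R F x)" for x
  proof (cases "x \<in> {-real M..<real M}")
    case True
    have *: "indicator {0..<1} (x - real_of_int k) = (if k = \<lfloor>x\<rfloor> then 1 else 0 :: real)" for k
    proof -
      have "k = \<lfloor>x\<rfloor> \<longleftrightarrow> 0 \<le> x - real_of_int k \<and> x - real_of_int k < 1" by linarith
      then show ?thesis by (simp add: indicator_def)
    qed
    have "\<lfloor>x\<rfloor> \<in> {-int M..<int M}"
      using True by (auto simp: le_floor_iff floor_less_iff)
    then have "(\<Sum>k\<in>{-int M..<int M}. indicator {0..<1} (x - real_of_int k) *\<^sub>R F x)
        = (\<Sum>k\<in>{-int M..<int M}. if k = \<lfloor>x\<rfloor> then F x else 0)"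
      unfolding * by (intro sum.cong) auto
    also have "\<dots> = F x" using \<open>\<lfloor>x\<rfloor> \<in> _\<close> by (subst sum.delta) auto
    finally show ?thesis ..
  qed (simp add: assms(2))
  then have "(LINT x|lebesgue. F x)
      = (LINT x|lebesgue. (\<Sum>k\<in>{-int M..<int M}. indicator {0..<1} (x - real_of_int k) *\<^sub>R F x))"
    by simp
  also have "\<dots> = (\<Sum>k\<in>{-int M..<int M}. LINT x|lebesgue. indicator {0..<1} (x - real_of_int k) *\<^sub>R F x)"
  proof (rule Bochner_Integration.integral_sum)
    fix k
    have "integrable lebesgue (\<lambda>x. indicator {of_int k..<of_int k + 1} x *\<^sub>R F x)"
      using assms(1) by (intro integrable_mult_indicator) auto
    moreover have "indicator {of_int k..<of_int k + 1} x = (indicator {0..<1} (x - real_of_int k) :: real)" for x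
      by (auto simp: indicator_def)
    ultimately show "integrable lebesgue (\<lambda>x. indicator {0..<1} (x - real_of_int k) *\<^sub>R F x)" by simp
  qed
  also have "\<dots> = (\<Sum>k\<in>{-int M..<int M}. LINT x|lebesgue. indicator {0..<1} x *\<^sub>R F (x + of_int k))"
  proof (rule sum.cong)
    fix k :: int
    show "(LINT x|lebesgue. indicator {0..<1} (x - real_of_int k) *\<^sub>R F x)
      = (LINT x|lebesgue. indicator {0..<1} x *\<^sub>R F (x + of_int k))"
      using lebesgue_integral_real_affine[of 1 "\<lambda>x. indicator {0..<1} (x - real_of_int k) *\<^sub>R F x" "of_int k"]
      by (simp add: add.commute)
  qed simp
  also have "\<dots> = (LINT x|lebesgue. (\<Sum>k\<in>{-int M..<int M}. indicator {0..<1} x *\<^sub>R F (x + of_int k)))"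
    using int by (intro Bochner_Integration.integral_sum[symmetric])
  finally show ?thesis by (simp add: scaleR_sum_right)
qed

text \<open>
  Parseval's identity for \<open>f(x) e(-x\<xi>)\<close> shows that \<open>\<bar>\<phi>\<bar>\<^sup>2\<close>, summed over \<open>\<xi> + k\<close> for all integers \<open>k\<close>, is
  the constant \<open>(norm2 f)\<^sup>2\<close>. The integral of \<open>\<bar>\<phi>\<bar>\<^sup>2\<close> over the line is the integral of this sum over the
  unit interval.
\<close>

lemma Plancherel_unit_interval:
  assumes f: "f \<in> L2" and supp: "\<And>x. x \<notin> {0..1} \<Longrightarrow> f x = 0"
  shows "fourier_integral f \<in> L2 \<and> norm2 (fourier_integral f) = norm2 f"
proof -
  define \<phi> where "\<phi> = fourier_integral f"
  have int: "integrable lebesgue f" by (rule L2_bounded_support_integrable[OF f supp])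
  have \<phi>_cont: "continuous_on UNIV \<phi>" unfolding \<phi>_def by (rule fourier_integral_continuous[OF int])
  have \<phi>_meas [measurable]: "\<phi> \<in> borel_measurable lebesgue" by (rule continuous_lebesgue_measurable[OF \<phi>_cont])
  define S where "S = (\<lambda>M \<xi>. \<Sum>k\<in>{-int M..<int M}. (cmod (\<phi> (\<xi> + of_int k)))\<^sup>2)"
  have S_cont: "continuous_on UNIV (S M)" for M
    unfolding S_def by (intro continuous_intros continuous_on_compose2[OF \<phi>_cont]) auto
  have S: "S M \<xi> \<le> (norm2 f)\<^sup>2" "(\<lambda>M. S M \<xi>) \<longlonglongrightarrow> (norm2 f)\<^sup>2" for M \<xi>
  proof -
    define g where "g = (\<lambda>x. f x * chr (- (x * \<xi>)))"
    have g_meas: "g \<in> borel_measurable lebesgue"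
      unfolding g_def by (intro borel_measurable_times borel_measurable_chr_linear L2_measurable f)
    have g: "g \<in> L2" by (rule L2_dominated[OF f g_meas, of 1]) (simp add: g_def norm_mult)
    have ng: "norm2 g = norm2 f" by (simp add: norm2_def g_def norm_mult)
    have "L2_inner g (unit_chr k) = \<phi> (\<xi> + of_int k)" for k
    proof -
      have "g x * cnj (unit_chr k x) = f x * chr (- (x * (\<xi> + of_int k)))" for x
      proof (cases "x \<in> {0..1}")
        case True
        then show ?thesis
          by (simp add: g_def unit_chr_def cnj_chr chr_add[symmetric] algebra_simps)
      qed (simp add: g_def supp)
      then show ?thesis by (simp add: L2_inner_def \<phi>_def fourier_integral_chr)
    qed
    then have eq: "S M \<xi> = (\<Sum>k\<in>{-int M..<int M}. (cmod (L2_inner g (unit_chr k)))\<^sup>2)" for M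
      by (simp add: S_def)
    show "S M \<xi> \<le> (norm2 f)\<^sup>2"
      unfolding eq ng[symmetric] by (rule Bessel[OF g unit_chr_L2 unit_chr_orthonormal]) simp
    show "(\<lambda>M. S M \<xi>) \<longlonglongrightarrow> (norm2 f)\<^sup>2"
      unfolding eq ng[symmetric]
      by (rule Parseval_unit_interval[OF g]) (simp add: g_def supp)
  qed
  define B where "B = (LINT x|lebesgue. cmod (f x))"
  have B: "cmod (\<phi> \<xi>) \<le> B" for \<xi> unfolding \<phi>_def B_def by (rule cmod_fourier_integral_le)
  define G where "G = (\<lambda>M \<xi>. indicator {-real M..<real M} \<xi> * (cmod (\<phi> \<xi>))\<^sup>2)"
  have G_int: "integrable lebesgue (G M)" for M
  proof -
    have "(\<lambda>\<xi>. indicator {-real M..<real M} \<xi> * \<phi> \<xi>) \<in> L2"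
    proof (rule L2_bounded_support[of _ B "-real M" "real M"])
      show "(\<lambda>\<xi>. indicator {-real M..<real M} \<xi> * \<phi> \<xi>) \<in> borel_measurable lebesgue"
        by (intro borel_measurable_times borel_measurable_indicator \<phi>_meas) auto
      show "cmod (indicator {-real M..<real M} x * \<phi> x) \<le> B" for x
        using B[of x] order_trans[OF norm_ge_zero B[of x]] by (auto simp: indicator_def)
    qed auto
    moreover have "(\<lambda>\<xi>. (cmod (indicator {-real M..<real M} \<xi> * \<phi> \<xi>))\<^sup>2) = G M"
      by (auto simp: G_def indicator_def)
    ultimately show ?thesis by (metis L2_integrable_sq)
  qed
  have G_eq: "(LINT \<xi>|lebesgue. G M \<xi>) = (LINT \<xi>|lebesgue. indicator {0..<1} \<xi> * S M \<xi>)" for M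
  proof -
    have "(LINT \<xi>|lebesgue. G M \<xi>)
        = (LINT \<xi>|lebesgue. indicator {0..<1} \<xi> *\<^sub>R (\<Sum>k\<in>{-int M..<int M}. G M (\<xi> + of_int k)))"
      by (rule integral_unfold_unit[OF G_int]) (simp add: G_def)
    also have "\<dots> = (LINT \<xi>|lebesgue. indicator {0..<1} \<xi> * S M \<xi>)"
    proof (rule Bochner_Integration.integral_cong)
      fix \<xi> :: real
      have "G M (\<xi> + of_int k) = (cmod (\<phi> (\<xi> + of_int k)))\<^sup>2"
        if "\<xi> \<in> {0..<1}" "k \<in> {-int M..<int M}" for k
      proof -
        have "- real M \<le> of_int k" "of_int k + 1 \<le> real M" using that(2) by auto
        then show ?thesis using that(1) by (simp add: G_def)
      qed
      then show "indicator {0..<1} \<xi> *\<^sub>R (\<Sum>k\<in>{-int M..<int M}. G M (\<xi> + of_int k)) = indicator {0..<1} \<xi> * S M \<xi>"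
        by (auto simp: indicator_def S_def)
    qed simp
    finally show ?thesis .
  qed
  have "(\<lambda>M. LINT \<xi>|lebesgue. indicator {0..<1} \<xi> * S M \<xi>)
      \<longlonglongrightarrow> (LINT \<xi>|lebesgue. indicator {0..<1::real} \<xi> * (norm2 f)\<^sup>2)"
  proof (rule integral_dominated_convergence[where w = "\<lambda>\<xi>. indicator {0..<1::real} \<xi> * (norm2 f)\<^sup>2"])
    have i: "integrable lebesgue (indicat_real {0..<1::real})" by (simp add: integrable_indicator_iff)
    then show "integrable lebesgue (\<lambda>\<xi>. indicator {0..<1::real} \<xi> * (norm2 f)\<^sup>2)" by simp
    then show "(\<lambda>\<xi>. indicator {0..<1::real} \<xi> * (norm2 f)\<^sup>2) \<in> borel_measurable lebesgue"
      by (rule borel_measurable_integrable)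
    show "(\<lambda>\<xi>. indicator {0..<1} \<xi> * S M \<xi>) \<in> borel_measurable lebesgue" for M
      using borel_measurable_integrable[OF i] continuous_lebesgue_measurable[OF S_cont]
      by (rule borel_measurable_times)
    show "AE \<xi> in lebesgue. (\<lambda>M. indicator {0..<1} \<xi> * S M \<xi>) \<longlonglongrightarrow> indicator {0..<1} \<xi> * (norm2 f)\<^sup>2"
      by (intro AE_I2 tendsto_intros S)
    have "0 \<le> S M \<xi>" for M \<xi> unfolding S_def by (intro sum_nonneg) auto
    then show "AE \<xi> in lebesgue. norm (indicator {0..<1} \<xi> * S M \<xi>) \<le> indicator {0..<1} \<xi> * (norm2 f)\<^sup>2" for M
      using S(1) by (auto simp: indicator_def)
  qed
  then have lim: "(\<lambda>M. LINT \<xi>|lebesgue. G M \<xi>) \<longlonglongrightarrow> (norm2 f)\<^sup>2"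
    by (simp add: G_eq)
  have mono: "AE \<xi> in lebesgue. mono (\<lambda>M. G M \<xi>)"
    by (rule AE_I2) (auto simp: mono_def G_def indicator_def)
  have conv: "AE \<xi> in lebesgue. (\<lambda>M. G M \<xi>) \<longlonglongrightarrow> (cmod (\<phi> \<xi>))\<^sup>2"
  proof (rule AE_I2, rule tendsto_eventually)
    fix \<xi> :: real
    obtain M0 where M0: "\<bar>\<xi>\<bar> < real M0" using reals_Archimedean2 by blast
    have "G M \<xi> = (cmod (\<phi> \<xi>))\<^sup>2" if "M0 \<le> M" for M
    proof -
      have "real M0 \<le> real M" using that by simp
      then have "\<xi> \<in> {-real M..<real M}" using M0 by auto
      then show ?thesis by (simp add: G_def)
    qed
    then show "\<forall>\<^sub>F M in sequentially. G M \<xi> = (cmod (\<phi> \<xi>))\<^sup>2"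
      by (rule eventually_sequentiallyI)
  qed
  have "integrable lebesgue (\<lambda>\<xi>. (cmod (\<phi> \<xi>))\<^sup>2)" "(LINT \<xi>|lebesgue. (cmod (\<phi> \<xi>))\<^sup>2) = (norm2 f)\<^sup>2"
    by (rule integral_monotone_convergence_nonneg[OF G_int mono _ conv lim]; simp add: G_def)+
  then show ?thesis unfolding \<phi>_def[symmetric] by (simp add: L2_def norm2_def)
qed

lemma measurable_affine_lebesgue:
  fixes c :: real
  assumes "c \<noteq> 0" shows "(\<lambda>x. t + c * x) \<in> lebesgue \<rightarrow>\<^sub>M lebesgue"
  using lebesgue_affine_measurable[of "\<lambda>_. c" t] assms by simp

lemma L2_affine:
  assumes f: "f \<in> L2" and "c \<noteq> 0"
  shows "(\<lambda>x. f (t + c * x)) \<in> L2" and "norm2 (\<lambda>x. f (t + c * x)) = norm2 f / sqrt \<bar>c\<bar>"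
proof -
  from measurable_compose[OF measurable_affine_lebesgue[OF assms(2)] L2_measurable[OF f]]
  have "(\<lambda>x. f (t + c * x)) \<in> borel_measurable lebesgue" .
  moreover have "integrable lebesgue (\<lambda>x. (cmod (f (t + c * x)))\<^sup>2)"
    by (rule lebesgue_integrable_real_affine[OF L2_integrable_sq[OF f] assms(2)])
  ultimately show "(\<lambda>x. f (t + c * x)) \<in> L2" by (simp add: L2_def)
  have "(LINT x|lebesgue. (cmod (f x))\<^sup>2) = \<bar>c\<bar> *\<^sub>R (LINT x|lebesgue. (cmod (f (t + c * x)))\<^sup>2)"
    by (rule lebesgue_integral_real_affine[OF assms(2)])
  then show "norm2 (\<lambda>x. f (t + c * x)) = norm2 f / sqrt \<bar>c\<bar>"
    using assms(2) by (simp add: norm2_def real_sqrt_mult)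
qed

lemma AE_affine:
  assumes "AE x in lebesgue. P x" "c \<noteq> 0"
  shows "AE x in lebesgue. P (t + c * x :: real)"
proof -
  note m = measurable_affine_lebesgue[OF assms(2), of t]
  from assms(1) obtain N where N: "{x. \<not> P x} \<subseteq> N" "N \<in> null_sets lebesgue"
    by (auto elim!: AE_E simp: null_sets_def)
  have NL: "N \<in> sets lebesgue" using N(2) by auto
  have ind: "indicator N \<in> borel_measurable lebesgue" using NL by simp
  have "0 = ennreal \<bar>c\<bar> * (\<integral>\<^sup>+x. indicator N (t + c * x) \<partial>lebesgue)"
    using nn_integral_real_affine_lebesgue[of "indicator N" c t] NL N(2) assms(2) by (simp add: null_sets_def)
  then have "(\<integral>\<^sup>+x. indicator N (t + c * x) \<partial>lebesgue) = 0" using assms(2) by simp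
  then have "AE x in lebesgue. indicator N (t + c * x) = (0 :: ennreal)"
    by (subst (asm) nn_integral_0_iff_AE) (use measurable_compose[OF m ind] in auto)
  then show ?thesis
    by eventually_elim (use N(1) in \<open>auto simp: indicator_eq_0_iff\<close>)
qed

lemma fourier_integral_affine:
  assumes "c \<noteq> 0"
  shows "fourier_integral (\<lambda>x. f (t + c * x)) \<xi> = chr (t * \<xi> / c) / of_real \<bar>c\<bar> * fourier_integral f (\<xi> / c)"
proof -
  have "fourier_integral f (\<xi> / c) = \<bar>c\<bar> *\<^sub>R (LINT x|lebesgue. f (t + c * x) * chr (- ((t + c * x) * (\<xi> / c))))"
    unfolding fourier_integral_chr by (rule lebesgue_integral_real_affine[OF assms])
  also have "(\<lambda>x. f (t + c * x) * chr (- ((t + c * x) * (\<xi> / c))))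
      = (\<lambda>x. chr (- (t * \<xi> / c)) * (f (t + c * x) * chr (- (x * \<xi>))))"
  proof
    fix x
    have "- ((t + c * x) * (\<xi> / c)) = - (t * \<xi> / c) + - (x * \<xi>)"
      using assms by (simp add: field_simps)
    then have "chr (- ((t + c * x) * (\<xi> / c))) = chr (- (t * \<xi> / c)) * chr (- (x * \<xi>))"
      by (simp only: chr_add)
    then show "f (t + c * x) * chr (- ((t + c * x) * (\<xi> / c)))
      = chr (- (t * \<xi> / c)) * (f (t + c * x) * chr (- (x * \<xi>)))" by simp
  qed
  also have "(LINT x|lebesgue. chr (- (t * \<xi> / c)) * (f (t + c * x) * chr (- (x * \<xi>))))
      = chr (- (t * \<xi> / c)) * fourier_integral (\<lambda>x. f (t + c * x)) \<xi>"
    unfolding fourier_integral_chr by simp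
  finally have "chr (t * \<xi> / c) * fourier_integral f (\<xi> / c)
      = of_real \<bar>c\<bar> * (chr (t * \<xi> / c) * chr (- (t * \<xi> / c))) * fourier_integral (\<lambda>x. f (t + c * x)) \<xi>"
    by (simp add: scaleR_conv_of_real)
  moreover have "chr (t * \<xi> / c) * chr (- (t * \<xi> / c)) = 1" by (simp add: chr_add[symmetric])
  ultimately have "chr (t * \<xi> / c) * fourier_integral f (\<xi> / c)
      = of_real \<bar>c\<bar> * fourier_integral (\<lambda>x. f (t + c * x)) \<xi>" by (simp only: mult_1_right)
  then show ?thesis using assms by (simp add: field_simps)
qed

text \<open>
  Square-integrable functions of bounded support. They are integrable, so for them the Fourier integral
  converges absolutely and needs no limit.
\<close>

definition L2_bdd :: "(real \<Rightarrow> complex) set" where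
  "L2_bdd = {f \<in> L2. \<exists>N. \<forall>x. N < \<bar>x\<bar> \<longrightarrow> f x = 0}"

lemma L2_bddE:
  assumes "f \<in> L2_bdd"
  obtains N where "f \<in> L2" "N > 0" "\<And>x. N < \<bar>x\<bar> \<Longrightarrow> f x = 0"
proof -
  from assms obtain N where "f \<in> L2" "\<And>x. N < \<bar>x\<bar> \<Longrightarrow> f x = 0" by (auto simp: L2_bdd_def)
  then show thesis using that[of "max N 1"] by auto
qed

lemma L2_bdd_imp_L2: "f \<in> L2_bdd \<Longrightarrow> f \<in> L2"
  by (simp add: L2_bdd_def)

lemma L2_bdd_integrable: "f \<in> L2_bdd \<Longrightarrow> integrable lebesgue f"
proof (elim L2_bddE)
  fix N assume f: "f \<in> L2" "\<And>x. N < \<bar>x\<bar> \<Longrightarrow> f x = 0"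
  show "integrable lebesgue f"
    by (rule L2_bounded_support_integrable[OF f(1), of "-N" N], rule f(2)) auto
qed

text \<open>
  An affine substitution moves the support into the unit interval.
\<close>

lemma Plancherel_L2_bdd:
  assumes "f \<in> L2_bdd"
  shows "fourier_integral f \<in> L2" and "norm2 (fourier_integral f) = norm2 f"
proof -
  from assms obtain N where f: "f \<in> L2" and "N > 0" and supp: "\<And>x. N < \<bar>x\<bar> \<Longrightarrow> f x = 0"
    by (rule L2_bddE) blast
  define c where "c = 2 * N"
  have c: "c > 0" "c \<noteq> 0" using \<open>N > 0\<close> by (auto simp: c_def)
  define g where "g = (\<lambda>x. f (-N + c * x))"
  have g: "g \<in> L2" "norm2 g = norm2 f / sqrt \<bar>c\<bar>" unfolding g_def by (rule L2_affine[OF f c(2)])+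
  have "g x = 0" if "x \<notin> {0..1}" for x
  proof -
    have "x < 0 \<or> 1 < x" using that by auto
    then have "c * x < 0 \<or> c < c * x" using c(1) by (simp add: mult_less_0_iff)
    then have "N < \<bar>-N + c * x\<bar>" by (auto simp: c_def)
    then show ?thesis by (simp add: g_def supp)
  qed
  from Plancherel_unit_interval[OF g(1) this]
  have G: "fourier_integral g \<in> L2" "norm2 (fourier_integral g) = norm2 f / sqrt \<bar>c\<bar>"
    by (auto simp: g)
  have eq: "fourier_integral f \<xi> = of_real c * chr (N * \<xi>) * fourier_integral g (0 + c * \<xi>)" for \<xi>
  proof -
    have "fourier_integral g (c * \<xi>) = chr (- (N * \<xi>)) / of_real c * fourier_integral f \<xi>"
      using fourier_integral_affine[of c f "-N" "c * \<xi>"] c by (simp add: g_def)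
    then have "of_real c * chr (N * \<xi>) * fourier_integral g (0 + c * \<xi>)
        = (chr (N * \<xi>) * chr (- (N * \<xi>))) * fourier_integral f \<xi>"
      using c by simp
    then show ?thesis by (simp add: chr_add[symmetric])
  qed
  have m: "fourier_integral f \<in> borel_measurable lebesgue"
    by (intro continuous_lebesgue_measurable fourier_integral_continuous L2_bdd_integrable assms)
  note Gc = L2_affine[OF G(1) c(2), of 0]
  show L2: "fourier_integral f \<in> L2"
    by (rule L2_dominated[OF Gc(1) m, of c]) (use c in \<open>simp add: eq norm_mult\<close>)
  have "norm2 (fourier_integral f) = c * norm2 (\<lambda>\<xi>. fourier_integral g (0 + c * \<xi>))"
    using c norm2_scale[of "of_real c" "\<lambda>\<xi>. fourier_integral g (0 + c * \<xi>)"]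
    by (simp add: norm2_def eq norm_mult)
  also have "\<dots> = norm2 f" unfolding Gc(2) G(2) using c by simp
  finally show "norm2 (fourier_integral f) = norm2 f" .
qed

section \<open>The Fourier transform as an isometry of square-integrable functions\<close>

abbreviation trunc :: "(real \<Rightarrow> complex) \<Rightarrow> nat \<Rightarrow> real \<Rightarrow> complex" where
  "trunc f n \<equiv> (\<lambda>x. indicator {- real n..real n} x * f x)"

lemma trunc_L2_bdd: "f \<in> L2 \<Longrightarrow> trunc f n \<in> L2_bdd"
proof -
  assume "f \<in> L2"
  then have "trunc f n \<in> L2" by (rule L2_indicator) simp
  moreover have "\<forall>x. real n < \<bar>x\<bar> \<longrightarrow> trunc f n x = 0" by (auto simp: indicator_def)
  ultimately show "trunc f n \<in> L2_bdd" unfolding L2_bdd_def by blast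
qed

lemma L2_bdd_combine:
  assumes "f \<in> L2_bdd" "g \<in> L2_bdd"
  shows "(\<lambda>x. a * f x + b * g x) \<in> L2_bdd"
proof -
  obtain M where M: "f \<in> L2" "\<And>x. M < \<bar>x\<bar> \<Longrightarrow> f x = 0" using assms(1) by (auto simp: L2_bdd_def)
  obtain N where N: "g \<in> L2" "\<And>x. N < \<bar>x\<bar> \<Longrightarrow> g x = 0" using assms(2) by (auto simp: L2_bdd_def)
  have "(\<lambda>x. a * f x + b * g x) \<in> L2" by (intro L2_intros M N)
  then show ?thesis using M(2) N(2) by (auto simp: L2_bdd_def intro!: exI[of _ "max M N"])
qed

lemma L2_bdd_diff: "f \<in> L2_bdd \<Longrightarrow> g \<in> L2_bdd \<Longrightarrow> (\<lambda>x. f x - g x) \<in> L2_bdd"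
  using L2_bdd_combine[of f g 1 "-1"] by simp

lemma fourier_integral_combine:
  assumes "integrable lebesgue f" "integrable lebesgue g"
  shows "fourier_integral (\<lambda>x. a * f x + b * g x) \<xi> = a * fourier_integral f \<xi> + b * fourier_integral g \<xi>"
proof -
  have "integrable lebesgue (\<lambda>x. f x * chr (- (x * \<xi>)))" "integrable lebesgue (\<lambda>x. g x * chr (- (x * \<xi>)))"
    using assms by (auto intro!: integrable_mult_chr continuous_lebesgue_measurable continuous_intros)
  then show ?thesis
    unfolding fourier_integral_chr distrib_right mult.assoc by simp
qed

lemma Plancherel_L2_bdd_diff:
  assumes "f \<in> L2_bdd" "g \<in> L2_bdd"
  shows "norm2 (\<lambda>\<xi>. fourier_integral f \<xi> - fourier_integral g \<xi>) = norm2 (\<lambda>x. f x - g x)"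
proof -
  have "fourier_integral (\<lambda>x. f x - g x) = (\<lambda>\<xi>. fourier_integral f \<xi> - fourier_integral g \<xi>)"
    using fourier_integral_combine[OF L2_bdd_integrable L2_bdd_integrable, OF assms, of 1 "-1"] by auto
  then show ?thesis using Plancherel_L2_bdd(2)[OF L2_bdd_diff[OF assms]] by simp
qed

text \<open>
  The choice in the definition of \<open>fourier\<close> is justified because the transforms of the truncations form
  a Cauchy sequence, their distances being those of the truncations.
\<close>

lemma fourier_L2_limit:
  assumes f: "f \<in> L2"
  shows "fourier f \<in> L2"
    and "(\<lambda>n. norm2 (\<lambda>\<xi>. fourier_integral (trunc f n) \<xi> - fourier f \<xi>)) \<longlonglongrightarrow> 0"
proof -
  note tc = trunc_L2_bdd[OF f]
  have FL2: "fourier_integral (trunc f n) \<in> L2" for n by (rule Plancherel_L2_bdd(1)[OF tc])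
  obtain g where g: "g \<in> L2" "(\<lambda>n. norm2 (\<lambda>\<xi>. fourier_integral (trunc f n) \<xi> - g \<xi>)) \<longlonglongrightarrow> 0"
  proof (rule L2_complete[of "\<lambda>n. fourier_integral (trunc f n)"])
    fix \<epsilon> :: real assume "\<epsilon> > 0"
    from LIMSEQ_D[OF L2_truncation_tendsto[OF f], of "\<epsilon> / 2"] obtain N where
      N: "\<And>n. N \<le> n \<Longrightarrow> norm2 (\<lambda>x. trunc f n x - f x) < \<epsilon> / 2" using \<open>\<epsilon> > 0\<close> by auto
    have "norm2 (\<lambda>\<xi>. fourier_integral (trunc f m) \<xi> - fourier_integral (trunc f n) \<xi>) < \<epsilon>"
      if "N \<le> m" "N \<le> n" for m n
    proof -
      have "norm2 (\<lambda>x. trunc f m x - trunc f n x)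
          \<le> norm2 (\<lambda>x. trunc f m x - f x) + norm2 (\<lambda>x. f x - trunc f n x)"
        by (intro norm2_triangle_diff f L2_bdd_imp_L2 tc)
      then show ?thesis
        using N[OF that(1)] N[OF that(2)] norm2_minus_commute[of f "trunc f n"]
        by (simp add: Plancherel_L2_bdd_diff[OF tc tc])
    qed
    then show "\<exists>N. \<forall>m\<ge>N. \<forall>n\<ge>N.
      norm2 (\<lambda>x. fourier_integral (trunc f m) x - fourier_integral (trunc f n) x) < \<epsilon>" by blast
  qed (use FL2 in auto)
  have "fourier f \<in> L2 \<and> (\<lambda>n. L2_dist_sq (fourier_integral (trunc f n)) (fourier f)) \<longlonglongrightarrow> 0"
    unfolding fourier_def
    by (rule someI[of _ g]) (use g FL2 in \<open>simp add: L2_dist_sq_tendsto_0_iff\<close>)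
  then show "fourier f \<in> L2"
    "(\<lambda>n. norm2 (\<lambda>\<xi>. fourier_integral (trunc f n) \<xi> - fourier f \<xi>)) \<longlonglongrightarrow> 0"
    using FL2 by (auto simp: L2_dist_sq_tendsto_0_iff)
qed

lemma norm2_tendsto:
  assumes "\<And>n. f n \<in> L2" "g \<in> L2" "(\<lambda>n. norm2 (\<lambda>x. f n x - g x)) \<longlonglongrightarrow> 0"
  shows "(\<lambda>n. norm2 (f n)) \<longlonglongrightarrow> norm2 g"
proof -
  have "(\<lambda>n. norm2 (f n) - norm2 g) \<longlonglongrightarrow> 0"
    by (rule Lim_null_comparison[OF _ assms(3)]) (use norm2_diff_abs assms in auto)
  then show ?thesis by (simp add: LIM_zero_iff)
qed

theorem Plancherel:
  assumes f: "f \<in> L2" shows "norm2 (fourier f) = norm2 f"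
proof -
  note tc = trunc_L2_bdd[OF f]
  have "(\<lambda>n. norm2 (fourier_integral (trunc f n))) \<longlonglongrightarrow> norm2 (fourier f)"
    by (intro norm2_tendsto fourier_L2_limit f Plancherel_L2_bdd(1)[OF tc])
  moreover have "(\<lambda>n. norm2 (fourier_integral (trunc f n))) \<longlonglongrightarrow> norm2 f"
    using norm2_tendsto[OF L2_bdd_imp_L2[OF tc] f L2_truncation_tendsto[OF f]]
    by (simp add: Plancherel_L2_bdd(2)[OF tc])
  ultimately show ?thesis by (rule LIMSEQ_unique)
qed

text \<open>
  Every approximation by functions of bounded support computes the transform. Truncations to the
  symmetric intervals alone would not do, as they are not preserved by affine substitutions.
\<close>

lemma fourier_eqI:
  assumes f: "f \<in> L2" and fn: "\<And>n. fn n \<in> L2_bdd" and lim: "(\<lambda>n. norm2 (\<lambda>x. fn n x - f x)) \<longlonglongrightarrow> 0"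
    and g: "g \<in> L2" and glim: "(\<lambda>n. norm2 (\<lambda>\<xi>. fourier_integral (fn n) \<xi> - g \<xi>)) \<longlonglongrightarrow> 0"
  shows "AE \<xi> in lebesgue. fourier f \<xi> = g \<xi>"
proof -
  note tc = trunc_L2_bdd[OF f]
  note F = fourier_L2_limit[OF f]
  have tL2: "fourier_integral (trunc f n) \<in> L2" and nL2: "fourier_integral (fn n) \<in> L2" for n
    by (rule Plancherel_L2_bdd(1), rule tc fn)+
  have le: "norm2 (\<lambda>\<xi>. fourier f \<xi> - g \<xi>) \<le>
      norm2 (\<lambda>\<xi>. fourier_integral (trunc f n) \<xi> - fourier f \<xi>)
      + (norm2 (\<lambda>x. trunc f n x - f x) + norm2 (\<lambda>x. fn n x - f x))
      + norm2 (\<lambda>\<xi>. fourier_integral (fn n) \<xi> - g \<xi>)" for n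
  proof -
    have "norm2 (\<lambda>x. trunc f n x - fn n x)
        \<le> norm2 (\<lambda>x. trunc f n x - f x) + norm2 (\<lambda>x. fn n x - f x)"
      using norm2_triangle_diff[OF L2_bdd_imp_L2[OF tc] f L2_bdd_imp_L2[OF fn], of n n]
        norm2_minus_commute[of f "fn n"] by simp
    then show ?thesis
      using norm2_triangle_diff[OF F(1) tL2[of n] g]
        norm2_triangle_diff[OF tL2[of n] nL2[of n] g]
        norm2_minus_commute[of "fourier f" "fourier_integral (trunc f n)"]
      by (simp add: Plancherel_L2_bdd_diff[OF tc fn])
  qed
  have "(\<lambda>n. norm2 (\<lambda>\<xi>. fourier_integral (trunc f n) \<xi> - fourier f \<xi>)
      + (norm2 (\<lambda>x. trunc f n x - f x) + norm2 (\<lambda>x. fn n x - f x))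
      + norm2 (\<lambda>\<xi>. fourier_integral (fn n) \<xi> - g \<xi>)) \<longlonglongrightarrow> 0 + (0 + 0) + 0"
    by (intro tendsto_add F(2) L2_truncation_tendsto f lim glim)
  from LIMSEQ_le_const[OF this] le have "norm2 (\<lambda>\<xi>. fourier f \<xi> - g \<xi>) \<le> 0" by simp
  then have "norm2 (\<lambda>\<xi>. fourier f \<xi> - g \<xi>) = 0" using norm2_nonneg order_antisym by blast
  then show ?thesis using norm2_eq_0_iff[OF L2_diff[OF F(1) g]] by simp
qed

lemma norm2_combine_tendsto:
  assumes "\<And>n. f n \<in> L2" "\<And>n. g n \<in> L2" "F \<in> L2" "G \<in> L2"
    "(\<lambda>n. norm2 (\<lambda>x. f n x - F x)) \<longlonglongrightarrow> 0" "(\<lambda>n. norm2 (\<lambda>x. g n x - G x)) \<longlonglongrightarrow> 0"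
  shows "(\<lambda>n. norm2 (\<lambda>x. (a * f n x + b * g n x) - (a * F x + b * G x))) \<longlonglongrightarrow> 0"
proof (rule Lim_null_comparison)
  have eq: "(a * f n x + b * g n x) - (a * F x + b * G x) = a * (f n x - F x) + b * (g n x - G x)" for n x
    by (simp add: algebra_simps)
  have "norm2 (\<lambda>x. (a * f n x + b * g n x) - (a * F x + b * G x))
      \<le> cmod a * norm2 (\<lambda>x. f n x - F x) + cmod b * norm2 (\<lambda>x. g n x - G x)" for n
    using norm2_triangle[of "\<lambda>x. a * (f n x - F x)" "\<lambda>x. b * (g n x - G x)"] assms(1-4)
    unfolding eq norm2_scale by (simp add: L2_scale L2_diff)
  then show "\<forall>\<^sub>F n in sequentially. norm (norm2 (\<lambda>x. (a * f n x + b * g n x) - (a * F x + b * G x)))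
      \<le> cmod a * norm2 (\<lambda>x. f n x - F x) + cmod b * norm2 (\<lambda>x. g n x - G x)" by simp
  have "(\<lambda>n. cmod a * norm2 (\<lambda>x. f n x - F x) + cmod b * norm2 (\<lambda>x. g n x - G x))
      \<longlonglongrightarrow> cmod a * 0 + cmod b * 0"
    by (intro tendsto_intros assms)
  then show "(\<lambda>n. cmod a * norm2 (\<lambda>x. f n x - F x) + cmod b * norm2 (\<lambda>x. g n x - G x)) \<longlonglongrightarrow> 0"
    by simp
qed

lemma fourier_combine:
  assumes f: "f \<in> L2" and g: "g \<in> L2"
  shows "AE \<xi> in lebesgue. fourier (\<lambda>x. a * f x + b * g x) \<xi> = a * fourier f \<xi> + b * fourier g \<xi>"
proof (rule fourier_eqI)
  note tc = trunc_L2_bdd[OF f] trunc_L2_bdd[OF g]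
  show "(\<lambda>x. a * f x + b * g x) \<in> L2" by (intro L2_intros f g)
  show "(\<lambda>x. a * trunc f n x + b * trunc g n x) \<in> L2_bdd" for n by (intro L2_bdd_combine tc)
  show "(\<lambda>n. norm2 (\<lambda>x. (a * trunc f n x + b * trunc g n x) - (a * f x + b * g x))) \<longlonglongrightarrow> 0"
    by (intro norm2_combine_tendsto L2_truncation_tendsto f g L2_bdd_imp_L2 tc)
  show "(\<lambda>\<xi>. a * fourier f \<xi> + b * fourier g \<xi>) \<in> L2" by (intro L2_intros fourier_L2_limit f g)
  show "(\<lambda>n. norm2 (\<lambda>\<xi>. fourier_integral (\<lambda>x. a * trunc f n x + b * trunc g n x) \<xi>
      - (a * fourier f \<xi> + b * fourier g \<xi>))) \<longlonglongrightarrow> 0"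
    unfolding fourier_integral_combine[OF L2_bdd_integrable[OF tc(1)] L2_bdd_integrable[OF tc(2)]]
    by (intro norm2_combine_tendsto fourier_L2_limit f g Plancherel_L2_bdd(1) tc)
qed

lemma fourier_scale: "f \<in> L2 \<Longrightarrow> AE \<xi> in lebesgue. fourier (\<lambda>x. c * f x) \<xi> = c * fourier f \<xi>"
  using fourier_combine[of f f c 0] by simp

lemma fourier_diff:
  "f \<in> L2 \<Longrightarrow> g \<in> L2 \<Longrightarrow> AE \<xi> in lebesgue. fourier (\<lambda>x. f x - g x) \<xi> = fourier f \<xi> - fourier g \<xi>"
  using fourier_combine[of f g 1 "-1"] by simp

lemma fourier_sum:
  assumes "finite F" "\<And>i. i \<in> F \<Longrightarrow> f i \<in> L2"
  shows "AE \<xi> in lebesgue. fourier (\<lambda>x. \<Sum>i\<in>F. c i * f i x) \<xi> = (\<Sum>i\<in>F. c i * fourier (f i) \<xi>)"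
  using assms
proof (induction F)
  case empty
  show ?case using fourier_scale[of "\<lambda>x. 0" 0] by simp
next
  case (insert i F)
  have s: "(\<lambda>x. \<Sum>i\<in>F. c i * f i x) \<in> L2" by (intro L2_sum L2_scale insert.prems) auto
  have i: "f i \<in> L2" using insert.prems by auto
  have "AE \<xi> in lebesgue. fourier (\<lambda>x. \<Sum>i\<in>F. c i * f i x) \<xi> = (\<Sum>i\<in>F. c i * fourier (f i) \<xi>)"
    by (rule insert.IH) (use insert.prems in auto)
  with fourier_combine[OF i s, of "c i" 1] show ?case
    by eventually_elim (use insert.hyps in simp)
qed

lemma fourier_norm2_diff:
  assumes "f \<in> L2" "g \<in> L2"
  shows "norm2 (\<lambda>\<xi>. fourier f \<xi> - fourier g \<xi>) = norm2 (\<lambda>x. f x - g x)"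
proof -
  have "norm2 (\<lambda>\<xi>. fourier f \<xi> - fourier g \<xi>) = norm2 (fourier (\<lambda>x. f x - g x))"
  proof (rule norm2_cong_AE)
    show "AE \<xi> in lebesgue. cmod (fourier f \<xi> - fourier g \<xi>) = cmod (fourier (\<lambda>x. f x - g x) \<xi>)"
      using fourier_diff[OF assms] by eventually_elim simp
  qed (intro L2_measurable L2_diff fourier_L2_limit assms)+
  then show ?thesis using Plancherel[OF L2_diff[OF assms]] by simp
qed

text \<open>
  Polarization: norms determine the real part of an inner product, and the imaginary part is the real part
  for \<open>\<i> * f\<close>, up to sign.
\<close>

theorem fourier_inner:
  assumes f: "f \<in> L2" and g: "g \<in> L2"
  shows "L2_inner (fourier f) (fourier g) = L2_inner f g"
proof -
  have re: "Re (L2_inner (fourier f) (fourier g)) = Re (L2_inner f g)" if "f \<in> L2" for f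
    using norm2_diff_sq[OF fourier_L2_limit(1)[OF that] fourier_L2_limit(1)[OF g]]
      norm2_diff_sq[OF that g] by (simp add: fourier_norm2_diff that g Plancherel)
  have "L2_inner (fourier (\<lambda>x. \<i> * f x)) (fourier g) = L2_inner (\<lambda>\<xi>. \<i> * fourier f \<xi>) (fourier g)"
    by (rule L2_inner_cong_AE) (auto intro!: L2_measurable fourier_L2_limit L2_scale f g fourier_scale)
  then have "Im (L2_inner (fourier f) (fourier g)) = Im (L2_inner f g)"
    using re[OF L2_scale[OF f, of \<i>]] by (simp add: L2_inner_scale_left)
  with re[OF f] show ?thesis by (simp add: complex_eq_iff)
qed

lemma fourier_affine:
  assumes f: "f \<in> L2" and c: "c \<noteq> 0"
  shows "AE \<xi> in lebesgue. fourier (\<lambda>x. f (t + c * x)) \<xi> = chr (t * \<xi> / c) / of_real \<bar>c\<bar> * fourier f (\<xi> / c)"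
proof (rule fourier_eqI)
  note tc = trunc_L2_bdd[OF f]
  note F = fourier_L2_limit[OF f]
  have ic: "1 / c \<noteq> 0" using c by simp
  show "(\<lambda>x. f (t + c * x)) \<in> L2" by (rule L2_affine[OF f c])
  show "(\<lambda>x. trunc f n (t + c * x)) \<in> L2_bdd" for n
  proof -
    have "trunc f n (t + c * x) = 0" if "(real n + \<bar>t\<bar>) / \<bar>c\<bar> < \<bar>x\<bar>" for x
    proof -
      have "real n + \<bar>t\<bar> < \<bar>c * x\<bar>" using that c by (simp add: divide_less_eq abs_mult mult.commute)
      then have "real n < \<bar>t + c * x\<bar>" by linarith
      then show ?thesis by (auto simp: indicator_def)
    qed
    then show ?thesis using L2_affine(1)[OF L2_bdd_imp_L2[OF tc] c] unfolding L2_bdd_def by blast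
  qed
  have "norm2 (\<lambda>x. trunc f n (t + c * x) - f (t + c * x)) = norm2 (\<lambda>x. trunc f n x - f x) / sqrt \<bar>c\<bar>" for n
    using L2_affine(2)[OF L2_diff[OF L2_bdd_imp_L2[OF tc] f] c] by simp
  moreover have "(\<lambda>n. norm2 (\<lambda>x. trunc f n x - f x) / sqrt \<bar>c\<bar>) \<longlonglongrightarrow> 0 / sqrt \<bar>c\<bar>"
    by (intro tendsto_intros L2_truncation_tendsto f) (use c in simp)
  ultimately show "(\<lambda>n. norm2 (\<lambda>x. trunc f n (t + c * x) - f (t + c * x))) \<longlonglongrightarrow> 0" by simp
  have m: "(\<lambda>\<xi>. chr (t * \<xi> / c) / of_real \<bar>c\<bar>) \<in> borel_measurable lebesgue"
    by (intro continuous_lebesgue_measurable continuous_intros) (use c in auto)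
  have V: "(\<lambda>\<xi>. chr (t * \<xi> / c) / of_real \<bar>c\<bar> * h (\<xi> / c)) \<in> L2"
    "norm2 (\<lambda>\<xi>. chr (t * \<xi> / c) / of_real \<bar>c\<bar> * h (\<xi> / c)) = norm2 h / sqrt \<bar>c\<bar>"
    if h: "h \<in> L2" for h
  proof -
    have h': "(\<lambda>\<xi>. h (\<xi> / c)) \<in> L2" "norm2 (\<lambda>\<xi>. h (\<xi> / c)) = norm2 h * sqrt \<bar>c\<bar>"
      using L2_affine[OF h ic, of 0] by (simp_all add: real_sqrt_divide abs_divide)
    show "(\<lambda>\<xi>. chr (t * \<xi> / c) / of_real \<bar>c\<bar> * h (\<xi> / c)) \<in> L2"
      by (rule L2_bounded_mult[OF h'(1) m, of "1 / \<bar>c\<bar>"]) (simp add: norm_divide)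
    have "norm2 (\<lambda>\<xi>. chr (t * \<xi> / c) / of_real \<bar>c\<bar> * h (\<xi> / c))
        = norm2 (\<lambda>\<xi>. of_real (1 / \<bar>c\<bar>) * h (\<xi> / c))"
      by (simp add: norm2_def norm_mult norm_divide)
    also have "\<dots> = (1 / \<bar>c\<bar>) * (norm2 h * sqrt \<bar>c\<bar>)"
      unfolding norm2_scale h'(2) by (simp add: norm_divide)
    also have "\<dots> = norm2 h / sqrt \<bar>c\<bar>"
      using c by (simp add: field_simps)
    finally show "norm2 (\<lambda>\<xi>. chr (t * \<xi> / c) / of_real \<bar>c\<bar> * h (\<xi> / c)) = norm2 h / sqrt \<bar>c\<bar>" .
  qed
  show "(\<lambda>\<xi>. chr (t * \<xi> / c) / of_real \<bar>c\<bar> * fourier f (\<xi> / c)) \<in> L2" by (rule V(1)[OF F(1)])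
  have "norm2 (\<lambda>\<xi>. fourier_integral (\<lambda>x. trunc f n (t + c * x)) \<xi>
        - chr (t * \<xi> / c) / of_real \<bar>c\<bar> * fourier f (\<xi> / c))
      = norm2 (\<lambda>\<xi>. fourier_integral (trunc f n) \<xi> - fourier f \<xi>) / sqrt \<bar>c\<bar>" for n
    using V(2)[OF L2_diff[OF Plancherel_L2_bdd(1)[OF tc] F(1)], of n]
    unfolding right_diff_distrib fourier_integral_affine[OF c, of "trunc f n" t] .
  moreover have "(\<lambda>n. norm2 (\<lambda>\<xi>. fourier_integral (trunc f n) \<xi> - fourier f \<xi>) / sqrt \<bar>c\<bar>)
      \<longlonglongrightarrow> 0 / sqrt \<bar>c\<bar>"
    by (intro tendsto_intros F) (use c in simp)
  ultimately show "(\<lambda>n. norm2 (\<lambda>\<xi>. fourier_integral (\<lambda>x. trunc f n (t + c * x)) \<xi>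
      - chr (t * \<xi> / c) / of_real \<bar>c\<bar> * fourier f (\<xi> / c))) \<longlonglongrightarrow> 0" by simp
qed

section \<open>Surjectivity of the Fourier transform\<close>

text \<open>
  Product measures are formed from Borel sets, hence Fubini's theorem is applied to Borel
  representatives.
\<close>

lemma lebesgue_borel_representative:
  fixes f :: "real \<Rightarrow> complex"
  assumes "integrable lebesgue f"
  obtains f' where "integrable lborel f'" "AE x in lebesgue. f x = f' x"
proof -
  have m: "f \<in> borel_measurable lebesgue" using assms by (rule borel_measurable_integrable)
  have "(\<lambda>x. Re (f x)) \<in> borel_measurable lebesgue" "(\<lambda>x. Im (f x)) \<in> borel_measurable lebesgue"
    using m by auto
  then obtain u v where u: "u \<in> borel_measurable lborel" "AE x in lborel. Re (f x) = u x"
    and v: "v \<in> borel_measurable lborel" "AE x in lborel. Im (f x) = v x"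
    by (blast dest: completion_ex_borel_measurable_real)
  define f' where "f' = (\<lambda>x. of_real (u x) + \<i> * of_real (v x))"
  have f'm: "f' \<in> borel_measurable lborel" unfolding f'_def using u(1) v(1) by measurable
  have "AE x in lborel. f x = f' x"
    using u(2) v(2) by eventually_elim (simp add: f'_def complex_eq_iff)
  then have ae: "AE x in lebesgue. f x = f' x" by (rule AE_completion)
  have "integrable lebesgue f'"
    using integrable_cong_AE[OF m measurable_completion[OF f'm] ae] assms by simp
  then show thesis using that ae integrable_completion[OF f'm] by blast
qed

text \<open>
  Both sides are the double integral of \<open>f x * g \<xi> * chr (- (x * \<xi>))\<close>, taken in the two orders.
\<close>

lemma fourier_integral_multiplication:
  assumes f: "integrable lebesgue f" and g: "integrable lebesgue g"
  shows "(LINT \<xi>|lebesgue. fourier_integral f \<xi> * g \<xi>) = (LINT x|lebesgue. f x * fourier_integral g x)"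
proof -
  obtain u where u: "integrable lborel u" "AE x in lebesgue. f x = u x"
    using lebesgue_borel_representative[OF f] by blast
  obtain v where v: "integrable lborel v" "AE x in lebesgue. g x = v x"
    using lebesgue_borel_representative[OF g] by blast
  note [measurable] = borel_measurable_integrable[OF u(1)] borel_measurable_integrable[OF v(1)]
  have um: "u \<in> borel_measurable lebesgue" and vm: "v \<in> borel_measurable lebesgue"
    by (rule measurable_completion, measurable)+
  have Fb: "fourier_integral h \<xi> = (LBINT x. w x * chr (- (x * \<xi>)))"
    if "integrable lebesgue h" "w \<in> borel_measurable lborel" "AE x in lebesgue. h x = w x" for h w \<xi>
  proof -
    note [measurable] = that(2)
    have "fourier_integral h \<xi> = (LINT x|lebesgue. w x * chr (- (x * \<xi>)))"
      unfolding fourier_integral_chr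
      by (rule integral_cong_AE)
         (use that measurable_completion[OF that(2)] in
           \<open>auto intro!: borel_measurable_times borel_measurable_chr_linear\<close>)
    also have "\<dots> = (LBINT x. w x * chr (- (x * \<xi>)))" by (rule integral_completion) measurable
    finally show ?thesis .
  qed
  note Fu = Fb[OF f borel_measurable_integrable[OF u(1)] u(2)]
    and Fv = Fb[OF g borel_measurable_integrable[OF v(1)] v(2)]
  have Fu_meas: "fourier_integral f \<in> borel_measurable borel"
    by (intro borel_measurable_continuous_onI fourier_integral_continuous f)
  have Fv_meas: "fourier_integral g \<in> borel_measurable borel"
    by (intro borel_measurable_continuous_onI fourier_integral_continuous g)
  have Fu_leb: "fourier_integral f \<in> borel_measurable lebesgue"
    and Fv_leb: "fourier_integral g \<in> borel_measurable lebesgue"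
    by (intro continuous_lebesgue_measurable fourier_integral_continuous f g)+
  have int: "integrable (lborel \<Otimes>\<^sub>M lborel) (\<lambda>(x, \<xi>). u x * (v \<xi> * chr (- (x * \<xi>))))"
  proof (rule lborel_pair.Fubini_integrable)
    show "(\<lambda>(x, \<xi>). u x * (v \<xi> * chr (- (x * \<xi>)))) \<in> borel_measurable (lborel \<Otimes>\<^sub>M lborel)"
      by measurable
    have "integrable lborel (\<lambda>x. cmod (u x) * (LBINT \<xi>. cmod (v \<xi>)))"
      using u(1) by simp
    then show "integrable lborel (\<lambda>x. LBINT y. norm (case (x, y) of (x, \<xi>) \<Rightarrow> u x * (v \<xi> * chr (- (x * \<xi>)))))"
      by (simp add: norm_mult)
    show "AE x in lborel. integrable lborel (\<lambda>y. case (x, y) of (x, \<xi>) \<Rightarrow> u x * (v \<xi> * chr (- (x * \<xi>))))"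
    proof (rule AE_I2)
      fix x
      have "integrable lborel (\<lambda>\<xi>. v \<xi> * chr (- (x * \<xi>)))"
      proof (rule Bochner_Integration.integrable_bound[OF v(1)])
        show "(\<lambda>\<xi>. v \<xi> * chr (- (x * \<xi>))) \<in> borel_measurable lborel" by measurable
      qed (simp add: norm_mult)
      then show "integrable lborel (\<lambda>y. case (x, y) of (x, \<xi>) \<Rightarrow> u x * (v \<xi> * chr (- (x * \<xi>))))"
        by simp
    qed
  qed
  have "(LINT \<xi>|lebesgue. fourier_integral f \<xi> * g \<xi>) = (LINT \<xi>|lebesgue. fourier_integral f \<xi> * v \<xi>)"
    by (rule integral_cong_AE)
       (use g vm v(2) Fu_leb in \<open>auto intro!: borel_measurable_times\<close>)
  also have "\<dots> = (LBINT \<xi>. fourier_integral f \<xi> * v \<xi>)"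
    by (rule integral_completion) (use Fu_meas in measurable)
  also have "\<dots> = (LBINT \<xi>. LBINT x. u x * (v \<xi> * chr (- (x * \<xi>))))"
  proof -
    have "fourier_integral f \<xi> * v \<xi> = (LBINT x. u x * (v \<xi> * chr (- (x * \<xi>))))" for \<xi>
      unfolding Fu by (subst integral_mult_left_zero[symmetric]) (simp add: mult_ac)
    then show ?thesis by simp
  qed
  also have "\<dots> = (LBINT x. LBINT \<xi>. u x * (v \<xi> * chr (- (x * \<xi>))))"
    by (rule lborel_pair.Fubini_integral[OF int])
  also have "\<dots> = (LBINT x. u x * fourier_integral g x)"
    unfolding Fv by (simp add: mult.commute)
  also have "\<dots> = (LINT x|lebesgue. u x * fourier_integral g x)"
    by (rule integral_completion[symmetric]) (use Fv_meas in measurable)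
  also have "\<dots> = (LINT x|lebesgue. f x * fourier_integral g x)"
    by (rule integral_cong_AE)
       (use f um u(2) Fv_leb in \<open>auto intro!: borel_measurable_times\<close>)
  finally show ?thesis .
qed

lemma L2_pairing_tendsto:
  assumes "\<And>n. f n \<in> L2" "\<And>n. g n \<in> L2" "F \<in> L2" "G \<in> L2"
    "(\<lambda>n. norm2 (\<lambda>x. f n x - F x)) \<longlonglongrightarrow> 0" "(\<lambda>n. norm2 (\<lambda>x. g n x - G x)) \<longlonglongrightarrow> 0"
  shows "(\<lambda>n. LINT x|lebesgue. f n x * g n x) \<longlonglongrightarrow> (LINT x|lebesgue. F x * G x)"
proof -
  have CS: "cmod (LINT x|lebesgue. a x * b x) \<le> norm2 a * norm2 b" if "a \<in> L2" "b \<in> L2" for a b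
    using L2_Cauchy_Schwarz[OF that(1) L2_cnj[OF that(2)]] by (simp add: L2_inner_def norm2_def)
  have le: "cmod ((LINT x|lebesgue. f n x * g n x) - (LINT x|lebesgue. F x * G x))
      \<le> norm2 (\<lambda>x. f n x - F x) * norm2 (g n) + norm2 F * norm2 (\<lambda>x. g n x - G x)" for n
  proof -
    have "(LINT x|lebesgue. f n x * g n x) - (LINT x|lebesgue. F x * G x)
        = (LINT x|lebesgue. (f n x - F x) * g n x) + (LINT x|lebesgue. F x * (g n x - G x))"
      using L2_integrable_product assms(1-4)
      by (simp add: left_diff_distrib right_diff_distrib)
    then show ?thesis
      using norm_triangle_mono[OF CS CS, of "\<lambda>x. f n x - F x" "g n" F "\<lambda>x. g n x - G x"] assms(1-4)
      by (simp add: L2_diff)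
  qed
  have "(\<lambda>n. norm2 (\<lambda>x. f n x - F x) * norm2 (g n) + norm2 F * norm2 (\<lambda>x. g n x - G x))
      \<longlonglongrightarrow> 0 * norm2 G + norm2 F * 0"
    by (rule tendsto_add[OF tendsto_mult tendsto_mult];
        (rule norm2_tendsto tendsto_const assms)+)
  then have "(\<lambda>n. norm2 (\<lambda>x. f n x - F x) * norm2 (g n) + norm2 F * norm2 (\<lambda>x. g n x - G x)) \<longlonglongrightarrow> 0"
    by simp
  with always_eventually[rule_format, OF le]
  have "(\<lambda>n. (LINT x|lebesgue. f n x * g n x) - (LINT x|lebesgue. F x * G x)) \<longlonglongrightarrow> 0"
    by (rule Lim_null_comparison)
  then show ?thesis by (simp add: LIM_zero_iff)
qed

lemma fourier_multiplication:
  assumes f: "f \<in> L2" and g: "g \<in> L2"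
  shows "(LINT \<xi>|lebesgue. fourier f \<xi> * g \<xi>) = (LINT x|lebesgue. f x * fourier g x)"
proof -
  note tf = trunc_L2_bdd[OF f] and tg = trunc_L2_bdd[OF g]
  have "(\<lambda>n. LINT \<xi>|lebesgue. fourier_integral (trunc f n) \<xi> * trunc g n \<xi>)
      \<longlonglongrightarrow> (LINT \<xi>|lebesgue. fourier f \<xi> * g \<xi>)"
    by (rule L2_pairing_tendsto[OF Plancherel_L2_bdd(1)[OF tf] L2_bdd_imp_L2[OF tg]
        fourier_L2_limit(1)[OF f] g fourier_L2_limit(2)[OF f] L2_truncation_tendsto[OF g]])
  moreover have "(\<lambda>n. LINT \<xi>|lebesgue. trunc f n \<xi> * fourier_integral (trunc g n) \<xi>)
      \<longlonglongrightarrow> (LINT x|lebesgue. f x * fourier g x)"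
    by (rule L2_pairing_tendsto[OF L2_bdd_imp_L2[OF tf] Plancherel_L2_bdd(1)[OF tg]
        f fourier_L2_limit(1)[OF g] L2_truncation_tendsto[OF f] fourier_L2_limit(2)[OF g]])
  ultimately show ?thesis
    unfolding fourier_integral_multiplication[OF L2_bdd_integrable[OF tf] L2_bdd_integrable[OF tg]]
    by (rule LIMSEQ_unique)
qed

text \<open>
  The preimage is \<open>cnj (fourier (cnj g))\<close>, the value of the adjoint. The adjoint is an isometry as well, so
  the multiplication formula gives \<open>L2_inner (fourier f) g = (norm2 f)\<^sup>2\<close>; as all three norms agree, the distance
  of \<open>fourier f\<close> and \<open>g\<close> vanishes.
\<close>

theorem fourier_surj:
  assumes g: "g \<in> L2"
  obtains f where "f \<in> L2" "AE \<xi> in lebesgue. fourier f \<xi> = g \<xi>"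
proof -
  define f where "f = (\<lambda>x. cnj (fourier (\<lambda>\<xi>. cnj (g \<xi>)) x))"
  note Fcg = fourier_L2_limit(1)[OF L2_cnj[OF g]]
  have f: "f \<in> L2" unfolding f_def by (intro L2_cnj Fcg)
  have "norm2 f = norm2 (fourier (\<lambda>\<xi>. cnj (g \<xi>)))" by (simp add: norm2_def f_def)
  also have "\<dots> = norm2 g" unfolding Plancherel[OF L2_cnj[OF g]] by (simp add: norm2_def)
  finally have norms: "norm2 f = norm2 g" .
  have "L2_inner (fourier f) g = (LINT x|lebesgue. f x * fourier (\<lambda>\<xi>. cnj (g \<xi>)) x)"
    unfolding L2_inner_def by (rule fourier_multiplication[OF f L2_cnj[OF g]])
  also have "\<dots> = L2_inner f f" by (simp add: L2_inner_def f_def)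
  also have "\<dots> = of_real ((norm2 g)\<^sup>2)" by (simp add: L2_inner_self norms)
  finally have "(norm2 (\<lambda>\<xi>. fourier f \<xi> - g \<xi>))\<^sup>2 = 0"
    unfolding norm2_diff_sq[OF fourier_L2_limit(1)[OF f] g] Plancherel[OF f] norms
    by (simp del: of_real_power)
  then have "norm2 (\<lambda>\<xi>. fourier f \<xi> - g \<xi>) = 0" by simp
  then show thesis
    using that[OF f] norm2_eq_0_iff[OF L2_diff[OF fourier_L2_limit(1)[OF f] g]] by simp
qed

section \<open>Sets that tile the line by integer translates\<close>

text \<open>
  On a tile each point of the unit interval has one representative \<open>x + k\<close>, so a sum over all
  translates of a function supported on \<open>A\<close> has a single term.
\<close>

lemma tile_representative:
  fixes A :: "real set"
  assumes "\<exists>!n::int. x + of_int n \<in> A" "A \<subseteq> {-real M..<real M}" "x \<in> {0..<1}"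
  obtains k :: int where "x + of_int k \<in> A"
    "\<forall>G :: real \<Rightarrow> 'a::comm_monoid_add. (\<forall>y. y \<notin> A \<longrightarrow> G y = 0) \<longrightarrow>
       (\<Sum>j\<in>{-int M..<int M}. G (x + of_int j)) = G (x + of_int k)"
proof -
  from assms(1) obtain k :: int where k: "x + of_int k \<in> A" "\<And>j::int. x + of_int j \<in> A \<Longrightarrow> j = k"
    by (elim ex1E) blast
  have mem: "k \<in> {-int M..<int M}" using subsetD[OF assms(2) k(1)] assms(3) by auto
  show thesis
  proof (rule that[OF k(1)], intro allI impI)
    fix G :: "real \<Rightarrow> 'a" assume G: "\<forall>y. y \<notin> A \<longrightarrow> G y = 0"
    have "(\<Sum>j\<in>{-int M..<int M}. G (x + of_int j)) = (\<Sum>j\<in>{k}. G (x + of_int j))"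
      by (rule sum.mono_neutral_right) (use mem k(2) G in auto)
    then show "(\<Sum>j\<in>{-int M..<int M}. G (x + of_int j)) = G (x + of_int k)" by simp
  qed
qed

text \<open>
  Characters with integer frequency have period \<open>1\<close>, so a tile may replace the unit interval as domain of integration.
\<close>

lemma integral_chr_tile:
  assumes tile: "AE x in lebesgue. \<exists>!n::int. x + of_int n \<in> A" and A: "A \<in> sets lebesgue"
    and bd: "A \<subseteq> {-real M..<real M}"
  shows "(LINT x|lebesgue. indicator A x * chr (of_int k * x)) = (if k = 0 then 1 else 0)"
proof -
  let ?h = "\<lambda>x. indicator A x * chr (of_int k * x)"
  have chr_m: "(\<lambda>x. chr (of_int k * x)) \<in> borel_measurable lebesgue"
    by (intro continuous_lebesgue_measurable continuous_intros)
  have h_meas: "?h \<in> borel_measurable lebesgue"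
    by (intro borel_measurable_times borel_measurable_indicator A chr_m)
  have h_supp: "?h x = 0" if "x \<notin> {-real M..<real M}" for x
    using that bd by (auto simp: indicator_def)
  have "integrable lebesgue ?h"
  proof (rule L2_bounded_support_integrable[of _ "-real M" "real M"])
    show "?h \<in> L2"
      by (rule L2_bounded_support[OF h_meas, of 1 "-real M" "real M"])
         (use bd in \<open>auto simp: indicator_def norm_mult\<close>)
    show "?h x = 0" if "x \<notin> {-real M..real M}" for x using that by (intro h_supp) auto
  qed
  then have "(LINT x|lebesgue. ?h x)
      = (LINT x|lebesgue. indicator {0..<1} x *\<^sub>R (\<Sum>j\<in>{-int M..<int M}. ?h (x + of_int j)))"
    by (rule integral_unfold_unit) (rule h_supp)
  also have "\<dots> = (LINT x|lebesgue. indicator {0..1} x * chr (of_int k * x))"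
  proof (rule integral_cong_AE)
    have "AE x in lebesgue. x \<noteq> (1 :: real)" by (rule AE_neq_real)
    then show "AE x in lebesgue. indicator {0..<1} x *\<^sub>R (\<Sum>j\<in>{-int M..<int M}. ?h (x + of_int j))
        = indicator {0..1} x * chr (of_int k * x)"
      using tile
    proof eventually_elim
      case (elim x)
      show ?case
      proof (cases "x \<in> {0..<1}")
        case True
        obtain n :: int where n: "x + of_int n \<in> A" and
          n_sum: "\<forall>G :: real \<Rightarrow> complex. (\<forall>y. y \<notin> A \<longrightarrow> G y = 0) \<longrightarrow>
            (\<Sum>j\<in>{-int M..<int M}. G (x + of_int j)) = G (x + of_int n)"
          by (rule tile_representative[OF elim(2) bd True, where ?'a = complex])
        have "(\<Sum>j\<in>{-int M..<int M}. ?h (x + of_int j)) = ?h (x + of_int n)"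
          by (rule n_sum[rule_format]) simp
        then show ?thesis using True n by (simp add: chr_int_mult_add)
      next
        case False
        then show ?thesis using elim by (auto simp: indicator_def)
      qed
    qed
    have shift: "(\<lambda>x. ?h (x + of_int j)) \<in> borel_measurable lebesgue" for j
    proof -
      from measurable_compose[OF measurable_affine_lebesgue[of 1 "of_int j"] h_meas] show ?thesis by (simp add: add.commute)
    qed
    show "(\<lambda>x. indicator {0..<1} x *\<^sub>R (\<Sum>j\<in>{-int M..<int M}. ?h (x + of_int j))) \<in> borel_measurable lebesgue"
      by (intro borel_measurable_scaleR borel_measurable_sum shift borel_measurable_indicator) simp
    show "(\<lambda>x. indicator {0..1} x * chr (of_int k * x)) \<in> borel_measurable lebesgue"
      by (intro borel_measurable_times chr_m L2_measurable[OF L2_indicator_Icc])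
  qed
  also have "\<dots> = (if k = 0 then 1 else 0)" by (rule integral_chr_unit)
  finally show ?thesis .
qed

text \<open>
  The function \<open>f0\<close> transports \<open>f\<close> to the unit interval, tile piece by tile piece. The approximation
  found there is periodic, so it serves on \<open>A\<close> with the same error.
\<close>

lemma trig_poly_dense_tile:
  assumes tile: "AE x in lebesgue. \<exists>!n::int. x + of_int n \<in> A" and A: "A \<in> sets lebesgue"
    and bd: "A \<subseteq> {-real M..<real M}"
    and f: "f \<in> L2" "\<And>x. x \<notin> A \<Longrightarrow> f x = 0" and "\<epsilon> > 0"
  obtains p where "trig_poly p" "norm2 (\<lambda>x. f x - indicator A x * p x) < \<epsilon>"
proof -
  define f0 where "f0 = (\<lambda>x. indicator {0..1} x * (\<Sum>j\<in>{-int M..<int M}. f (x + of_int j)))"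
  have shift: "(\<lambda>x. g (x + of_int j)) \<in> L2" if "g \<in> L2" for g and j :: int
    using L2_affine(1)[OF that, of 1 "of_int j"] by (simp add: add.commute)
  have f0: "f0 \<in> L2" unfolding f0_def by (intro L2_indicator L2_sum shift f) simp
  obtain p where p: "trig_poly p" "norm2 (\<lambda>x. f0 x - indicator {0..1} x * p x) < \<epsilon>"
    using trig_poly_dense_L2[OF f0 _ \<open>\<epsilon> > 0\<close>] by (auto simp: f0_def)
  obtain F c where F: "finite F" "p = (\<lambda>x. \<Sum>k\<in>F. c k * chr (of_int k * x))"
    using trig_poly_imp_sum[OF p(1)] by blast
  have p_per: "p (x + of_int n) = p x" for x n by (simp add: F(2) chr_int_mult_add)
  define D where "D = (\<lambda>x. f x - indicator A x * p x)"
  have D: "D \<in> L2" unfolding D_def using bd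
    by (intro L2_diff f L2_indicator_trig_poly[OF p(1), of _ "-real M" "real M"] A) auto
  have D_supp: "D x = 0" if "x \<notin> A" for x using that f(2) by (simp add: D_def)
  have "(norm2 D)\<^sup>2 = (LINT x|lebesgue. (cmod (D x))\<^sup>2)" by (rule norm2_sq)
  also have "\<dots> = (LINT x|lebesgue. indicator {0..<1} x *\<^sub>R (\<Sum>j\<in>{-int M..<int M}. (cmod (D (x + of_int j)))\<^sup>2))"
  proof (rule integral_unfold_unit[OF L2_integrable_sq[OF D]])
    fix x :: real assume "x \<notin> {-real M..<real M}"
    then have "x \<notin> A" using bd by blast
    then show "(cmod (D x))\<^sup>2 = 0" by (simp add: D_supp)
  qed
  also have "\<dots> = (LINT x|lebesgue. (cmod (f0 x - indicator {0..1} x * p x))\<^sup>2)"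
  proof (rule integral_cong_AE)
    have "AE x in lebesgue. x \<noteq> (1 :: real)" by (rule AE_neq_real)
    then show "AE x in lebesgue. indicator {0..<1} x *\<^sub>R (\<Sum>j\<in>{-int M..<int M}. (cmod (D (x + of_int j)))\<^sup>2)
        = (cmod (f0 x - indicator {0..1} x * p x))\<^sup>2"
      using tile
    proof eventually_elim
      case (elim x)
      show ?case
      proof (cases "x \<in> {0..<1}")
        case True
        obtain n :: int where n: "x + of_int n \<in> A" and
          n_sum: "\<forall>G :: real \<Rightarrow> complex. (\<forall>y. y \<notin> A \<longrightarrow> G y = 0) \<longrightarrow>
            (\<Sum>j\<in>{-int M..<int M}. G (x + of_int j)) = G (x + of_int n)"
          by (rule tile_representative[OF elim(2) bd True, where ?'a = complex])
        have "complex_of_real (\<Sum>j\<in>{-int M..<int M}. (cmod (D (x + of_int j)))\<^sup>2)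
            = of_real ((cmod (D (x + of_int n)))\<^sup>2)"
          using n_sum[rule_format, of "\<lambda>y. of_real ((cmod (D y))\<^sup>2)"] D_supp by simp
        then have "(\<Sum>j\<in>{-int M..<int M}. (cmod (D (x + of_int j)))\<^sup>2) = (cmod (D (x + of_int n)))\<^sup>2"
          by (simp only: of_real_eq_iff)
        moreover have "f0 x = f (x + of_int n)"
          using n_sum[rule_format, of f] f(2) True by (simp add: f0_def)
        ultimately show ?thesis using True n by (simp add: D_def p_per)
      next
        case False
        then show ?thesis using elim by (auto simp: indicator_def f0_def)
      qed
    qed
    show "(\<lambda>x. indicator {0..<1} x *\<^sub>R (\<Sum>j\<in>{-int M..<int M}. (cmod (D (x + of_int j)))\<^sup>2)) \<in> borel_measurable lebesgue"
      by (intro borel_measurable_scaleR borel_measurable_sum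
          borel_measurable_integrable[OF L2_integrable_sq[OF shift[OF D]]] borel_measurable_indicator) simp
    show "(\<lambda>x. (cmod (f0 x - indicator {0..1} x * p x))\<^sup>2) \<in> borel_measurable lebesgue"
      by (intro borel_measurable_integrable L2_integrable_sq L2_diff f0
          L2_indicator_trig_poly[OF p(1), of _ 0 1]) auto
  qed
  also have "\<dots> = (norm2 (\<lambda>x. f0 x - indicator {0..1} x * p x))\<^sup>2" by (rule norm2_sq[symmetric])
  finally have "norm2 D = norm2 (\<lambda>x. f0 x - indicator {0..1} x * p x)"
    using power2_eq_iff_nonneg by (metis norm2_nonneg)
  then show thesis using that[OF p(1)] p(2) by (simp add: D_def)
qed

text \<open>
  The shifted intervals are consecutive and fill \<open>[a1, a1 + 1]\<close>. The exceptional points are the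
  integer translates of the end points. Countability, which is stronger than measure zero, survives the
  exponential map without further argument.
\<close>

lemma three_intervals_tile:
  fixes a1 b1 a2 b2 a3 b3 :: real and k l :: int
  assumes "a1 \<le> b1" "a2 \<le> b2" "a3 \<le> b3"
    and "b1 = a2 - of_int k" "b2 - of_int k = a3 - of_int l" "b3 - of_int l = a1 + 1"
  shows "countable {x. \<not> (\<exists>!n::int. x + of_int n \<in> {a1..b1} \<union> {a2..b2} \<union> {a3..b3})}"
proof (rule countable_subset)
  let ?E = "\<Union>c\<in>{a1, b1, b2 - of_int k}. range (\<lambda>n::int. c - of_int n)"
  show "countable ?E" by (intro countable_UN countable_image) auto
  show "{x. \<not> (\<exists>!n::int. x + of_int n \<in> {a1..b1} \<union> {a2..b2} \<union> {a3..b3})} \<subseteq> ?E"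
  proof (rule subsetI, rule ccontr)
    fix x assume x: "x \<in> {x. \<not> (\<exists>!n::int. x + of_int n \<in> {a1..b1} \<union> {a2..b2} \<union> {a3..b3})}" "x \<notin> ?E"
    have ne: "x + of_int n \<noteq> a1" "x + of_int n \<noteq> b1" "x + of_int n \<noteq> b2 - of_int k" for n :: int
      using x(2) by (auto simp: eq_diff_eq)
    \<comment> \<open>The integer that translates \<open>x\<close> into \<open>[a1, a1 + 1)\<close>.\<close>
    define m where "m = - \<lfloor>x - a1\<rfloor>"
    have m: "a1 < x + of_int m" "x + of_int m < a1 + 1"
      unfolding m_def using floor_correct[of "x - a1"] ne(1)[of "- \<lfloor>x - a1\<rfloor>"] by linarith+
    have m_uniq: "n = m" if "a1 \<le> x + of_int n" "x + of_int n \<le> a1 + 1" for n :: int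
    proof -
      have "x + of_int n \<noteq> a1 + 1" using ne(1)[of "n - 1"] by auto
      then have "of_int n < of_int m + (1::real)" "of_int m < of_int n + (1::real)" using that m by linarith+
      then show ?thesis by linarith
    qed
    have loc: "(n = m \<and> x + of_int m < b1) \<or> (n = m + k \<and> b1 < x + of_int m \<and> x + of_int m < b2 - of_int k)
        \<or> (n = m + l \<and> b2 - of_int k < x + of_int m)"
      if mem: "x + of_int n \<in> {a1..b1} \<union> {a2..b2} \<union> {a3..b3}" for n :: int
    proof -
      consider "a1 \<le> x + of_int n" "x + of_int n \<le> b1" | "a2 \<le> x + of_int n" "x + of_int n \<le> b2"
        | "a3 \<le> x + of_int n" "x + of_int n \<le> b3" using mem by auto
      then show ?thesis
      proof cases
        case 1
        then have "n = m" using assms by (intro m_uniq) linarith+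
        then show ?thesis using 1 ne(2)[of m] by auto
      next
        case 2
        then have "n - k = m" using assms by (intro m_uniq; simp; linarith)
        then have "n = m + k" "b1 \<le> x + of_int m" "x + of_int m \<le> b2 - of_int k" using 2 assms by auto
        then show ?thesis using ne(2,3)[of m] by auto
      next
        case 3
        then have "n - l = m" using assms by (intro m_uniq; simp; linarith)
        then have "n = m + l" "b2 - of_int k \<le> x + of_int m" using 3 assms by auto
        then show ?thesis using ne(3)[of m] by auto
      qed
    qed
    consider "x + of_int m < b1" | "b1 < x + of_int m" "x + of_int m < b2 - of_int k"
      | "b2 - of_int k < x + of_int m" using ne(2,3)[of m] by linarith
    then have "\<exists>!n::int. x + of_int n \<in> {a1..b1} \<union> {a2..b2} \<union> {a3..b3}"
    proof cases
      case 1
      show ?thesis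
      proof (rule ex1I[of _ "m"])
        show "n = m" if "x + of_int n \<in> {a1..b1} \<union> {a2..b2} \<union> {a3..b3}" for n :: int
          using loc[OF that] 1 assms by linarith
      qed (use 1 m assms in auto)
    next
      case 2
      show ?thesis
      proof (rule ex1I[of _ "m + k"])
        show "n = m + k" if "x + of_int n \<in> {a1..b1} \<union> {a2..b2} \<union> {a3..b3}" for n :: int
          using loc[OF that] 2 assms by linarith
      qed (use 2 m assms in auto)
    next
      case 3
      show ?thesis
      proof (rule ex1I[of _ "m + l"])
        show "n = m + l" if "x + of_int n \<in> {a1..b1} \<union> {a2..b2} \<union> {a3..b3}" for n :: int
          using loc[OF that] 3 assms by linarith
      qed (use 3 m assms in auto)
    qed
    then show False using x(1) by blast
  qed
qed

lemma AE_of_countable: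
  fixes P :: "real \<Rightarrow> bool"
  assumes "countable {x. \<not> P x}" shows "AE x in lebesgue. P x"
proof (rule AE_I')
  show "{x. \<not> P x} \<in> null_sets lebesgue"
    by (intro null_sets_completionI countable_imp_null_set_lborel assms)
qed auto

section \<open>Three intervals\<close>

text \<open>
  Equal power sums of orders 1 to 3 determine three numbers up to a permutation. The permutations are grouped by use: of
  one with a fixed point only that point matters, while the two 3-cycles are kept apart.
\<close>

lemma equal_power_sums_3:
  fixes x1 x2 x3 y1 y2 y3 :: complex
  assumes 1: "x1 + x2 + x3 = y1 + y2 + y3"
    and 2: "x1^2 + x2^2 + x3^2 = y1^2 + y2^2 + y3^2"
    and 3: "x1^3 + x2^3 + x3^3 = y1^3 + y2^3 + y3^3"
  obtains "x1 = y1" | "x2 = y2" | "x3 = y3" | "x1 = y2" "x2 = y3" "x3 = y1" | "x1 = y3" "x3 = y2" "x2 = y1"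
proof -
  have pair: "(a = c \<and> b = d) \<or> (a = d \<and> b = c)" if "a + b = c + d" "a^2 + b^2 = c^2 + d^2" for a b c d :: complex
  proof -
    have "(a - c) * (a - d) = 0" using that by algebra
    then show ?thesis using that(1) by auto
  qed
  have "(x1 - y1) * (x1 - y2) * (x1 - y3) = 0" using 1 2 3 by algebra
  then consider "x1 = y1" | "x1 = y2" | "x1 = y3" by auto
  then show thesis
  proof cases
    case 1
    then show thesis by (rule that)
  next
    case 2
    then have "(x2 = y1 \<and> x3 = y3) \<or> (x2 = y3 \<and> x3 = y1)"
      using assms by (intro pair) (auto simp: algebra_simps)
    then show thesis using that 2 by blast
  next
    case 3
    then have "(x2 = y1 \<and> x3 = y2) \<or> (x2 = y2 \<and> x3 = y1)"
      using assms by (intro pair) (auto simp: algebra_simps)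
    then show thesis using that 3 by blast
  qed
qed

lemma chr_eq_iff: "chr a = chr b \<longleftrightarrow> (\<exists>n::int. a = b + of_int n)"
proof
  assume "chr a = chr b"
  then have "chr (a - b) = 1"
    using chr_add[of a "- b"] chr_add[of b "- b"] by simp
  then have "cos (2 * pi * (a - b)) = 1" 
    by (simp add: chr_def complex_eq_iff)
  then obtain n :: int where "2 * pi * (a - b) = of_int n * 2 * pi"
    using cos_one_2pi_int by blast
  then have "a = b + of_int n" by simp
  then show "\<exists>n::int. a = b + of_int n" ..
qed (auto simp: chr_add)

text \<open>
  Shifted left by \<open>k\<close> and \<open>l\<close>, the second and third interval continue the first one, in this order, up to
  \<open>a1 + 1\<close>. Exchanging the last two intervals gives the other cyclic order.
\<close>

definition translates_consecutive ::
    "real \<Rightarrow> real \<Rightarrow> real \<Rightarrow> real \<Rightarrow> real \<Rightarrow> real \<Rightarrow> nat \<Rightarrow> nat \<Rightarrow> bool" where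
  "translates_consecutive a1 b1 a2 b2 a3 b3 k l \<longleftrightarrow>
     b1 = a2 - real k \<and> b2 - real k = a3 - real l \<and> b3 - real l = a1 + 1"

lemma three_intervals_tile_exists:
  assumes "a1 < b1" "a2 < b2" "a3 < b3"
    and "translates_consecutive a1 b1 a2 b2 a3 b3 k l \<or> translates_consecutive a1 b1 a3 b3 a2 b2 l k"
  shows "countable {x. \<not> (\<exists>!n::int. x + of_int n \<in> {a1..b1} \<union> {a2..b2} \<union> {a3..b3})}"
  using assms(4)
proof
  assume "translates_consecutive a1 b1 a2 b2 a3 b3 k l"
  then show ?thesis using assms
    by (intro three_intervals_tile[where k = "int k" and l = "int l"]) (auto simp: translates_consecutive_def)
next
  assume "translates_consecutive a1 b1 a3 b3 a2 b2 l k"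
  then have "countable {x. \<not> (\<exists>!n::int. x + of_int n \<in> {a1..b1} \<union> {a3..b3} \<union> {a2..b2})}" using assms
    by (intro three_intervals_tile[where k = "int l" and l = "int k"]) (auto simp: translates_consecutive_def)
  then show ?thesis by (simp only: Un_ac)
qed

text \<open>
  The integrals for \<open>k = 1, 2, 3\<close> give equal power sums of \<open>chr\<close> at the left and right end points. If some
  interval had end points with the same value of \<open>chr\<close>, its length would be a positive integer, which
  is impossible since the three lengths are positive with sum \<open>1\<close>, the case \<open>k = 0\<close>.
\<close>

lemma three_intervals_consecutive:
  fixes a1 b1 a2 b2 a3 b3 :: real
  assumes ord: "a1 < b1" "b1 < a2" "a2 < b2" "b2 < a3" "a3 < b3"
    and int: "\<And>k::int. (LINT x|lebesgue. indicator ({a1..b1} \<union> {a2..b2} \<union> {a3..b3}) x * chr (of_int k * x))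
      = (if k = 0 then 1 else 0)"
  shows "\<exists>k l. translates_consecutive a1 b1 a2 b2 a3 b3 k l \<or> translates_consecutive a1 b1 a3 b3 a2 b2 l k"
proof -
  have split: "(LINT x|lebesgue. indicator ({a1..b1} \<union> {a2..b2} \<union> {a3..b3}) x * chr (of_int k * x))
      = (LINT x|lebesgue. indicator {a1..b1} x * chr (of_int k * x))
      + (LINT x|lebesgue. indicator {a2..b2} x * chr (of_int k * x))
      + (LINT x|lebesgue. indicator {a3..b3} x * chr (of_int k * x))" for k :: int
  proof -
    have i: "integrable lebesgue (\<lambda>x. indicator {a..b} x * chr (of_int k * x))" for a b
    proof (rule integrable_mult_chr)
      show "integrable lebesgue (indicator {a..b} :: real \<Rightarrow> complex)"
        by (rule L2_bounded_support_integrable[OF L2_indicator_Icc, of a b]) auto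
    qed (intro continuous_lebesgue_measurable continuous_intros)
    have "indicator ({a1..b1} \<union> {a2..b2} \<union> {a3..b3}) x * chr (of_int k * x)
        = indicator {a1..b1} x * chr (of_int k * x) + indicator {a2..b2} x * chr (of_int k * x)
          + indicator {a3..b3} x * chr (of_int k * x)" for x
      using ord by (auto simp: indicator_def)
    then show ?thesis using i by simp
  qed
  have len: "(LINT x|lebesgue. indicator {a..b} x * chr (of_int 0 * x)) = of_real (b - a)" if "a \<le> b" for a b
  proof -
    have "(LINT x|lebesgue. indicator {a..b} x * chr (of_int 0 * x))
        = (LINT x|lebesgue. complex_of_real (indicator {a..b} x))"
      by (intro Bochner_Integration.integral_cong) (auto simp: indicator_def)
    also have "\<dots> = of_real (LINT x|lebesgue. indicator {a..b} x)" by (rule integral_complex_of_real)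
    finally show ?thesis using that by simp
  qed
  have "complex_of_real ((b1 - a1) + (b2 - a2) + (b3 - a3)) = of_real 1"
    using int[of 0] unfolding split using len[of a1 b1] len[of a2 b2] len[of a3 b3] ord by simp
  then have total: "(b1 - a1) + (b2 - a2) + (b3 - a3) = 1" by (simp only: of_real_eq_iff)
  have power_sum: "chr b1 ^ n + chr b2 ^ n + chr b3 ^ n = chr a1 ^ n + chr a2 ^ n + chr a3 ^ n" if "n > 0" for n :: nat
  proof -
    have pw: "chr (real n * x) = chr x ^ n" for x
      by (induction n) (simp_all add: chr_add distrib_right)
    have "0 = (LINT x|lebesgue. indicator ({a1..b1} \<union> {a2..b2} \<union> {a3..b3}) x * chr (of_int (int n) * x))"
      using int[of "int n"] that by simp
    also have "\<dots> = ((chr (n * b1) - chr (n * a1)) + (chr (n * b2) - chr (n * a2)) + (chr (n * b3) - chr (n * a3)))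
        / (2 * of_real pi * \<i> * of_real (real n))"
      unfolding split using integral_chr_Icc[of _ _ "real n"] ord that by (simp add: add_divide_distrib)
    finally show ?thesis using that by (simp add: pw[symmetric] algebra_simps)
  qed
  have no_fix: False if "chr b = chr a" "a < b" "b - a < 1" for a b
  proof -
    from that(1)[unfolded chr_eq_iff] obtain n :: int where "b = a + of_int n" by (elim exE)
    then have "0 < real_of_int n" "real_of_int n < 1" using that by linarith+
    then show False by simp
  qed
  have ps1: "chr b1 + chr b2 + chr b3 = chr a1 + chr a2 + chr a3"
    using power_sum[of 1] by simp
  have ps2: "chr b1 ^ 2 + chr b2 ^ 2 + chr b3 ^ 2 = chr a1 ^ 2 + chr a2 ^ 2 + chr a3 ^ 2"
    by (rule power_sum) simp
  have ps3: "chr b1 ^ 3 + chr b2 ^ 3 + chr b3 ^ 3 = chr a1 ^ 3 + chr a2 ^ 3 + chr a3 ^ 3"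
    by (rule power_sum) simp
  show ?thesis
  proof (rule equal_power_sums_3[OF ps1 ps2 ps3])
    assume "chr b1 = chr a2" "chr b2 = chr a3" "chr b3 = chr a1"
    then obtain m n :: int where mn: "b1 = a2 + of_int m" "b2 = a3 + of_int n"
      unfolding chr_eq_iff by blast
    have "m < 0" "n < 0" using mn ord by linarith+
    then have "real (nat (- m)) = - of_int m" "real (nat (- m - n)) = - of_int m - of_int n"
      by simp_all
    then have "b1 = a2 - real (nat (- m)) \<and> b2 - real (nat (- m)) = a3 - real (nat (- m - n))
        \<and> b3 - real (nat (- m - n)) = a1 + 1"
      using mn total by linarith
    then show ?thesis unfolding translates_consecutive_def by blast
  next
    assume "chr b1 = chr a3" "chr b3 = chr a2" "chr b2 = chr a1"
    then obtain m n :: int where mn: "b1 = a3 + of_int m" "b2 = a1 + of_int n"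
      unfolding chr_eq_iff by blast
    have "m < 0" "n > 0" using mn ord by linarith+
    then have "real (nat (n - 1)) = of_int n - 1" "real (nat (- m)) = - of_int m"
      by simp_all
    then have "b1 = a3 - real (nat (- m)) \<and> b3 - real (nat (- m)) = a2 - real (nat (n - 1))
        \<and> b2 - real (nat (n - 1)) = a1 + 1"
      using mn total by linarith
    then show ?thesis unfolding translates_consecutive_def by blast
  next
    assume "chr b1 = chr a1"
    then have False by (rule no_fix) (use ord total in linarith)+
    then show ?thesis ..
  next
    assume "chr b2 = chr a2"
    then have False by (rule no_fix) (use ord total in linarith)+
    then show ?thesis ..
  next
    assume "chr b3 = chr a3"
    then have False by (rule no_fix) (use ord total in linarith)+
    then show ?thesis ..
  qed
qed

section \<open>Wavelet systems on the frequency side\<close>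

text \<open>
  For \<open>\<Psi> = fourier \<psi>\<close> this is the transform of the wavelet system of \<open>\<psi>\<close>; see
  \<open>fourier_wavelet_system\<close>. The outer factor \<open>2 powr - (j / 2)\<close> combines the normalization
  of the system with the Jacobian of the dilation.
\<close>

definition wavelet_freq :: "(real \<Rightarrow> complex) \<Rightarrow> int \<times> int \<Rightarrow> real \<Rightarrow> complex" where
  "wavelet_freq \<Psi> = (\<lambda>(j, k) \<xi>. of_real (2 powr - (of_int j / 2)) * (chr (- (of_int k * (\<xi> / 2 powi j)))
     * \<Psi> (\<xi> / 2 powi j)))"

lemma two_powi_eq: "2 powi j = ((2::real) powr (of_int j / 2))\<^sup>2" for j :: int
proof -
  have "((2::real) powr (of_int j / 2))\<^sup>2 = 2 powr (of_int j / 2 + of_int j / 2)"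
    unfolding power2_eq_square powr_add ..
  also have "\<dots> = 2 powi j" by (simp add: powr_real_of_int')
  finally show ?thesis by simp
qed

lemma wavelet_system_L2:
  assumes "\<psi> \<in> L2" shows "wavelet_system \<psi> i \<in> L2"
proof (cases i)
  case (Pair j k)
  show ?thesis
    using L2_scale[OF L2_affine(1)[OF assms, of "2 powi j" "- of_int k"]]
    by (simp add: Pair wavelet_system_def)
qed

lemma fourier_wavelet_system:
  assumes "\<psi> \<in> L2"
  shows "AE \<xi> in lebesgue. fourier (wavelet_system \<psi> i) \<xi> = wavelet_freq (fourier \<psi>) i \<xi>"
proof (cases i)
  case (Pair j k)
  define s :: real where "s = 2 powr (of_int j / 2)"
  have s: "s > 0" "2 powi j = s\<^sup>2" "2 powr - (of_int j / 2) = 1 / s"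
    by (simp_all add: s_def two_powi_eq powr_minus_divide)
  have ws: "wavelet_system \<psi> i = (\<lambda>x. of_real s * \<psi> (- of_int k + s\<^sup>2 * x))"
    by (simp add: Pair wavelet_system_def s(2) s_def[symmetric])
  have c: "s\<^sup>2 \<noteq> 0" using s(1) by simp
  have "AE \<xi> in lebesgue. fourier (wavelet_system \<psi> i) \<xi> = of_real s * fourier (\<lambda>x. \<psi> (- of_int k + s\<^sup>2 * x)) \<xi>"
    unfolding ws by (rule fourier_scale[OF L2_affine(1)[OF assms c]])
  with fourier_affine[OF assms c, of "- of_int k"] show ?thesis
  proof eventually_elim
    case (elim \<xi>)
    show ?case
      unfolding elim using s(1)
      by (simp add: Pair wavelet_freq_def s(2,3) power2_eq_square)
  qed
qed

lemma AE_dilate: "AE x in lebesgue. P x \<Longrightarrow> AE \<xi> in lebesgue. P (\<xi> / 2 powi j)" for P :: "real \<Rightarrow> bool"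
  using AE_affine[of P "1 / 2 powi j" 0] by simp

lemma L2_dilate:
  assumes "h \<in> L2"
  shows "(\<lambda>\<xi>. h (\<xi> / 2 powi j)) \<in> L2"
  using L2_affine(1)[OF assms, of "1 / 2 powi j" 0] by simp

lemma wavelet_freq_L2:
  assumes "h \<in> L2" shows "wavelet_freq h i \<in> L2"
proof (cases i)
  case (Pair j k)
  have "(\<lambda>\<xi>. chr (- (of_int k * (\<xi> / 2 powi j))) * h (\<xi> / 2 powi j)) \<in> L2"
    by (rule L2_bounded_mult[OF L2_dilate[OF assms], of _ 1])
       (auto intro!: continuous_lebesgue_measurable continuous_intros)
  from L2_scale[OF this] show ?thesis by (simp add: Pair wavelet_freq_def)
qed

lemma norm2_wavelet_freq:
  assumes "h \<in> L2" shows "norm2 (wavelet_freq h i) = norm2 h"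
proof (cases i)
  case (Pair j k)
  define s :: real where "s = 2 powr (of_int j / 2)"
  have s: "s > 0" "2 powi j = s\<^sup>2" "2 powr - (of_int j / 2) = 1 / s"
    by (simp_all add: s_def two_powi_eq powr_minus_divide)
  have "norm2 (wavelet_freq h i) = norm2 (\<lambda>\<xi>. of_real (1 / s) * h (\<xi> / s\<^sup>2))"
    by (simp add: Pair wavelet_freq_def norm2_def norm_mult s norm_divide)
  also have "\<dots> = (1 / s) * norm2 (\<lambda>\<xi>. h (0 + (1 / s\<^sup>2) * \<xi>))"
    unfolding norm2_scale using s(1) by (simp add: norm_divide)
  also have "norm2 (\<lambda>\<xi>. h (0 + (1 / s\<^sup>2) * \<xi>)) = norm2 h / sqrt \<bar>1 / s\<^sup>2\<bar>"
    by (rule L2_affine(2)[OF assms]) (use s(1) in simp)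
  finally show ?thesis using s(1) by (simp add: real_sqrt_divide)
qed

lemma wavelet_freq_diff:
  "wavelet_freq (\<lambda>x. g x - h x) i \<xi> = wavelet_freq g i \<xi> - wavelet_freq h i \<xi>"
  by (cases i) (simp add: wavelet_freq_def right_diff_distrib)

text \<open>
  Within one scale the dilation is an isometry, so the inner product does not depend on \<open>j\<close>.
\<close>

lemma wavelet_freq_inner_same_scale:
  "L2_inner (wavelet_freq g (j, k)) (wavelet_freq h (j, k'))
    = (LINT \<xi>|lebesgue. g \<xi> * cnj (h \<xi>) * chr (of_int (k' - k) * \<xi>))"
proof -
  define s :: real where "s = 2 powr (of_int j / 2)"
  have s: "s > 0" "2 powi j = s\<^sup>2" "2 powr - (of_int j / 2) = 1 / s"
    by (simp_all add: s_def two_powi_eq powr_minus_divide)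
  have c: "s\<^sup>2 \<noteq> 0" using s(1) by simp
  let ?f = "\<lambda>\<xi>. wavelet_freq g (j, k) \<xi> * cnj (wavelet_freq h (j, k') \<xi>)"
  have "L2_inner (wavelet_freq g (j, k)) (wavelet_freq h (j, k')) = \<bar>s\<^sup>2\<bar> *\<^sub>R (LINT \<xi>|lebesgue. ?f (0 + s\<^sup>2 * \<xi>))"
    unfolding L2_inner_def by (rule lebesgue_integral_real_affine[OF c])
  also have "\<dots> = (LINT \<xi>|lebesgue. s\<^sup>2 *\<^sub>R ?f (0 + s\<^sup>2 * \<xi>))" by simp
  also have "\<dots> = (LINT \<xi>|lebesgue. g \<xi> * cnj (h \<xi>) * chr (of_int (k' - k) * \<xi>))"
  proof (rule Bochner_Integration.integral_cong)
    fix \<xi> :: real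
    have "chr (- (of_int k * \<xi>)) * chr (of_int k' * \<xi>) = chr (of_int (k' - k) * \<xi>)"
      by (simp add: chr_add[symmetric] left_diff_distrib)
    moreover have "s\<^sup>2 *\<^sub>R ?f (0 + s\<^sup>2 * \<xi>)
        = g \<xi> * cnj (h \<xi>) * (chr (- (of_int k * \<xi>)) * chr (of_int k' * \<xi>))"
      using s(1) by (simp add: wavelet_freq_def s(2,3) cnj_chr scaleR_conv_of_real power2_eq_square)
    ultimately show "s\<^sup>2 *\<^sub>R ?f (0 + s\<^sup>2 * \<xi>) = g \<xi> * cnj (h \<xi>) * chr (of_int (k' - k) * \<xi>)" by simp
  qed simp
  finally show ?thesis .
qed

lemma wavelet_system_inner:
  assumes "\<psi> \<in> L2"
  shows "L2_inner (wavelet_system \<psi> i) (wavelet_system \<psi> i')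
    = L2_inner (wavelet_freq (fourier \<psi>) i) (wavelet_freq (fourier \<psi>) i')"
proof -
  note F = fourier_L2_limit(1)
  have "L2_inner (wavelet_system \<psi> i) (wavelet_system \<psi> i')
      = L2_inner (fourier (wavelet_system \<psi> i)) (fourier (wavelet_system \<psi> i'))"
    by (rule fourier_inner[symmetric]) (rule wavelet_system_L2[OF assms])+
  also have "\<dots> = L2_inner (wavelet_freq (fourier \<psi>) i) (wavelet_freq (fourier \<psi>) i')"
    by (rule L2_inner_cong_AE)
       (rule fourier_wavelet_system[OF assms] L2_measurable[OF F[OF wavelet_system_L2[OF assms]]]
         L2_measurable[OF wavelet_freq_L2[OF F[OF assms]]])+
  finally show ?thesis .
qed

lemma norm2_approx_fourier:
  assumes "\<psi> \<in> L2" "f \<in> L2" "finite F"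
  shows "norm2 (\<lambda>x. f x - (\<Sum>i\<in>F. c i * wavelet_system \<psi> i x))
    = norm2 (\<lambda>\<xi>. fourier f \<xi> - (\<Sum>i\<in>F. c i * wavelet_freq (fourier \<psi>) i \<xi>))"
proof -
  note F = fourier_L2_limit(1)
  let ?p = "\<lambda>x. \<Sum>i\<in>F. c i * wavelet_system \<psi> i x"
  let ?q = "\<lambda>\<xi>. \<Sum>i\<in>F. c i * wavelet_freq (fourier \<psi>) i \<xi>"
  have p: "?p \<in> L2" by (intro L2_sum L2_scale wavelet_system_L2 assms)
  have q: "?q \<in> L2" by (intro L2_sum L2_scale wavelet_freq_L2 F assms)
  have "AE \<xi> in lebesgue. \<forall>i\<in>F. fourier (wavelet_system \<psi> i) \<xi> = wavelet_freq (fourier \<psi>) i \<xi>"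
    by (rule AE_finite_allI[OF assms(3)]) (rule fourier_wavelet_system[OF assms(1)])
  with fourier_sum[OF assms(3), of "wavelet_system \<psi>", OF wavelet_system_L2[OF assms(1)], of c]
  have "AE \<xi> in lebesgue. fourier ?p \<xi> = ?q \<xi>"
    by eventually_elim (auto intro: sum.cong)
  then have "norm2 (\<lambda>\<xi>. fourier f \<xi> - fourier ?p \<xi>) = norm2 (\<lambda>\<xi>. fourier f \<xi> - ?q \<xi>)"
    by (intro norm2_cong_AE L2_measurable L2_diff F assms p q) auto
  then show ?thesis by (simp add: fourier_norm2_diff[OF assms(2) p])
qed

section \<open>From wavelets to tilings\<close>

text \<open>
  By density a function orthogonal to all characters is arbitrarily close to functions orthogonal to it.
\<close>

lemma orthogonal_to_chr_tile_imp_0: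
  assumes tile: "AE x in lebesgue. \<exists>!n::int. x + of_int n \<in> A" and A: "A \<in> sets lebesgue"
    and bd: "A \<subseteq> {-real M..<real M}"
    and h: "h \<in> L2" "\<And>x. x \<notin> A \<Longrightarrow> h x = 0"
    and orth: "\<And>k::int. (LINT x|lebesgue. h x * chr (of_int k * x)) = 0"
  shows "AE x in lebesgue. h x = 0"
proof -
  have "norm2 h \<le> \<epsilon>" if "\<epsilon> > 0" for \<epsilon>
  proof -
    obtain p where p: "trig_poly p" "norm2 (\<lambda>x. h x - indicator A x * p x) < \<epsilon>"
      using trig_poly_dense_tile[OF tile A bd h \<open>\<epsilon> > 0\<close>] by blast
    obtain F c where F: "finite F" "p = (\<lambda>x. \<Sum>k\<in>F. c k * chr (of_int k * x))"
      using trig_poly_imp_sum[OF p(1)] by blast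
    have hi: "integrable lebesgue h"
      by (rule L2_bounded_support_integrable[OF h(1), of "-real M" "real M"])
         (use h(2) bd in force)
    have "L2_inner h (\<lambda>x. indicator A x * p x)
        = (LINT x|lebesgue. (\<Sum>k\<in>F. cnj (c k) * (h x * chr (of_int (- k) * x))))"
      unfolding L2_inner_def
    proof (rule Bochner_Integration.integral_cong)
      fix x
      have "cnj (p x) = (\<Sum>k\<in>F. cnj (c k) * chr (of_int (- k) * x))" by (simp add: F(2) cnj_chr)
      then show "h x * cnj (indicator A x * p x) = (\<Sum>k\<in>F. cnj (c k) * (h x * chr (of_int (- k) * x)))"
        using h(2)[of x] by (cases "x \<in> A") (simp_all add: sum_distrib_left mult_ac)
    qed simp
    also have "\<dots> = (\<Sum>k\<in>F. LINT x|lebesgue. cnj (c k) * (h x * chr (of_int (- k) * x)))"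
      by (intro Bochner_Integration.integral_sum integrable_mult_right integrable_mult_chr hi
          continuous_lebesgue_measurable continuous_intros)
    also have "\<dots> = 0" using orth by (simp del: of_int_minus)
    finally have "L2_inner h (\<lambda>x. indicator A x * p x) = 0" .
    moreover have pL: "(\<lambda>x. indicator A x * p x) \<in> L2"
      using bd by (intro L2_indicator_trig_poly[OF p(1) A, of "-real M" "real M"]) auto
    ultimately have "(norm2 h)\<^sup>2 \<le> (norm2 (\<lambda>x. h x - indicator A x * p x))\<^sup>2"
      using norm2_diff_sq[OF h(1) pL] by simp
    then show ?thesis using p(2) by (simp add: power2_le_iff_abs_le)
  qed
  then have "norm2 h \<le> 0" by (meson dense_ge)
  then have "norm2 h = 0" using norm2_nonneg[of h] by linarith
  then show ?thesis using norm2_eq_0_iff[OF h(1)] by simp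
qed

lemma sets_dilate:
  assumes "K \<in> sets lebesgue"
  shows "{\<xi>::real. \<xi> / 2 powi j \<in> K} \<in> sets lebesgue"
proof -
  have "(\<lambda>\<xi>::real. 0 + (1 / 2 powi j) * \<xi>) \<in> lebesgue \<rightarrow>\<^sub>M lebesgue"
    by (rule measurable_affine_lebesgue) simp
  from measurable_sets[OF this assms] show ?thesis by (simp add: vimage_def)
qed

lemma H2_wavelet_translates_orthonormal:
  assumes \<psi>: "H2_wavelet \<psi>" and mod: "AE \<xi> in lebesgue. cmod (fourier \<psi> \<xi>) = indicator K \<xi>"
    and K: "K \<in> sets lebesgue"
  shows "(LINT \<xi>|lebesgue. indicator K \<xi> * chr (of_int k * \<xi>)) = (if k = 0 then 1 else 0)"
proof -
  have L: "\<psi> \<in> L2" using \<psi> by (simp add: H2_wavelet_def H2_def)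
  have m: "fourier \<psi> \<in> borel_measurable lebesgue" by (intro L2_measurable fourier_L2_limit L)
  have chr_m: "(\<lambda>\<xi>. chr (of_int k * \<xi>)) \<in> borel_measurable lebesgue"
    by (intro continuous_lebesgue_measurable continuous_intros)
  have "(if k = 0 then 1 else 0) = L2_inner (wavelet_system \<psi> (0, 0)) (wavelet_system \<psi> (0, k))"
    using \<psi> by (simp add: H2_wavelet_def orthonormal_basis_def)
  also have "\<dots> = (LINT \<xi>|lebesgue. fourier \<psi> \<xi> * cnj (fourier \<psi> \<xi>) * chr (of_int (k - 0) * \<xi>))"
    unfolding wavelet_system_inner[OF L] by (rule wavelet_freq_inner_same_scale)
  also have "\<dots> = (LINT \<xi>|lebesgue. indicator K \<xi> * chr (of_int k * \<xi>))"
  proof (rule integral_cong_AE)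
    show "AE \<xi> in lebesgue. fourier \<psi> \<xi> * cnj (fourier \<psi> \<xi>) * chr (of_int (k - 0) * \<xi>)
        = indicator K \<xi> * chr (of_int k * \<xi>)"
      using mod by eventually_elim (simp add: complex_norm_square[symmetric] indicator_def)
  qed (use m chr_m K in \<open>auto intro!: borel_measurable_times borel_measurable_cnj borel_measurable_indicator\<close>)
  finally show ?thesis ..
qed

text \<open>
  The function of scale \<open>j\<close> is orthogonal to all functions of scale \<open>0\<close>, and these span
  everything on the tile \<open>K\<close>. Hence it vanishes on \<open>K\<close>, whereas its modulus is a positive constant
  on \<open>2\<^sup>jK\<close>.
\<close>

lemma H2_wavelet_dilates_disjoint:
  assumes \<psi>: "H2_wavelet \<psi>" and mod: "AE \<xi> in lebesgue. cmod (fourier \<psi> \<xi>) = indicator K \<xi>"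
    and K: "K \<in> sets lebesgue" and bd: "K \<subseteq> {-real M..<real M}"
    and tile: "AE x in lebesgue. \<exists>!n::int. x + of_int n \<in> K" and "j \<noteq> 0"
  shows "AE \<xi> in lebesgue. \<not> (\<xi> \<in> K \<and> \<xi> / 2 powi j \<in> K)"
proof -
  have L: "\<psi> \<in> L2" using \<psi> by (simp add: H2_wavelet_def H2_def)
  define \<Psi> where "\<Psi> = fourier \<psi>"
  have \<Psi>: "\<Psi> \<in> L2" unfolding \<Psi>_def by (rule fourier_L2_limit(1)[OF L])
  define g where "g = wavelet_freq \<Psi> (j, 0)"
  have g: "g \<in> L2" unfolding g_def by (rule wavelet_freq_L2[OF \<Psi>])
  define h where "h = (\<lambda>\<xi>. indicator K \<xi> * (cnj (\<Psi> \<xi>) * g \<xi>))"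
  have hm: "h \<in> borel_measurable lebesgue"
    unfolding h_def
    by (intro borel_measurable_times borel_measurable_indicator K borel_measurable_cnj L2_measurable \<Psi> g)
  have mod': "AE \<xi> in lebesgue. cmod (\<Psi> \<xi>) = indicator K \<xi>" using mod by (simp add: \<Psi>_def)
  have h: "h \<in> L2"
    by (rule L2_dominated[OF g hm, of 1], use mod' in eventually_elim)
       (auto simp: h_def norm_mult indicator_def)
  have orth: "(LINT \<xi>|lebesgue. h \<xi> * chr (of_int k * \<xi>)) = 0" for k
  proof -
    have "L2_inner (wavelet_system \<psi> (j, 0)) (wavelet_system \<psi> (0, k)) = 0"
      using \<psi> \<open>j \<noteq> 0\<close> by (simp add: H2_wavelet_def orthonormal_basis_def)
    then have "0 = L2_inner g (wavelet_freq \<Psi> (0, k))"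
      unfolding wavelet_system_inner[OF L] g_def \<Psi>_def by simp
    also have "\<dots> = (LINT \<xi>|lebesgue. h \<xi> * chr (of_int k * \<xi>))"
      unfolding L2_inner_def
    proof (rule integral_cong_AE)
      show "AE \<xi> in lebesgue. g \<xi> * cnj (wavelet_freq \<Psi> (0, k) \<xi>) = h \<xi> * chr (of_int k * \<xi>)"
        using mod'
      proof eventually_elim
        case (elim \<xi>)
        then have "\<Psi> \<xi> = 0" if "\<xi> \<notin> K" using that by simp
        then show ?case
          by (cases "\<xi> \<in> K") (simp_all add: wavelet_freq_def h_def cnj_chr mult_ac)
      qed
    qed (intro borel_measurable_times borel_measurable_cnj L2_measurable g wavelet_freq_L2 \<Psi> hm
        continuous_lebesgue_measurable continuous_intros)+
    finally show ?thesis ..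
  qed
  have "AE \<xi> in lebesgue. h \<xi> = 0"
    by (rule orthogonal_to_chr_tile_imp_0[OF tile K bd h _ orth]) (simp add: h_def)
  with mod' AE_dilate[OF mod', of j] show ?thesis
  proof eventually_elim
    case (elim \<xi>)
    show ?case
    proof
      assume \<xi>: "\<xi> \<in> K \<and> \<xi> / 2 powi j \<in> K"
      then have "\<Psi> \<xi> \<noteq> 0" "\<Psi> (\<xi> / 2 powi j) \<noteq> 0" using elim by auto
      then show False using elim(3) \<xi> by (simp add: h_def g_def wavelet_freq_def)
    qed
  qed
qed

text \<open>
  All functions of the system vanish outside the dilates of \<open>K\<close> and cannot approximate a nonzero function
  supported there. The half-line is cut off at \<open>N\<close> to obtain indicators in \<open>L2\<close>.
\<close>

lemma H2_wavelet_dilates_cover: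
  assumes \<psi>: "H2_wavelet \<psi>" and mod: "AE \<xi> in lebesgue. cmod (fourier \<psi> \<xi>) = indicator K \<xi>"
    and K: "K \<in> sets lebesgue"
  shows "AE \<xi> in lebesgue. \<xi> > 0 \<longrightarrow> (\<exists>j::int. \<xi> / 2 powi j \<in> K)"
proof -
  have L: "\<psi> \<in> L2" using \<psi> by (simp add: H2_wavelet_def H2_def)
  define \<Psi> where "\<Psi> = fourier \<psi>"
  have \<Psi>: "\<Psi> \<in> L2" unfolding \<Psi>_def by (rule fourier_L2_limit(1)[OF L])
  have "AE \<xi> in lebesgue. \<forall>j. cmod (\<Psi> (\<xi> / 2 powi j)) = indicator K (\<xi> / 2 powi j)"
    unfolding AE_all_countable using mod by (intro allI AE_dilate) (simp add: \<Psi>_def)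
  then have W0: "AE \<xi> in lebesgue. \<forall>i. (\<forall>j::int. \<xi> / 2 powi j \<notin> K) \<longrightarrow> wavelet_freq \<Psi> i \<xi> = 0"
    by eventually_elim (auto simp: wavelet_freq_def)
  have "AE \<xi> in lebesgue. 0 < \<xi> \<and> \<xi> \<le> real N \<longrightarrow> (\<exists>j::int. \<xi> / 2 powi j \<in> K)" for N :: nat
  proof -
    define A where "A = {0<..real N} - (\<Union>j::int. {\<xi>. \<xi> / 2 powi j \<in> K})"
    have A: "A \<in> sets lebesgue" unfolding A_def by (intro sets.Diff sets.countable_UN) (auto intro: sets_dilate K)
    define a :: "real \<Rightarrow> complex" where "a = indicator A"
    have am: "a \<in> borel_measurable lebesgue" unfolding a_def by (rule borel_measurable_indicator[OF A])
    have aL: "a \<in> L2"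
      by (rule L2_bounded_support[OF am, of 1 0 "real N"]) (auto simp: a_def A_def indicator_def)
    obtain f where f: "f \<in> L2" "AE \<xi> in lebesgue. fourier f \<xi> = a \<xi>" using fourier_surj[OF aL] by blast
    have fH: "f \<in> H2"
      unfolding H2_def using f by (auto elim!: eventually_mono simp: a_def A_def)
    have "(norm2 a)\<^sup>2 \<le> \<epsilon>" if "\<epsilon> > 0" for \<epsilon>
    proof -
      have "\<forall>f\<in>H2. \<forall>\<epsilon>>0. \<exists>F c. finite F \<and> L2_dist_sq f (\<lambda>x. \<Sum>i\<in>F. c i * wavelet_system \<psi> i x) < \<epsilon>"
        using \<psi> by (simp add: H2_wavelet_def orthonormal_basis_def)
      then obtain F c where F: "finite F" "L2_dist_sq f (\<lambda>x. \<Sum>i\<in>F. c i * wavelet_system \<psi> i x) < ennreal \<epsilon>"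
        using fH \<open>\<epsilon> > 0\<close> by (metis ennreal_less_zero_iff)
      let ?q = "\<lambda>\<xi>. fourier f \<xi> - (\<Sum>i\<in>F. c i * wavelet_freq \<Psi> i \<xi>)"
      have q: "?q \<in> L2" by (intro L2_diff L2_sum L2_scale wavelet_freq_L2 \<Psi> fourier_L2_limit f)
      have "norm2 a \<le> norm2 ?q"
      proof (rule norm2_mono[OF q am])
        show "AE \<xi> in lebesgue. cmod (a \<xi>) \<le> cmod (?q \<xi>)"
          using f(2) W0
        proof eventually_elim
          case (elim \<xi>)
          show ?case
          proof (cases "\<xi> \<in> A")
            case True
            then have "wavelet_freq \<Psi> i \<xi> = 0" for i using elim(2) unfolding A_def by blast
            then show ?thesis using elim(1) by (simp only: mult_zero_right sum.neutral_const diff_zero order_refl)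
          qed (simp add: a_def)
        qed
      qed
      have sL: "(\<lambda>x. \<Sum>i\<in>F. c i * wavelet_system \<psi> i x) \<in> L2"
        by (intro L2_sum L2_scale wavelet_system_L2 L)
      have "(norm2 a)\<^sup>2 \<le> (norm2 ?q)\<^sup>2" using \<open>norm2 a \<le> norm2 ?q\<close> by (intro power_mono) auto
      also have "(norm2 ?q)\<^sup>2 < \<epsilon>"
        using F(2) unfolding L2_dist_sq_eq[OF f(1) sL] norm2_approx_fourier[OF L f(1) F(1)] \<Psi>_def by (simp add: ennreal_less_iff del: ennreal_power)
      finally show ?thesis by simp
    qed
    then have "(norm2 a)\<^sup>2 \<le> 0" by (meson dense_ge)
    then have "norm2 a = 0" by simp
    then have "AE \<xi> in lebesgue. a \<xi> = 0" using norm2_eq_0_iff[OF aL] by simp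
    then show ?thesis by eventually_elim (auto simp: a_def A_def indicator_def split: if_splits)
  qed
  then have "AE \<xi> in lebesgue. \<forall>N::nat. 0 < \<xi> \<and> \<xi> \<le> real N \<longrightarrow> (\<exists>j::int. \<xi> / 2 powi j \<in> K)"
    unfolding AE_all_countable by (rule allI)
  then show ?thesis
  proof eventually_elim
    case (elim \<xi>)
    obtain N where "\<xi> \<le> real N" using real_arch_simple by blast
    then show ?case using elim by blast
  qed
qed

lemma ex1_int_minus: "(\<exists>!n::int. P (- n)) \<longleftrightarrow> (\<exists>!n. P n)"
  by (metis minus_minus)

lemma H2_wavelet_dilation_tile:
  assumes \<psi>: "H2_wavelet \<psi>" and mod: "AE \<xi> in lebesgue. cmod (fourier \<psi> \<xi>) = indicator K \<xi>"
    and K: "K \<in> sets lebesgue" and bd: "K \<subseteq> {-real M..<real M}"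
    and tile: "AE x in lebesgue. \<exists>!n::int. x + of_int n \<in> K"
  shows "AE \<xi> in lebesgue. \<xi> > 0 \<longrightarrow> (\<exists>!j::int. \<xi> / 2 powi j \<in> K)"
proof -
  have "AE \<xi> in lebesgue. \<not> (\<xi> / 2 powi i \<in> K \<and> \<xi> / 2 powi j \<in> K)" if "i \<noteq> j" for i j :: int
  proof -
    have "AE \<xi> in lebesgue. \<not> (\<xi> \<in> K \<and> \<xi> / 2 powi (j - i) \<in> K)"
      by (rule H2_wavelet_dilates_disjoint[OF \<psi> mod K bd tile]) (use that in simp)
    from AE_dilate[OF this, of i] show ?thesis by (simp add: power_int_add[symmetric])
  qed
  then have "AE \<xi> in lebesgue. \<forall>i j. i \<noteq> j \<longrightarrow> \<not> (\<xi> / 2 powi i \<in> K \<and> \<xi> / 2 powi j \<in> K)"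
    by (simp add: AE_all_countable)
  with H2_wavelet_dilates_cover[OF \<psi> mod K] show ?thesis by eventually_elim blast
qed

section \<open>From tilings to wavelets\<close>

definition closed_span :: "('i \<Rightarrow> real \<Rightarrow> complex) \<Rightarrow> (real \<Rightarrow> complex) set" where
  "closed_span e = {g \<in> L2. \<forall>\<epsilon>>0. \<exists>F c. finite F \<and> norm2 (\<lambda>x. g x - (\<Sum>i\<in>F. c i * e i x)) < \<epsilon>}"

lemma closed_span_add:
  assumes "\<And>i. e i \<in> L2" "g \<in> closed_span e" "h \<in> closed_span e"
  shows "(\<lambda>x. g x + h x) \<in> closed_span e"
  unfolding closed_span_def
proof (intro CollectI conjI allI impI)
  show gh: "(\<lambda>x. g x + h x) \<in> L2" using assms(2,3) by (intro L2_add) (auto simp: closed_span_def)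
  fix \<epsilon> :: real assume "\<epsilon> > 0"
  then have e2: "\<epsilon> / 2 > 0" by simp
  obtain F c where F: "finite F" "norm2 (\<lambda>x. g x - (\<Sum>i\<in>F. c i * e i x)) < \<epsilon> / 2"
    using assms(2) e2 unfolding closed_span_def by blast
  obtain G d where G: "finite G" "norm2 (\<lambda>x. h x - (\<Sum>i\<in>G. d i * e i x)) < \<epsilon> / 2"
    using assms(3) e2 unfolding closed_span_def by blast
  define c' where "c' = (\<lambda>i. (if i \<in> F then c i else 0) + (if i \<in> G then d i else 0))"
  have 1: "(\<Sum>i\<in>F \<union> G. c' i * e i x) = (\<Sum>i\<in>F. c i * e i x) + (\<Sum>i\<in>G. d i * e i x)" for x
  proof -
    have "(\<Sum>i\<in>F \<union> G. (if i \<in> F then c i else 0) * e i x) = (\<Sum>i\<in>F. c i * e i x)"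
      using F(1) G(1) by (intro sum.mono_neutral_cong_right) auto
    moreover have "(\<Sum>i\<in>F \<union> G. (if i \<in> G then d i else 0) * e i x) = (\<Sum>i\<in>G. d i * e i x)"
      using F(1) G(1) by (intro sum.mono_neutral_cong_right) auto
    ultimately show ?thesis by (simp add: c'_def distrib_right sum.distrib)
  qed
  have gL: "(\<lambda>x. g x - (\<Sum>i\<in>F. c i * e i x)) \<in> L2" and hL: "(\<lambda>x. h x - (\<Sum>i\<in>G. d i * e i x)) \<in> L2"
    using assms by (auto simp: closed_span_def intro!: L2_diff L2_sum L2_scale)
  have "norm2 (\<lambda>x. (g x + h x) - (\<Sum>i\<in>F \<union> G. c' i * e i x)) < \<epsilon>"
    using norm2_triangle[OF gL hL] F(2) G(2) unfolding 1 by (simp add: algebra_simps)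
  then show "\<exists>F c. finite F \<and> norm2 (\<lambda>x. (g x + h x) - (\<Sum>i\<in>F. c i * e i x)) < \<epsilon>"
    using F(1) G(1) by blast
qed

lemma closed_span_sum:
  assumes "\<And>i. e i \<in> L2" "\<And>j. j \<in> J \<Longrightarrow> g j \<in> closed_span e"
  shows "(\<lambda>x. \<Sum>j\<in>J. g j x) \<in> closed_span e"
proof -
  have "(\<lambda>x. 0) \<in> closed_span e"
    unfolding closed_span_def by (auto intro!: exI[of _ "{}"])
  then show ?thesis
    using assms(2) by (induction J rule: infinite_finite_induct) (auto intro: closed_span_add[OF assms(1)])
qed

lemma closed_span_limit:
  assumes "\<And>i. e i \<in> L2" "g \<in> L2" "\<And>\<epsilon>. \<epsilon> > 0 \<Longrightarrow> \<exists>h\<in>closed_span e. norm2 (\<lambda>x. g x - h x) < \<epsilon>"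
  shows "g \<in> closed_span e"
  unfolding closed_span_def
proof (intro CollectI conjI allI impI assms(2))
  fix \<epsilon> :: real assume "\<epsilon> > 0"
  then have e2: "\<epsilon> / 2 > 0" by simp
  then obtain h where h: "h \<in> closed_span e" "norm2 (\<lambda>x. g x - h x) < \<epsilon> / 2" using assms(3) by blast
  then obtain F c where F: "finite F" "norm2 (\<lambda>x. h x - (\<Sum>i\<in>F. c i * e i x)) < \<epsilon> / 2"
    using e2 unfolding closed_span_def by blast
  have hL: "h \<in> L2" using h(1) by (simp add: closed_span_def)
  have sL: "(\<lambda>x. \<Sum>i\<in>F. c i * e i x) \<in> L2" by (intro L2_sum L2_scale assms(1))
  have "norm2 (\<lambda>x. g x - (\<Sum>i\<in>F. c i * e i x)) < \<epsilon>"
    using norm2_triangle_diff[OF assms(2) hL sL] h(2) F(2) by simp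
  then show "\<exists>F c. finite F \<and> norm2 (\<lambda>x. g x - (\<Sum>i\<in>F. c i * e i x)) < \<epsilon>" using F(1) by blast
qed

text \<open>
  The reindexing \<open>\<iota>\<close> allows frequencies \<open>k\<close> to be used in place of the pairs that index a wavelet system.
\<close>

lemma closed_span_finite_combination:
  assumes "\<And>i. e i \<in> L2" "finite F"
  shows "(\<lambda>x. \<Sum>i\<in>F. c i * e (\<iota> i) x) \<in> closed_span e"
proof (rule closed_span_sum[OF assms(1)])
  fix j
  have "norm2 (\<lambda>x. c j * e (\<iota> j) x - (\<Sum>i\<in>{\<iota> j}. (\<lambda>_. c j) i * e i x)) = 0" by simp
  then show "(\<lambda>x. c j * e (\<iota> j) x) \<in> closed_span e"
    unfolding closed_span_def using L2_scale[OF assms(1)]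
    by (auto intro!: exI[of _ "{\<iota> j}"] exI[of _ "\<lambda>_. c j"])
qed

text \<open>
  The wavelet is the function whose transform is the indicator of \<open>K\<close>. Its system is orthonormal across
  scales since the dilates of \<open>K\<close> are disjoint and within a scale since \<open>K\<close> is a translation
  tile. For completeness, a function on the half-line is the sum of its restrictions to the dilates of \<open>K\<close>,
  and each restriction is approximated by trigonometric polynomials rescaled from \<open>K\<close>.
\<close>

lemma H2_wavelet_set_of_tiles:
  assumes K: "K \<in> sets lebesgue" and pos: "K \<subseteq> {0<..}" and bd: "K \<subseteq> {-real M..<real M}"
    and tile: "AE x in lebesgue. \<exists>!n::int. x + of_int n \<in> K"
    and dtile: "AE \<xi> in lebesgue. \<xi> > 0 \<longrightarrow> (\<exists>!j::int. \<xi> / 2 powi j \<in> K)"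
  shows "H2_wavelet_set K"
proof -
  define \<kappa> :: "real \<Rightarrow> complex" where "\<kappa> = indicator K"
  have \<kappa>m: "\<kappa> \<in> borel_measurable lebesgue" unfolding \<kappa>_def by (rule borel_measurable_indicator[OF K])
  have \<kappa>: "\<kappa> \<in> L2"
  proof (rule L2_bounded_support[OF \<kappa>m])
    show "cmod (\<kappa> x) \<le> 1" for x by (simp add: \<kappa>_def indicator_def)
    show "\<kappa> x = 0" if "x \<notin> {-real M..real M}" for x using that bd by (cases "x \<in> K") (auto simp: \<kappa>_def)
  qed
  obtain \<psi> where L: "\<psi> \<in> L2" and ft: "AE \<xi> in lebesgue. fourier \<psi> \<xi> = \<kappa> \<xi>"
    using fourier_surj[OF \<kappa>] by blast
  note F = fourier_L2_limit(1)
  define W where "W = wavelet_freq \<kappa>"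
  have WL: "W i \<in> L2" for i unfolding W_def by (rule wavelet_freq_L2[OF \<kappa>])
  have "AE \<xi> in lebesgue. \<forall>j. fourier \<psi> (\<xi> / 2 powi j) = \<kappa> (\<xi> / 2 powi j)"
    unfolding AE_all_countable by (intro allI AE_dilate[OF ft])
  then have W: "AE \<xi> in lebesgue. \<forall>i. wavelet_freq (fourier \<psi>) i \<xi> = W i \<xi>"
    by eventually_elim (auto simp: wavelet_freq_def W_def)
  then have Wi: "AE \<xi> in lebesgue. wavelet_freq (fourier \<psi>) i \<xi> = W i \<xi>" for i
    by eventually_elim blast
  have inner: "L2_inner (wavelet_system \<psi> i) (wavelet_system \<psi> i') = L2_inner (W i) (W i')" for i i'
    unfolding wavelet_system_inner[OF L]
    by (rule L2_inner_cong_AE) (rule Wi L2_measurable[OF WL] L2_measurable[OF wavelet_freq_L2[OF F[OF L]]])+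

  have in_H2: "wavelet_system \<psi> i \<in> H2" for i
  proof -
    have "AE \<xi> in lebesgue. \<xi> \<le> 0 \<longrightarrow> fourier (wavelet_system \<psi> i) \<xi> = 0"
      using fourier_wavelet_system[OF L, of i] Wi[of i]
    proof eventually_elim
      case (elim \<xi>)
      have "W i \<xi> = 0" if "\<xi> \<le> 0"
      proof (cases i)
        case (Pair j k)
        have "\<xi> / 2 powi j \<le> 0" using that by (simp add: divide_nonpos_pos)
        then have "\<xi> / 2 powi j \<notin> K" using pos by auto
        then show ?thesis by (simp add: W_def wavelet_freq_def \<kappa>_def Pair)
      qed
      then show ?case using elim by simp
    qed
    then show ?thesis by (simp add: H2_def wavelet_system_L2[OF L])
  qed

  have orthonormal: "L2_inner (wavelet_system \<psi> i) (wavelet_system \<psi> i') = (if i = i' then 1 else 0)" for i i'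
  proof (cases i; cases i')
    fix j k j' k' assume i: "i = (j, k)" "i' = (j', k')"
    show ?thesis
    proof (cases "j = j'")
      case True
      have "L2_inner (W i) (W i') = (LINT \<xi>|lebesgue. \<kappa> \<xi> * cnj (\<kappa> \<xi>) * chr (of_int (k' - k) * \<xi>))"
        unfolding i True W_def by (rule wavelet_freq_inner_same_scale)
      also have "\<dots> = (LINT \<xi>|lebesgue. indicator K \<xi> * chr (of_int (k' - k) * \<xi>))"
        by (intro Bochner_Integration.integral_cong) (auto simp: \<kappa>_def indicator_def)
      also have "\<dots> = (if k' - k = 0 then 1 else 0)" by (rule integral_chr_tile[OF tile K bd])
      finally show ?thesis unfolding inner using True i by auto
    next
      case False
      have "L2_inner (W i) (W i') = L2_inner (\<lambda>\<xi>. 0) (\<lambda>\<xi>. 0)"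
        unfolding L2_inner_def
      proof (rule integral_cong_AE)
        show "AE \<xi> in lebesgue. W i \<xi> * cnj (W i' \<xi>) = 0 * cnj 0"
          using dtile
        proof eventually_elim
          case (elim \<xi>)
          have "\<not> (\<xi> / 2 powi j \<in> K \<and> \<xi> / 2 powi j' \<in> K)"
          proof
            assume 1: "\<xi> / 2 powi j \<in> K \<and> \<xi> / 2 powi j' \<in> K"
            then have "\<xi> / 2 powi j > 0" using pos by auto
            moreover have "(2::real) powi j > 0" by simp
            ultimately have "\<xi> > 0" by (simp add: pos_less_divide_eq)
            then show False using elim 1 False by blast
          qed
          then show ?case by (auto simp: W_def wavelet_freq_def i \<kappa>_def)
        qed
      qed (intro borel_measurable_times borel_measurable_cnj L2_measurable WL, simp)
      then show ?thesis unfolding inner using False i by (simp add: L2_inner_def)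
    qed
  qed

  have dilate_span: "(\<lambda>\<xi>. indicator {\<xi>. \<xi> / 2 powi j \<in> K} \<xi> * g \<xi>) \<in> closed_span W" if g: "g \<in> L2" for g and j :: int
  proof (rule closed_span_limit[OF WL])
    have V: "{\<xi>. \<xi> / 2 powi j \<in> K} \<in> sets lebesgue" by (rule sets_dilate[OF K])
    show "(\<lambda>\<xi>. indicator {\<xi>. \<xi> / 2 powi j \<in> K} \<xi> * g \<xi>) \<in> L2" by (rule L2_indicator[OF g V])
    fix \<epsilon> :: real assume "\<epsilon> > 0"
    define s :: real where "s = 2 powr - (of_int j / 2)"
    have s: "s > 0" by (simp add: s_def)
    \<comment> \<open>The restriction of \<open>g\<close> to \<open>2\<^sup>jK\<close>, rescaled isometrically to \<open>K\<close>.\<close>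
    define G where "G = (\<lambda>\<eta>. indicator K \<eta> * (of_real (1 / s) * g (0 + 2 powi j * \<eta>)))"
    have G: "G \<in> L2" unfolding G_def by (intro L2_indicator L2_scale L2_affine g K) simp
    obtain p where p: "trig_poly p" "norm2 (\<lambda>\<eta>. G \<eta> - indicator K \<eta> * p \<eta>) < \<epsilon>"
      using trig_poly_dense_tile[OF tile K bd G _ \<open>\<epsilon> > 0\<close>] by (auto simp: G_def)
    obtain T c where T: "finite T" "p = (\<lambda>x. \<Sum>k\<in>T. c k * chr (of_int k * x))"
      using trig_poly_imp_sum[OF p(1)] by blast
    define h where "h = wavelet_freq (\<lambda>\<eta>. indicator K \<eta> * p \<eta>) (j, 0)"
    have h_eq: "h = (\<lambda>\<xi>. \<Sum>k\<in>T. c k * W (j, - k) \<xi>)"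
      by (simp add: h_def T(2) W_def wavelet_freq_def \<kappa>_def sum_distrib_left mult_ac fun_eq_iff)
    have h_span: "h \<in> closed_span W"
      unfolding h_eq by (rule closed_span_finite_combination[OF WL T(1)])
    have pL: "(\<lambda>\<eta>. indicator K \<eta> * p \<eta>) \<in> L2"
      using bd by (intro L2_indicator_trig_poly[OF p(1) K, of "-real M" "real M"]) auto
    have "indicator {\<xi>. \<xi> / 2 powi j \<in> K} \<xi> * g \<xi> = wavelet_freq G (j, 0) \<xi>" for \<xi>
      using s by (simp add: wavelet_freq_def G_def s_def[symmetric] indicator_def)
    then have "norm2 (\<lambda>\<xi>. indicator {\<xi>. \<xi> / 2 powi j \<in> K} \<xi> * g \<xi> - h \<xi>)
        = norm2 (wavelet_freq (\<lambda>\<eta>. G \<eta> - indicator K \<eta> * p \<eta>) (j, 0))"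
      by (simp add: h_def wavelet_freq_diff[abs_def])
    also have "\<dots> < \<epsilon>" using p(2) by (simp add: norm2_wavelet_freq L2_diff G pL)
    finally show "\<exists>h\<in>closed_span W. norm2 (\<lambda>\<xi>. indicator {\<xi>. \<xi> / 2 powi j \<in> K} \<xi> * g \<xi> - h \<xi>) < \<epsilon>"
      using h_span by blast
  qed

  have complete: "g \<in> closed_span W" if g: "g \<in> L2" and g0: "AE \<xi> in lebesgue. \<xi> \<le> 0 \<longrightarrow> g \<xi> = 0" for g
  proof (rule closed_span_limit[OF WL g])
    \<comment> \<open>The part of \<open>g\<close> that lives on finitely many dilates of \<open>K\<close>.\<close>
    define S where "S = (\<lambda>(N::nat) \<xi>. \<Sum>j\<in>{-int N..int N}. indicator {\<xi>. \<xi> / 2 powi j \<in> K} \<xi> * g \<xi>)"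
    have S_span: "S N \<in> closed_span W" for N
      unfolding S_def by (intro closed_span_sum WL dilate_span g)
    have SL: "S N \<in> L2" for N using S_span by (simp add: closed_span_def)
    have S_eq: "AE \<xi> in lebesgue. \<exists>j. \<forall>N. S N \<xi> = (if j \<in> {-int N..int N} then g \<xi> else 0)"
      using dtile g0
    proof eventually_elim
      case (elim \<xi>)
      show ?case
      proof (cases "\<xi> > 0")
        case True
        then have "\<exists>!j::int. \<xi> / 2 powi j \<in> K" using elim(1) by simp
        then obtain j :: int where j: "\<xi> / 2 powi j \<in> K" "\<forall>i::int. \<xi> / 2 powi i \<in> K \<longrightarrow> i = j"
          by (elim ex1E) blast
        then have "\<xi> / 2 powi i \<in> K \<longleftrightarrow> i = j" for i by blast
        then have "indicator {\<xi>. \<xi> / 2 powi i \<in> K} \<xi> * g \<xi> = (if i = j then g \<xi> else 0)" for i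
          by (simp add: indicator_def)
        then have "S N \<xi> = (if j \<in> {-int N..int N} then g \<xi> else 0)" for N
          unfolding S_def by simp
        then show ?thesis by blast
      next
        case False
        then have "g \<xi> = 0" using elim(2) by simp
        then show ?thesis by (simp add: S_def)
      qed
    qed
    have lim: "(\<lambda>N. norm2 (\<lambda>\<xi>. g \<xi> - S N \<xi>)) \<longlonglongrightarrow> 0"
    proof (rule L2_dominated_convergence[OF g])
      show "(\<lambda>\<xi>. g \<xi> - S N \<xi>) \<in> borel_measurable lebesgue" for N by (intro L2_measurable L2_diff g SL)
      show "AE \<xi> in lebesgue. cmod (g \<xi> - S N \<xi>) \<le> cmod (g \<xi>)" for N
        using S_eq by eventually_elim auto
      show "AE \<xi> in lebesgue. (\<lambda>N. g \<xi> - S N \<xi>) \<longlonglongrightarrow> 0"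
        using S_eq
      proof eventually_elim
        case (elim \<xi>)
        then obtain j where j: "\<And>N. S N \<xi> = (if j \<in> {-int N..int N} then g \<xi> else 0)" by blast
        have "eventually (\<lambda>N. g \<xi> - S N \<xi> = 0) sequentially"
          by (rule eventually_sequentiallyI[of "nat \<bar>j\<bar>"]) (auto simp: j)
        then show ?case by (rule tendsto_eventually)
      qed
    qed
    show "\<exists>h\<in>closed_span W. norm2 (\<lambda>x. g x - h x) < \<epsilon>" if "\<epsilon> > 0" for \<epsilon>
    proof -
      obtain N where "\<And>n. N \<le> n \<Longrightarrow> norm (norm2 (\<lambda>\<xi>. g \<xi> - S n \<xi>) - 0) < \<epsilon>"
        using LIMSEQ_D[OF lim \<open>\<epsilon> > 0\<close>] by blast
      from this[of N] have "norm2 (\<lambda>\<xi>. g \<xi> - S N \<xi>) < \<epsilon>" by simp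
      then show ?thesis using S_span[of N] by (intro bexI)
    qed
  qed

  have dense: "\<exists>F c. finite F \<and> L2_dist_sq f (\<lambda>x. \<Sum>i\<in>F. c i * wavelet_system \<psi> i x) < \<epsilon>"
    if f: "f \<in> H2" and "\<epsilon> > 0" for f \<epsilon>
  proof -
    have fL: "f \<in> L2" using f by (simp add: H2_def)
    obtain r where r: "0 < r" "ennreal r < \<epsilon>"
    proof -
      obtain y where y: "0 < y" "y < \<epsilon>" using dense[OF \<open>\<epsilon> > 0\<close>] by (elim exE conjE)
      then have "y \<noteq> top" by auto
      then have "y = ennreal (enn2real y)" by (simp add: less_top)
      then show thesis using that[of "enn2real y"] y by (metis ennreal_less_zero_iff)
    qed
    have "fourier f \<in> closed_span W"
      using f by (intro complete F fL) (simp add: H2_def)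
    then obtain T c where T: "finite T" "norm2 (\<lambda>\<xi>. fourier f \<xi> - (\<Sum>i\<in>T. c i * W i \<xi>)) < sqrt r"
    proof -
      have "\<forall>\<epsilon>>0. \<exists>T c. finite T \<and> norm2 (\<lambda>\<xi>. fourier f \<xi> - (\<Sum>i\<in>T. c i * W i \<xi>)) < \<epsilon>"
        using \<open>fourier f \<in> closed_span W\<close> by (simp add: closed_span_def)
      moreover have "sqrt r > 0" using r(1) by simp
      ultimately show thesis using that by blast
    qed
    have sL: "(\<lambda>x. \<Sum>i\<in>T. c i * wavelet_system \<psi> i x) \<in> L2"
      by (intro L2_sum L2_scale wavelet_system_L2 L)
    have "norm2 (\<lambda>x. f x - (\<Sum>i\<in>T. c i * wavelet_system \<psi> i x))
        = norm2 (\<lambda>\<xi>. fourier f \<xi> - (\<Sum>i\<in>T. c i * wavelet_freq (fourier \<psi>) i \<xi>))"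
      by (rule norm2_approx_fourier[OF L fL T(1)])
    also have "\<dots> = norm2 (\<lambda>\<xi>. fourier f \<xi> - (\<Sum>i\<in>T. c i * W i \<xi>))"
    proof (rule norm2_cong_AE)
      show "AE \<xi> in lebesgue. cmod (fourier f \<xi> - (\<Sum>i\<in>T. c i * wavelet_freq (fourier \<psi>) i \<xi>))
          = cmod (fourier f \<xi> - (\<Sum>i\<in>T. c i * W i \<xi>))"
        using W by eventually_elim (simp only:)
    qed (intro L2_measurable L2_diff L2_sum L2_scale F fL WL wavelet_freq_L2 L)+
    finally have "(norm2 (\<lambda>x. f x - (\<Sum>i\<in>T. c i * wavelet_system \<psi> i x)))\<^sup>2 < (sqrt r)\<^sup>2"
      using T(2) by (intro power_strict_mono) auto
    then have "L2_dist_sq f (\<lambda>x. \<Sum>i\<in>T. c i * wavelet_system \<psi> i x) < ennreal r"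
      unfolding L2_dist_sq_eq[OF fL sL] using r(1) by (intro ennreal_lessI) auto
    then show ?thesis using T(1) r(2) by (meson less_trans)
  qed

  have "fourier \<psi> \<xi> = 0 \<longleftrightarrow> \<xi> \<notin> K" if "fourier \<psi> \<xi> = \<kappa> \<xi>" for \<xi>
    using that by (simp add: \<kappa>_def indicator_def)
  with ft have "AE \<xi> in lebesgue. \<xi> \<le> 0 \<longrightarrow> fourier \<psi> \<xi> = 0"
    using pos by (auto elim!: eventually_mono)
  then have "\<psi> \<in> H2" using L by (simp add: H2_def)
  then have "H2_wavelet \<psi>"
    unfolding H2_wavelet_def orthonormal_basis_def using in_H2 orthonormal dense by blast
  moreover have "AE \<xi> in lebesgue. cmod (fourier \<psi> \<xi>) = indicator K \<xi>"
    using ft by eventually_elim (simp add: \<kappa>_def indicator_def)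
  ultimately show ?thesis using K pos unfolding H2_wavelet_set_def by blast
qed

section \<open>Dyadic dilations as translations of the logarithm\<close>

lemma powr_mem_Icc_iff:
  fixes n :: int
  assumes "0 < p" "0 < q"
  shows "2 powr x * 2 powi n \<in> {p..q} \<longleftrightarrow> x + of_int n \<in> {log 2 p..log 2 q}"
proof -
  have "2 powr x * 2 powi n = 2 powr (x + of_int n)" by (simp add: powr_add powr_real_of_int')
  then show ?thesis using assms by (simp add: log_le_iff le_log_iff)
qed

lemma three_intervals_log_iff:
  fixes n :: int
  assumes "0 < p1" "0 < q1" "0 < p2" "0 < q2" "0 < p3" "0 < q3"
  shows "2 powr x * 2 powi n \<in> {p1..q1} \<union> {p2..q2} \<union> {p3..q3}
    \<longleftrightarrow> x + of_int n \<in> {log 2 p1..log 2 q1} \<union> {log 2 p2..log 2 q2} \<union> {log 2 p3..log 2 q3}"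
  using assms powr_mem_Icc_iff by (simp only: Un_iff)

text \<open>
  Substituting \<open>\<xi> = 2 powr x\<close>; the sign of the exponent is immaterial as it runs through all integers.
\<close>

lemma dilation_tile_log:
  fixes K L :: "real set"
  assumes L: "\<And>x n. 2 powr x * 2 powi n \<in> K \<longleftrightarrow> x + of_int n \<in> L"
  shows "(\<exists>!j::int. 2 powr x / 2 powi j \<in> K) \<longleftrightarrow> (\<exists>!n::int. x + of_int n \<in> L)"
proof -
  have "2 powr x / 2 powi j \<in> K \<longleftrightarrow> x + of_int (- j) \<in> L" for j :: int
    unfolding L[symmetric] by (simp add: power_int_minus divide_inverse)
  then show ?thesis using ex1_int_minus[of "\<lambda>n. x + of_int n \<in> L"] by simp
qed

text \<open>
  The logarithm is differentiable on the half-line and so maps null sets to null sets.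
\<close>

lemma AE_dilation_tile_imp_log:
  fixes K L :: "real set"
  assumes L: "\<And>x n. 2 powr x * 2 powi n \<in> K \<longleftrightarrow> x + of_int n \<in> L"
    and "AE \<xi> in lebesgue. \<xi> > 0 \<longrightarrow> (\<exists>!j::int. \<xi> / 2 powi j \<in> K)"
  shows "AE x in lebesgue. \<exists>!n::int. x + of_int n \<in> L"
proof -
  let ?S = "{\<xi>. \<not> (\<xi> > 0 \<longrightarrow> (\<exists>!j::int. \<xi> / 2 powi j \<in> K))}"
  obtain N where "?S \<subseteq> N" "N \<in> null_sets lebesgue"
    using assms(2) unfolding eventually_ae_filter by auto
  then have "negligible ?S"
    using negligible_subset by (auto simp: negligible_iff_null_sets[symmetric])
  then have "negligible (log 2 ` ?S)"
  proof (rule negligible_differentiable_image_negligible[rotated])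
    show "log 2 differentiable_on ?S"
      unfolding differentiable_on_def
    proof
      fix \<xi> assume "\<xi> \<in> ?S"
      then have "(log 2 has_real_derivative 1 / (ln 2 * \<xi>)) (at \<xi>)"
        by (intro DERIV_log[THEN DERIV_cong]) auto
      then show "log 2 differentiable at \<xi> within ?S"
        using real_differentiable_def differentiable_at_withinI by blast
    qed
  qed simp
  moreover have "{x. \<not> (\<exists>!n::int. x + of_int n \<in> L)} \<subseteq> log 2 ` ?S"
  proof
    fix x assume "x \<in> {x. \<not> (\<exists>!n::int. x + of_int n \<in> L)}"
    then have "2 powr x \<in> ?S" by (simp add: dilation_tile_log[OF L])
    then show "x \<in> log 2 ` ?S" by (rule rev_image_eqI) simp
  qed
  ultimately have "{x. \<not> (\<exists>!n::int. x + of_int n \<in> L)} \<in> null_sets lebesgue"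
    using negligible_subset negligible_iff_null_sets by blast
  then show ?thesis by (rule AE_I') auto
qed

lemma AE_dilation_tile_of_log:
  fixes K L :: "real set"
  assumes L: "\<And>x n. 2 powr x * 2 powi n \<in> K \<longleftrightarrow> x + of_int n \<in> L"
    and "countable {x. \<not> (\<exists>!n::int. x + of_int n \<in> L)}"
  shows "AE \<xi> in lebesgue. \<xi> > 0 \<longrightarrow> (\<exists>!j::int. \<xi> / 2 powi j \<in> K)"
proof (rule AE_of_countable, rule countable_subset)
  show "countable ((\<lambda>x. 2 powr x) ` {x. \<not> (\<exists>!n::int. x + of_int n \<in> L)})"
    using assms(2) by (rule countable_image)
  show "{\<xi>. \<not> (\<xi> > 0 \<longrightarrow> (\<exists>!j::int. \<xi> / 2 powi j \<in> K))} \<subseteq> (\<lambda>x. 2 powr x) ` {x. \<not> (\<exists>!n::int. x + of_int n \<in> L)}"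
  proof
    fix \<xi> assume \<xi>: "\<xi> \<in> {\<xi>. \<not> (\<xi> > 0 \<longrightarrow> (\<exists>!j::int. \<xi> / 2 powi j \<in> K))}"
    then have "\<xi> = 2 powr (log 2 \<xi>)" by simp
    with \<xi> show "\<xi> \<in> (\<lambda>x. 2 powr x) ` {x. \<not> (\<exists>!n::int. x + of_int n \<in> L)}"
      using dilation_tile_log[OF L, of "log 2 \<xi>"] by (intro rev_image_eqI[of "log 2 \<xi>"]) simp_all
  qed
qed

lemma log_eq_iff_scaled:
  assumes "0 < x" "0 < y"
  shows "log 2 x - real m = log 2 y - real n \<longleftrightarrow> x / 2 ^ m = y / 2 ^ n"
    and "log 2 x = log 2 y - real n \<longleftrightarrow> x = y / 2 ^ n"
    and "log 2 x - real m = log 2 y + 1 \<longleftrightarrow> x / 2 ^ m = 2 * y"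
proof -
  have d: "log 2 (z / 2 ^ k) = log 2 z - real k" if "0 < z" for z k
    using that by (simp add: log_divide log_nat_power)
  have inj: "log 2 a = log 2 b \<longleftrightarrow> a = b" if "0 < a" "0 < b" for a b :: real
  proof
    assume "log 2 a = log 2 b"
    then have "2 powr log 2 a = 2 powr log 2 b" by (simp only:)
    then show "a = b" using that by simp
  qed simp
  show "log 2 x - real m = log 2 y - real n \<longleftrightarrow> x / 2 ^ m = y / 2 ^ n"
    using inj[of "x / 2 ^ m" "y / 2 ^ n"] assms by (simp add: d)
  show "log 2 x = log 2 y - real n \<longleftrightarrow> x = y / 2 ^ n"
    using inj[of "x" "y / 2 ^ n"] assms by (simp add: d)
  have "log 2 (2 * y) = log 2 y + 1" using assms by (simp add: log_mult)
  then show "log 2 x - real m = log 2 y + 1 \<longleftrightarrow> x / 2 ^ m = 2 * y"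
    using inj[of "x / 2 ^ m" "2 * y"] assms by (simp add: d)
qed

lemma translates_consecutive_log_iff:
  assumes "0 < p1" "0 < q1" "0 < p2" "0 < q2" "0 < p3" "0 < q3"
  shows "translates_consecutive (log 2 p1) (log 2 q1) (log 2 p2) (log 2 q2) (log 2 p3) (log 2 q3) r s
    \<longleftrightarrow> q1 = p2 / 2 ^ r \<and> q2 / 2 ^ r = p3 / 2 ^ s \<and> q3 / 2 ^ s = 2 * p1"
  using assms by (simp only: translates_consecutive_def log_eq_iff_scaled)

section \<open>Three-interval wavelet sets\<close>

text \<open>
  The three equations between end points already imply the equation between sets.
\<close>

lemma translate_tiling_iff:
  assumes "p1 < q1" "p2 < q2" "p3 < (q3 :: real)"
  shows "({p1..q1} \<union> (\<lambda>x. x - real k) ` {p2..q2} \<union> (\<lambda>x. x - real l) ` {p3..q3} = {p1..p1 + 1} \<and>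
      q1 = p2 - real k \<and> q2 - real k = p3 - real l \<and> q3 - real l = p1 + 1)
    \<longleftrightarrow> translates_consecutive p1 q1 p2 q2 p3 q3 k l"
proof -
  have "{p1..q1} \<union> {p2 - real k..q2 - real k} \<union> {p3 - real l..q3 - real l} = {p1..p1 + 1}"
    if "q1 = p2 - real k" "q2 - real k = p3 - real l" "q3 - real l = p1 + 1"
    using that assms by auto
  moreover have img: "(\<lambda>x. x - real n) ` {a..b} = {a - real n..b - real n}" for a b n
    by simp
  ultimately show ?thesis unfolding translates_consecutive_def img by blast
qed

lemma dilate_tiling_iff:
  assumes "0 < p1" "p1 < q1" "0 < p2" "p2 < q2" "0 < p3" "p3 < q3"
  shows "({p1..q1} \<union> (\<lambda>x. x / 2 ^ r) ` {p2..q2} \<union> (\<lambda>x. x / 2 ^ s) ` {p3..q3} = {p1..2 * p1} \<and>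
      q1 = p2 / 2 ^ r \<and> q2 / 2 ^ r = p3 / 2 ^ s \<and> q3 / 2 ^ s = 2 * p1)
    \<longleftrightarrow> translates_consecutive (log 2 p1) (log 2 q1) (log 2 p2) (log 2 q2) (log 2 p3) (log 2 q3) r s"
proof -
  have img: "(\<lambda>x. x / 2 ^ n) ` {a..b} = {a / 2 ^ n..b / 2 ^ n}" if "a < b" for a b :: real and n :: nat
    using that by (simp add: image_divide_atLeastAtMost)
  have "{p1..q1} \<union> {p2 / 2 ^ r..q2 / 2 ^ r} \<union> {p3 / 2 ^ s..q3 / 2 ^ s} = {p1..2 * p1}"
    if "q1 = p2 / 2 ^ r" "q2 / 2 ^ r = p3 / 2 ^ s" "q3 / 2 ^ s = 2 * p1"
  proof -
    have "p2 / 2 ^ r \<le> q2 / 2 ^ r" "p3 / 2 ^ s \<le> q3 / 2 ^ s"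
      using assms by (auto intro: divide_right_mono)
    then show ?thesis using that assms(2) by auto
  qed
  moreover have "translates_consecutive (log 2 p1) (log 2 q1) (log 2 p2) (log 2 q2) (log 2 p3) (log 2 q3) r s
      \<longleftrightarrow> q1 = p2 / 2 ^ r \<and> q2 / 2 ^ r = p3 / 2 ^ s \<and> q3 / 2 ^ s = 2 * p1"
    using assms by (intro translates_consecutive_log_iff) auto
  ultimately show ?thesis unfolding img[OF assms(4)] img[OF assms(6)] by blast
qed

theorem corollary13:
  fixes p1 q1 p2 q2 p3 q3 :: real and K :: "real set"
  assumes "0 < p1" "p1 < q1" "q1 < p2" "p2 < q2" "q2 < p3" "p3 < q3"
    and "K = {p1..q1} \<union> {p2..q2} \<union> {p3..q3}"
  shows "H2_wavelet_set K \<longleftrightarrow>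
    (\<exists>r s k l :: nat.
       (({p1..q1} \<union> (\<lambda>x. x - real k) ` {p2..q2} \<union> (\<lambda>x. x - real l) ` {p3..q3} = {p1..p1 + 1} \<and>
         q1 = p2 - real k \<and> q2 - real k = p3 - real l \<and> q3 - real l = p1 + 1) \<or>
        ({p1..q1} \<union> (\<lambda>x. x - real l) ` {p3..q3} \<union> (\<lambda>x. x - real k) ` {p2..q2} = {p1..p1 + 1} \<and>
         q1 = p3 - real l \<and> q3 - real l = p2 - real k \<and> q2 - real k = p1 + 1)) \<and>
       (({p1..q1} \<union> (\<lambda>x. x / 2 ^ r) ` {p2..q2} \<union> (\<lambda>x. x / 2 ^ s) ` {p3..q3} = {p1..2 * p1} \<and>
         q1 = p2 / 2 ^ r \<and> q2 / 2 ^ r = p3 / 2 ^ s \<and> q3 / 2 ^ s = 2 * p1) \<or>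
        ({p1..q1} \<union> (\<lambda>x. x / 2 ^ s) ` {p3..q3} \<union> (\<lambda>x. x / 2 ^ r) ` {p2..q2} = {p1..2 * p1} \<and>
         q1 = p3 / 2 ^ s \<and> q3 / 2 ^ s = p2 / 2 ^ r \<and> q2 / 2 ^ r = 2 * p1)))"
proof -
  note ord = assms(1-6)
  have pos: "0 < p2" "0 < p3" "0 < q1" "0 < q2" "0 < q3" using ord by auto
  \<comment> \<open>The logarithms of the end points are ordered like the end points, so the results on three
    intervals apply to \<open>log 2 ` K\<close> as they do to \<open>K\<close>.\<close>
  define a1 b1 a2 b2 a3 b3 where logs: "a1 = log 2 p1" "b1 = log 2 q1" "a2 = log 2 p2" "b2 = log 2 q2"
    "a3 = log 2 p3" "b3 = log 2 q3"
  define L where "L = {a1..b1} \<union> {a2..b2} \<union> {a3..b3}"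
  have ord_log: "a1 < b1" "b1 < a2" "a2 < b2" "b2 < a3" "a3 < b3"
    using ord pos by (simp_all add: logs)
  have L: "2 powr x * 2 powi n \<in> K \<longleftrightarrow> x + of_int n \<in> L" for x and n :: int
    unfolding assms(7) L_def logs using ord(1) pos by (intro three_intervals_log_iff)
  obtain M where "max q3 (max \<bar>a1\<bar> \<bar>b3\<bar>) < real M" using reals_Archimedean2 by blast
  then have bd: "K \<subseteq> {-real M..<real M}" "L \<subseteq> {-real M..<real M}"
    using ord ord_log by (auto simp: assms(7) L_def)
  have sets: "K \<in> sets lebesgue" "L \<in> sets lebesgue" by (auto simp: assms(7) L_def)
  have Kpos: "K \<subseteq> {0<..}" using ord by (auto simp: assms(7))
  let ?T = "\<lambda>k l. translates_consecutive p1 q1 p2 q2 p3 q3 k l \<or> translates_consecutive p1 q1 p3 q3 p2 q2 l k"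
  let ?D = "\<lambda>r s. translates_consecutive a1 b1 a2 b2 a3 b3 r s \<or> translates_consecutive a1 b1 a3 b3 a2 b2 s r"
  have "H2_wavelet_set K \<longleftrightarrow> (\<exists>r s k l. ?T k l \<and> ?D r s)"
  proof
    assume "H2_wavelet_set K"
    then obtain \<psi> where \<psi>: "H2_wavelet \<psi>" "AE \<xi> in lebesgue. cmod (fourier \<psi> \<xi>) = indicator K \<xi>"
      unfolding H2_wavelet_set_def by blast
    from three_intervals_consecutive[OF ord(2-6) H2_wavelet_translates_orthonormal[OF \<psi> sets(1), unfolded assms(7)]]
    obtain k l where T: "?T k l" by (elim exE)
    have "AE x in lebesgue. \<exists>!n::int. x + of_int n \<in> K"
      unfolding assms(7) by (rule AE_of_countable[OF three_intervals_tile_exists[OF ord(2,4,6) T]])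
    from H2_wavelet_dilation_tile[OF \<psi> sets(1) bd(1) this]
    have "AE x in lebesgue. \<exists>!n::int. x + of_int n \<in> L" by (rule AE_dilation_tile_imp_log[OF L])
    from three_intervals_consecutive[OF ord_log integral_chr_tile[OF this sets(2) bd(2), unfolded L_def]]
    obtain r s where "?D r s" by (elim exE)
    with T show "\<exists>r s k l. ?T k l \<and> ?D r s" by blast
  next
    assume "\<exists>r s k l. ?T k l \<and> ?D r s"
    then obtain r s k l where T: "?T k l" and D: "?D r s" by blast
    have "AE x in lebesgue. \<exists>!n::int. x + of_int n \<in> K"
      unfolding assms(7) by (rule AE_of_countable[OF three_intervals_tile_exists[OF ord(2,4,6) T]])
    moreover have "AE \<xi> in lebesgue. \<xi> > 0 \<longrightarrow> (\<exists>!j::int. \<xi> / 2 powi j \<in> K)"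
      using AE_dilation_tile_of_log[OF L] three_intervals_tile_exists[OF ord_log(1,3,5) D]
      by (simp only: L_def)
    ultimately show "H2_wavelet_set K" by (rule H2_wavelet_set_of_tiles[OF sets(1) Kpos bd(1)])
  qed
  then show ?thesis
    unfolding translate_tiling_iff[OF ord(2,4,6)] translate_tiling_iff[OF ord(2,6,4)]
      dilate_tiling_iff[OF ord(1,2) pos(1) ord(4) pos(2) ord(6)]
      dilate_tiling_iff[OF ord(1,2) pos(2) ord(6) pos(1) ord(4)] logs[symmetric] .
qed

end
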